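(* Let $d,n\in\mathbb{N}$ and $\varepsilon\le\alpha\le 1$ (with $\varepsilon n$ an integer). Let $\mathcal{D}_0$ be the distribution of $n$ i.i.d. samples from $\mathcal{N}(0,I_d)$. For a parameter $\beta\ge 0$, let $\mathcal{D}_1=\mathcal{D}_1(\beta)$ be the distribution of $(X_1,\dots,X_n)$ generated as follows: (1) select a uniformly random subset $A\subset[n]$ of size $\varepsilon n$; (2) draw $\{X_i\}_{i\in A}$ i.i.d. from $\mathcal{N}(0,I_d)$ and set $\mathbf{R}_A=\sum_{i\in A}X_i$; (3) draw $z\sim\mathcal{N}(0,\frac{\alpha^2}{d}I_d)$; (4) set $\mu=-\beta\mathbf{R}_A-z$ and draw $\{X_i\}_{i\in[n]\setminus A}$ i.i.d. from $\mathcal{N}(\mu,I_d)$. There is a sufficiently small absolute constant $c>0$ such that the following holds: if $n\le c\cdot\min\left(\frac{d^{2/3}\varepsilon^{2/3}}{\alpha^{8/3}},\frac{d\varepsilon}{\alpha^2}\right)$ and $n\ge\frac{\sqrt d}{\alpha^2}+\frac{d\varepsilon^3}{\alpha^4}$, then for an appropriate choice of $\beta$ (depending on $\varepsilon,\alpha,d,n$) we have $d_{TV}(\mathcal{D}_0,\mathcal{D}_1)\le 0.1$.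
   Context: $d_{TV}$ denotes total variation distance. *)

theory Defs
  imports "HOL-Probability.Probability"
begin

text \<open>
  The constant of the theorem is uniform in the dimension, so vectors in dimension \<open>d\<close> are
  (extensional) functions on the index set \<open>{1..d}\<close>, and a tuple of \<open>n\<close> such vectors is an
  (extensional) function on \<open>{1..n}\<close>; \<open>X i j\<close> is the \<open>j\<close>-th coordinate of the \<open>i\<close>-th sample.
\<close>

abbreviation euclid :: "nat \<Rightarrow> (nat \<Rightarrow> real) measure" where
  "euclid d \<equiv> \<Pi>\<^sub>M j\<in>{1..d}. borel"

abbreviation samples :: "nat \<Rightarrow> nat \<Rightarrow> (nat \<Rightarrow> nat \<Rightarrow> real) measure" where
  "samples d n \<equiv> \<Pi>\<^sub>M i\<in>{1..n}. euclid d"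

text \<open>The second argument of \<open>normal_density\<close> is the standard deviation; here \<open>v\<close> is the
  variance, so that \<open>gaussian d m v\<close> is \<open>\<N>(m, v I\<^sub>d)\<close> for \<open>v > 0\<close>.\<close>

definition gaussian :: "nat \<Rightarrow> (nat \<Rightarrow> real) \<Rightarrow> real \<Rightarrow> (nat \<Rightarrow> real) measure" where
  "gaussian d m v = (\<Pi>\<^sub>M j\<in>{1..d}. density lborel (\<lambda>x. ennreal (normal_density (m j) (sqrt v) x)))"

definition null_dist :: "nat \<Rightarrow> nat \<Rightarrow> (nat \<Rightarrow> nat \<Rightarrow> real) measure" where
  "null_dist d n = (\<Pi>\<^sub>M i\<in>{1..n}. gaussian d (\<lambda>_. 0) 1)"

text \<open>\<open>alt_dist\<close> is only meaningful when \<open>\<epsilon> * n\<close> is an integer between 0 and \<open>n\<close>;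
  then \<open>nat \<lfloor>\<epsilon> * real n\<rfloor>\<close> is that integer.\<close>

definition alt_dist ::
    "nat \<Rightarrow> nat \<Rightarrow> real \<Rightarrow> real \<Rightarrow> real \<Rightarrow> (nat \<Rightarrow> nat \<Rightarrow> real) measure" where
  "alt_dist d n \<epsilon> \<alpha> \<beta> =
    do {
      A \<leftarrow> uniform_count_measure {A. A \<subseteq> {1..n} \<and> card A = nat \<lfloor>\<epsilon> * real n\<rfloor>};
      X \<leftarrow> (\<Pi>\<^sub>M i\<in>A. gaussian d (\<lambda>_. 0) 1);
      z \<leftarrow> gaussian d (\<lambda>_. 0) (\<alpha>\<^sup>2 / real d);
      Y \<leftarrow> (\<Pi>\<^sub>M i\<in>{1..n} - A. gaussian d (\<lambda>j. - \<beta> * (\<Sum>i\<in>A. X i j) - z j) 1);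
      return (samples d n) (merge A ({1..n} - A) (X, Y))
    }"

definition tv_dist :: "'a measure \<Rightarrow> 'a measure \<Rightarrow> real" where
  "tv_dist M N = (SUP E\<in>sets M. \<bar>measure M E - measure N E\<bar>)"

end

theory Submission
  imports Defs
begin

text \<open>
  Write \<open>k = \<epsilon> n\<close>, \<open>m = n - k\<close>, \<open>\<tau> = \<alpha>\<^sup>2 / d\<close>, and choose \<open>\<beta>\<close> as the smaller root of
  \<open>\<beta>\<^sup>2 k m - 2 \<beta> k + m \<tau> = 0\<close>, which makes the variance of \<open>\<Sum>i. X i j\<close> the same under both hypotheses.
  Given \<open>A\<close>, the \<open>d\<close> coordinates are independent and centered Gaussian, and for two sets \<open>A\<close>, \<open>A'\<close> with
  \<open>s = card (A \<inter> A') - k\<^sup>2 / n\<close> the likelihood ratios satisfy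
  \<open>E\<^sub>0 [L\<^sub>A L\<^sub>A'] = ((1 - \<beta>\<^sup>2 n s)\<^sup>2 - (2 \<beta> n s / m)\<^sup>2) powr (- d / 2)\<close>,
  which is at most \<open>exp (d \<beta>\<^sup>2 n s + 9 d \<beta>\<^sup>2 s\<^sup>2)\<close>. The centered hypergeometric variable \<open>s\<close> is
  sub-Poissonian with variance proxy \<open>V = k\<^sup>2 / n\<close>. The bounds on \<open>n\<close> make \<open>V\<close>
  large and \<open>d \<beta>\<^sup>2 n\<close> and \<open>d \<beta>\<^sup>2 k\<close> small compared with \<open>1 / sqrt V\<close>, so that the chi-square divergence is at most
  \<open>0.01\<close> and the total variation distance at most \<open>0.1\<close>.
\<close>

section \<open>Quadratic exponentials of standard normal variables\<close>

text \<open>The total sum of the samples is visible without knowledge of \<open>A\<close>. A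
  mismatch of its variance would enter every pair of sets alike and would not average out. After
  matching, the determinant is 1 at \<open>s = 0\<close>, so the exponent has no constant term and
  its leading part is linear in a mean-zero variable: only fluctuations of the overlap cost
  anything. The smaller root is at most 2 \<alpha>^2 / (d \<epsilon>), and the four size conditions
  then have distinct tasks. The bound by d^(2/3) \<epsilon>^(2/3) / \<alpha>^(8/3), when cubed, says
  that V (d \<beta>^2 n)^2 is small, the cost of the linear term. The bound by d \<epsilon> /
  \<alpha>^2 makes \<beta> n small and also d \<beta>^2 V, the cost of the quadratic term. The lower
  bound sqrt d / \<alpha>^2 combined with the first upper bound makes V large, so that
  \<open>s\<close> has Gaussian exponential moments at rates of order 1 / sqrt V. The lower bound d
  \<epsilon>^3 / \<alpha>^4 combined with the second upper bound makes \<epsilon> small, so that m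
  is at least n / 2.\<close>

definition stdnormal :: "real measure" where
  "stdnormal = density lborel (\<lambda>x. ennreal (normal_density 0 1 x))"

lemma space_stdnormal [simp]: "space stdnormal = UNIV"
  by (simp add: stdnormal_def)

lemma sets_stdnormal [simp, measurable_cong]: "sets stdnormal = sets borel"
  by (simp add: stdnormal_def)

lemma prob_space_stdnormal: "prob_space stdnormal"
  unfolding stdnormal_def by (rule prob_space_normal_density) simp

interpretation stdnormal: prob_space stdnormal
  by (rule prob_space_stdnormal)

interpretation stdnormal_prod: product_prob_space "\<lambda>_. stdnormal" UNIV
  by (intro product_prob_spaceI prob_space_stdnormal)

text \<open>The rotation splits into affine substitutions in one variable: \<open>y\<close> becomes
  \<open>(c * u - x) / s\<close> for fixed \<open>u\<close>, the order of integration is exchanged,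
  and \<open>u\<close> becomes \<open>c * x + s * y\<close> for fixed \<open>x\<close>. The factors
  |1 / s| and |s| cancel. For \<open>s = 0\<close> only sign changes remain.\<close>

lemma nn_integral_lborel_rotation:
  fixes K :: "real \<times> real \<Rightarrow> ennreal"
  assumes K [measurable]: "K \<in> borel_measurable (borel \<Otimes>\<^sub>M borel)" and cs: "c\<^sup>2 + s\<^sup>2 = 1"
  shows "(\<integral>\<^sup>+x. \<integral>\<^sup>+y. K (c * x + s * y, - s * x + c * y) \<partial>lborel \<partial>lborel)
    = (\<integral>\<^sup>+x. \<integral>\<^sup>+y. K (x, y) \<partial>lborel \<partial>lborel)"
proof (cases "s = 0")
  case True
  with cs have c: "c \<noteq> 0" "\<bar>c\<bar> = 1" by (auto simp: power2_eq_1_iff)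
  have "(\<integral>\<^sup>+x. \<integral>\<^sup>+y. K (x, y) \<partial>lborel \<partial>lborel) = (\<integral>\<^sup>+x. \<integral>\<^sup>+y. K (x, 0 + c * y) \<partial>lborel \<partial>lborel)"
    by (subst nn_integral_real_affine[OF _ c(1), of _ 0]) (auto simp: c)
  also have "\<dots> = (\<integral>\<^sup>+x. \<integral>\<^sup>+y. K (0 + c * x, 0 + c * y) \<partial>lborel \<partial>lborel)"
    by (subst nn_integral_real_affine[OF _ c(1), of _ 0]) (auto simp: c)
  finally show ?thesis using True by simp
next
  case False
  have inner: "(\<integral>\<^sup>+u. K (u, (c * u - x) / s) \<partial>lborel)
      = \<bar>s\<bar> * (\<integral>\<^sup>+y. K (c * x + s * y, - s * x + c * y) \<partial>lborel)" for x
  proof -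
    have "(c * (c * x + s * y) - x) / s = - s * x + c * y" for y
    proof -
      have "c * (c * x + s * y) - x = (c\<^sup>2 - 1) * x + c * s * y"
        by (simp add: algebra_simps power2_eq_square)
      also have "c\<^sup>2 - 1 = - s\<^sup>2" using cs by simp
      finally show ?thesis using False by (simp add: field_simps power2_eq_square)
    qed
    then show ?thesis
      by (subst nn_integral_real_affine[OF _ False, of _ "c * x"]) auto
  qed
  have "(\<integral>\<^sup>+x. \<integral>\<^sup>+y. K (x, y) \<partial>lborel \<partial>lborel)
      = (\<integral>\<^sup>+u. \<bar>- 1 / s\<bar> * (\<integral>\<^sup>+x. K (u, c * u / s + (- 1 / s) * x) \<partial>lborel) \<partial>lborel)"
    using False by (intro nn_integral_cong nn_integral_real_affine) auto
  also have "\<dots> = \<bar>1 / s\<bar> * (\<integral>\<^sup>+u. \<integral>\<^sup>+x. K (u, (c * u - x) / s) \<partial>lborel \<partial>lborel)"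
    by (subst nn_integral_cmult) (auto simp: diff_divide_distrib)
  also have "(\<integral>\<^sup>+u. \<integral>\<^sup>+x. K (u, (c * u - x) / s) \<partial>lborel \<partial>lborel)
      = (\<integral>\<^sup>+x. \<integral>\<^sup>+u. K (u, (c * u - x) / s) \<partial>lborel \<partial>lborel)"
    by (rule lborel_pair.Fubini') measurable
  also have "\<dots> = \<bar>s\<bar> * (\<integral>\<^sup>+x. \<integral>\<^sup>+y. K (c * x + s * y, - s * x + c * y) \<partial>lborel \<partial>lborel)"
    unfolding inner by (rule nn_integral_cmult) measurable
  also have "\<bar>1 / s\<bar> * (\<bar>s\<bar> * (\<integral>\<^sup>+x. \<integral>\<^sup>+y. K (c * x + s * y, - s * x + c * y) \<partial>lborel \<partial>lborel))
      = (\<integral>\<^sup>+x. \<integral>\<^sup>+y. K (c * x + s * y, - s * x + c * y) \<partial>lborel \<partial>lborel)"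
    using False by (simp add: mult.assoc[symmetric] ennreal_mult[symmetric] flip: abs_mult)
  finally show ?thesis ..
qed

lemma nn_integral_stdnormal:
  "f \<in> borel_measurable borel \<Longrightarrow>
    (\<integral>\<^sup>+x. f x \<partial>stdnormal) = (\<integral>\<^sup>+x. ennreal (normal_density 0 1 x) * f x \<partial>lborel)"
  unfolding stdnormal_def by (rule nn_integral_density) auto

text \<open>The joint density depends only on x^2 + y^2, so it can be moved into the integrand and
  is unaffected by the rotation there.\<close>

lemma nn_integral_stdnormal_rotation:
  fixes F :: "real \<times> real \<Rightarrow> ennreal"
  assumes F [measurable]: "F \<in> borel_measurable (borel \<Otimes>\<^sub>M borel)" and cs: "c\<^sup>2 + s\<^sup>2 = 1"
  shows "(\<integral>\<^sup>+x. \<integral>\<^sup>+y. F (c * x + s * y, - s * x + c * y) \<partial>stdnormal \<partial>stdnormal)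
    = (\<integral>\<^sup>+x. \<integral>\<^sup>+y. F (x, y) \<partial>stdnormal \<partial>stdnormal)"
proof -
  define K where "K = (\<lambda>(x, y). ennreal (normal_density 0 1 x * normal_density 0 1 y) * F (x, y))"
  have K [measurable]: "K \<in> borel_measurable (borel \<Otimes>\<^sub>M borel)"
    unfolding K_def by measurable
  have unfold: "(\<integral>\<^sup>+x. \<integral>\<^sup>+y. G x y \<partial>stdnormal \<partial>stdnormal)
      = (\<integral>\<^sup>+x. \<integral>\<^sup>+y. ennreal (normal_density 0 1 x * normal_density 0 1 y) * G x y \<partial>lborel \<partial>lborel)"
    if [measurable]: "case_prod G \<in> borel_measurable (borel \<Otimes>\<^sub>M borel)" for G
    by (simp add: nn_integral_stdnormal ennreal_mult mult.assoc nn_integral_cmult)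
  have rot: "(c * x + s * y)\<^sup>2 + (- s * x + c * y)\<^sup>2 = x\<^sup>2 + y\<^sup>2" for x y
  proof -
    have "(c * x + s * y)\<^sup>2 + (- s * x + c * y)\<^sup>2 = (c\<^sup>2 + s\<^sup>2) * (x\<^sup>2 + y\<^sup>2)"
      by (simp add: power2_eq_square algebra_simps)
    then show ?thesis using cs by simp
  qed
  have dens: "normal_density 0 1 u * normal_density 0 1 v = 1 / (2 * pi) * exp (- (u\<^sup>2 + v\<^sup>2) / 2)" for u v
    by (simp add: normal_density_def exp_add[symmetric] add_divide_distrib)
  have "(\<integral>\<^sup>+x. \<integral>\<^sup>+y. F (c * x + s * y, - s * x + c * y) \<partial>stdnormal \<partial>stdnormal)
      = (\<integral>\<^sup>+x. \<integral>\<^sup>+y. K (c * x + s * y, - s * x + c * y) \<partial>lborel \<partial>lborel)"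
    by (subst unfold) (simp_all only: K_def prod.case dens rot, measurable)
  also have "\<dots> = (\<integral>\<^sup>+x. \<integral>\<^sup>+y. K (x, y) \<partial>lborel \<partial>lborel)"
    by (rule nn_integral_lborel_rotation[OF K cs])
  also have "\<dots> = (\<integral>\<^sup>+x. \<integral>\<^sup>+y. F (x, y) \<partial>stdnormal \<partial>stdnormal)"
    by (subst unfold) (simp_all add: K_def)
  finally show ?thesis .
qed

text \<open>Supplies the rotation that turns \<open>(a, b)\<close> onto an axis; at the origin,
  where no direction is distinguished, any unit vector serves.\<close>

lemma polar_coordinates_exist:
  fixes a b :: real
  obtains r c s where "a = r * c" "b = r * s" "c\<^sup>2 + s\<^sup>2 = 1" "r\<^sup>2 = a\<^sup>2 + b\<^sup>2"
proof (cases "a = 0 \<and> b = 0")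
  case True
  then show ?thesis by (intro that[of 0 1 0]) auto
next
  case False
  then have "a\<^sup>2 + b\<^sup>2 > 0" by (simp add: sum_power2_gt_zero_iff)
  then have "sqrt (a\<^sup>2 + b\<^sup>2) > 0" by simp
  with False show ?thesis
    by (intro that[of "sqrt (a\<^sup>2 + b\<^sup>2)" "a / sqrt (a\<^sup>2 + b\<^sup>2)" "b / sqrt (a\<^sup>2 + b\<^sup>2)"])
       (auto simp: power_divide add_divide_distrib[symmetric])
qed

text \<open>Adding one more independent normal variable is absorbed by two plane rotations.\<close>

lemma stdnormal_linear_forms:
  fixes p q :: "'i \<Rightarrow> real"
  assumes "finite I"
  shows "\<exists>a b c. a\<^sup>2 = (\<Sum>i\<in>I. (p i)\<^sup>2) \<and> a * b = (\<Sum>i\<in>I. p i * q i) \<and> b\<^sup>2 + c\<^sup>2 = (\<Sum>i\<in>I. (q i)\<^sup>2) \<and>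
    (\<forall>F \<in> borel_measurable (borel \<Otimes>\<^sub>M borel).
      (\<integral>\<^sup>+x. F (\<Sum>i\<in>I. p i * x i, \<Sum>i\<in>I. q i * x i) \<partial>PiM I (\<lambda>_. stdnormal))
      = (\<integral>\<^sup>+g. \<integral>\<^sup>+h. (F (a * g, b * g + c * h) :: ennreal) \<partial>stdnormal \<partial>stdnormal))"
  using assms
proof (induction I rule: finite_induct)
  case empty
  show ?case
    by (intro exI[of _ 0]) (simp add: stdnormal.emeasure_space_1[simplified] prob_space.emeasure_space_1[OF prob_space_PiM[OF prob_space_stdnormal]])
next
  case (insert i I)
  from insert.IH obtain a b c where
    abc: "a\<^sup>2 = (\<Sum>i\<in>I. (p i)\<^sup>2)" "a * b = (\<Sum>i\<in>I. p i * q i)" "b\<^sup>2 + c\<^sup>2 = (\<Sum>i\<in>I. (q i)\<^sup>2)"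
    and F: "\<And>F. F \<in> borel_measurable (borel \<Otimes>\<^sub>M borel) \<Longrightarrow>
      (\<integral>\<^sup>+x. F (\<Sum>i\<in>I. p i * x i, \<Sum>i\<in>I. q i * x i) \<partial>PiM I (\<lambda>_. stdnormal))
      = (\<integral>\<^sup>+g. \<integral>\<^sup>+h. (F (a * g, b * g + c * h) :: ennreal) \<partial>stdnormal \<partial>stdnormal)" by blast
  \<comment> \<open>The numbers \<open>a\<close>, \<open>b\<close>, \<open>c\<close> form a Cholesky
    factor of the Gram matrix: \<open>a * g\<close> stands for the first form and
    \<open>b * g + c * h\<close> for the second. The first rotation, in the plane of the new
    variable and \<open>g\<close>, concentrates the first form on one variable; the second form then
    has coefficient \<open>b'\<close> on that variable and \<open>c1\<close> on the other.\<close>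
  obtain a' co si where 1: "p i = a' * co" "a = a' * si" "co\<^sup>2 + si\<^sup>2 = 1" "a'\<^sup>2 = (p i)\<^sup>2 + a\<^sup>2"
    by (rule polar_coordinates_exist)
  define b' where "b' = q i * co + b * si"
  define c1 where "c1 = b * co - q i * si"
  \<comment> \<open>The second rotation acts on the two variables outside the first form and merges
    their coefficients \<open>c1\<close> and \<open>c\<close> into \<open>c'\<close>. The variable
    left over no longer occurs and integrates to 1.\<close>
  obtain c' co2 si2 where 2: "c1 = c' * co2" "c = c' * si2" "co2\<^sup>2 + si2\<^sup>2 = 1" "c'\<^sup>2 = c1\<^sup>2 + c\<^sup>2"
    by (rule polar_coordinates_exist)
  have "a' * b' = p i * q i + a * b"
    unfolding b'_def 1 by (simp add: algebra_simps)
  moreover have "b'\<^sup>2 + c'\<^sup>2 = (q i)\<^sup>2 + (b\<^sup>2 + c\<^sup>2)"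
  proof -
    have "b'\<^sup>2 + c'\<^sup>2 = (co\<^sup>2 + si\<^sup>2) * ((q i)\<^sup>2 + b\<^sup>2) + c\<^sup>2"
      unfolding 2(4) b'_def c1_def by (simp add: power2_eq_square algebra_simps)
    then show ?thesis using 1(3) by simp
  qed
  moreover have "(\<integral>\<^sup>+x. G (\<Sum>i\<in>insert i I. p i * x i, \<Sum>i\<in>insert i I. q i * x i) \<partial>PiM (insert i I) (\<lambda>_. stdnormal))
      = (\<integral>\<^sup>+g. \<integral>\<^sup>+h. (G (a' * g, b' * g + c' * h) :: ennreal) \<partial>stdnormal \<partial>stdnormal)"
    if G [measurable]: "G \<in> borel_measurable (borel \<Otimes>\<^sub>M borel)" for G
  proof -
    have upd: "(\<Sum>j\<in>insert i I. r j * (x(i := y)) j) = r i * y + (\<Sum>j\<in>I. r j * x j)" for r x y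
    proof -
      have "(\<Sum>j\<in>I. r j * (x(i := y)) j) = (\<Sum>j\<in>I. r j * x j)"
        by (rule sum.cong) (use insert.hyps in auto)
      then show ?thesis using insert.hyps by simp
    qed
    have "(\<integral>\<^sup>+x. G (\<Sum>i\<in>insert i I. p i * x i, \<Sum>i\<in>insert i I. q i * x i) \<partial>PiM (insert i I) (\<lambda>_. stdnormal))
      = (\<integral>\<^sup>+y. \<integral>\<^sup>+x. G (p i * y + (\<Sum>j\<in>I. p j * x j), q i * y + (\<Sum>j\<in>I. q j * x j))
            \<partial>PiM I (\<lambda>_. stdnormal) \<partial>stdnormal)"
      using insert.hyps by (subst stdnormal_prod.product_nn_integral_insert_rev) (simp_all only: upd, measurable)
    also have "\<dots> = (\<integral>\<^sup>+y. \<integral>\<^sup>+g. \<integral>\<^sup>+h. G (p i * y + a * g, q i * y + (b * g + c * h))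
            \<partial>stdnormal \<partial>stdnormal \<partial>stdnormal)"
      by (intro nn_integral_cong, subst F[where F="\<lambda>(u, v). G (p i * y + u, q i * y + v)" for y, simplified]) auto
    also have "\<dots> = (\<integral>\<^sup>+y. \<integral>\<^sup>+g. (\<lambda>(y, g). \<integral>\<^sup>+h. G (p i * y + a * g, q i * y + (b * g + c * h)) \<partial>stdnormal) (y, g)
            \<partial>stdnormal \<partial>stdnormal)" by simp
    also have "\<dots> = (\<integral>\<^sup>+y. \<integral>\<^sup>+g. (\<lambda>(y, g). \<integral>\<^sup>+h. G (p i * y + a * g, q i * y + (b * g + c * h)) \<partial>stdnormal)
              (co * y + (- si) * g, - (- si) * y + co * g) \<partial>stdnormal \<partial>stdnormal)"
      by (rule nn_integral_stdnormal_rotation[symmetric]) (use 1(3) in auto)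
    also have "\<dots> = (\<integral>\<^sup>+x. \<integral>\<^sup>+w. \<integral>\<^sup>+h. G (a' * x, b' * x + (c1 * w + c * h)) \<partial>stdnormal \<partial>stdnormal \<partial>stdnormal)"
    proof -
      have "p i * (co * y + (- si) * g) + a * (- (- si) * y + co * g) = a' * y" for y g
      proof -
        have "p i * (co * y + (- si) * g) + a * (- (- si) * y + co * g) = a' * ((co\<^sup>2 + si\<^sup>2) * y)"
          unfolding 1(1,2) by (simp add: power2_eq_square algebra_simps)
        then show ?thesis using 1(3) by simp
      qed
      moreover have "q i * (co * y + (- si) * g) + (b * (- (- si) * y + co * g) + c * h) = b' * y + (c1 * g + c * h)" for y g h
        by (simp add: b'_def c1_def algebra_simps)
      ultimately show ?thesis by (simp only: prod.case)
    qed
    also have "\<dots> = (\<integral>\<^sup>+x. \<integral>\<^sup>+w. \<integral>\<^sup>+h. G (a' * x, b' * x + c' * w) \<partial>stdnormal \<partial>stdnormal \<partial>stdnormal)"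
    proof (rule nn_integral_cong)
      fix x
      have "(\<integral>\<^sup>+w. \<integral>\<^sup>+h. G (a' * x, b' * x + (c1 * w + c * h)) \<partial>stdnormal \<partial>stdnormal)
        = (\<integral>\<^sup>+w. \<integral>\<^sup>+h. (\<lambda>(w, h). G (a' * x, b' * x + c' * w)) (co2 * w + si2 * h, - si2 * w + co2 * h) \<partial>stdnormal \<partial>stdnormal)"
        unfolding 2(1,2) by (simp add: algebra_simps)
      also have "\<dots> = (\<integral>\<^sup>+w. \<integral>\<^sup>+h. (\<lambda>(w, h). G (a' * x, b' * x + c' * w)) (w, h) \<partial>stdnormal \<partial>stdnormal)"
        by (rule nn_integral_stdnormal_rotation) (use 2(3) in auto)
      finally show "(\<integral>\<^sup>+w. \<integral>\<^sup>+h. G (a' * x, b' * x + (c1 * w + c * h)) \<partial>stdnormal \<partial>stdnormal)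
        = (\<integral>\<^sup>+w. \<integral>\<^sup>+h. G (a' * x, b' * x + c' * w) \<partial>stdnormal \<partial>stdnormal)" by simp
    qed
    finally show ?thesis by (simp add: stdnormal.emeasure_space_1[simplified])
  qed
  ultimately show ?case
    using insert.hyps abc 1(4) by (intro exI[of _ a'] exI[of _ b'] exI[of _ c']) auto
qed

section \<open>Gaussian integrals of quadratic exponentials in one and two variables\<close>

lemma nn_integral_exp_quadratic_stdnormal:
  fixes B C :: real
  assumes "C < 1"
  shows "(\<integral>\<^sup>+x. ennreal (exp (C * x\<^sup>2 / 2 + B * x)) \<partial>stdnormal)
    = ennreal (exp (B\<^sup>2 / (2 * (1 - C))) / sqrt (1 - C))"
proof -
  \<comment> \<open>Completing the square: up to a constant, the weighted density is normal with
    mean \<open>B / r\<^sup>2\<close> and standard deviation \<open>1 / r\<close>.\<close>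
  define r where "r = sqrt (1 - C)"
  have r: "r > 0" "r\<^sup>2 = 1 - C" using assms by (auto simp: r_def)
  have "normal_density 0 1 x * exp (C * x\<^sup>2 / 2 + B * x)
      = exp (B\<^sup>2 / (2 * r\<^sup>2)) / r * normal_density (B / r\<^sup>2) (1 / r) x" for x
  proof -
    have "- x\<^sup>2 / 2 + (C * x\<^sup>2 / 2 + B * x) = - (r\<^sup>2 * x\<^sup>2) / 2 + B * x"
      unfolding r(2) by (simp add: field_simps)
    also have "\<dots> = B\<^sup>2 / (2 * r\<^sup>2) + - (x - B / r\<^sup>2)\<^sup>2 / (2 * (1 / r)\<^sup>2)"
      using r(1) by (simp add: field_simps power2_eq_square)
    finally show ?thesis
      using r(1) by (simp add: normal_density_def exp_add[symmetric] real_sqrt_mult real_sqrt_divide field_simps)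
  qed
  then have "(\<integral>\<^sup>+x. ennreal (exp (C * x\<^sup>2 / 2 + B * x)) \<partial>stdnormal)
     = (\<integral>\<^sup>+x. ennreal (exp (B\<^sup>2 / (2 * r\<^sup>2)) / r) * ennreal (normal_density (B / r\<^sup>2) (1 / r) x) \<partial>lborel)"
    using r(1) by (subst nn_integral_stdnormal) (auto simp: ennreal_mult[symmetric])
  also have "\<dots> = ennreal (exp (B\<^sup>2 / (2 * r\<^sup>2)) / r) * (\<integral>\<^sup>+x. ennreal (normal_density (B / r\<^sup>2) (1 / r) x) \<partial>lborel)"
    by (rule nn_integral_cmult) simp
  also have "(\<integral>\<^sup>+x. ennreal (normal_density (B / r\<^sup>2) (1 / r) x) \<partial>lborel) = 1"
    using r(1) by (simp add: nn_integral_eq_integral)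
  finally show ?thesis using r by (simp add: r_def)
qed

text \<open>With \<open>G\<close> the Gram matrix of \<open>p\<close> and \<open>q\<close>, the quantity \<open>D\<close> is \<open>det (I - M G)\<close>.\<close>

lemma nn_integral_exp_quadratic_forms:
  fixes p q :: "'i \<Rightarrow> real" and m11 m12 m22 :: real
  assumes I: "finite I"
    and G: "G11 = (\<Sum>i\<in>I. (p i)\<^sup>2)" "G12 = (\<Sum>i\<in>I. p i * q i)" "G22 = (\<Sum>i\<in>I. (q i)\<^sup>2)"
    and D: "D = 1 - (m11 * G11 + 2 * m12 * G12 + m22 * G22) + (m11 * m22 - m12\<^sup>2) * (G11 * G22 - G12\<^sup>2)"
    and pos: "D > 0" "m22 \<ge> 0" "m22 * G22 < 1"
  shows "(\<integral>\<^sup>+x. ennreal (exp (m11 * (\<Sum>i\<in>I. p i * x i)\<^sup>2 / 2 + m12 * (\<Sum>i\<in>I. p i * x i) * (\<Sum>i\<in>I. q i * x i)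
        + m22 * (\<Sum>i\<in>I. q i * x i)\<^sup>2 / 2)) \<partial>PiM I (\<lambda>_. stdnormal)) = ennreal (1 / sqrt D)"
proof -
  define F where "F = (\<lambda>(u, v). ennreal (exp (m11 * u\<^sup>2 / 2 + m12 * u * v + m22 * v\<^sup>2 / 2)))"
  have F [measurable]: "F \<in> borel_measurable (borel \<Otimes>\<^sub>M borel)" unfolding F_def by measurable
  from stdnormal_linear_forms[OF I, of p q] F obtain a b c where
    abc: "a\<^sup>2 = G11" "a * b = G12" "b\<^sup>2 + c\<^sup>2 = G22"
    and int: "(\<integral>\<^sup>+x. F (\<Sum>i\<in>I. p i * x i, \<Sum>i\<in>I. q i * x i) \<partial>PiM I (\<lambda>_. stdnormal))
      = (\<integral>\<^sup>+g. \<integral>\<^sup>+h. F (a * g, b * g + c * h) \<partial>stdnormal \<partial>stdnormal)" 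
    unfolding G by blast
  \<comment> \<open>In terms of \<open>g\<close> and \<open>h\<close> the exponent is A g^2 / 2 + B
    g h + C h^2 / 2. Integrating over \<open>h\<close> first requires \<open>C < 1\<close>, which
    follows from \<open>c\<^sup>2 \<le> G22\<close> and \<open>m22 \<ge> 0\<close>.\<close>
  define A where "A = m11 * a\<^sup>2 + 2 * m12 * a * b + m22 * b\<^sup>2"
  define B where "B = m12 * a * c + m22 * b * c"
  define C where "C = m22 * c\<^sup>2"
  have "C \<le> m22 * G22"
    unfolding C_def using pos(2) by (intro mult_left_mono) (auto simp: abc(3)[symmetric])
  then have C: "C < 1" using pos(3) by simp
  have det: "D = (1 - A) * (1 - C) - B\<^sup>2"
    unfolding D A_def B_def C_def abc[symmetric] by (simp add: power2_eq_square algebra_simps)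
  \<comment> \<open>Schur complement: the integral over \<open>h\<close> adds
    \<open>B\<^sup>2 / (1 - C)\<close> to the coefficient of g^2. The product of
    \<open>1 - A'\<close> and \<open>1 - C\<close> is the determinant, so \<open>D > 0\<close>
    yields \<open>A' < 1\<close>.\<close>
  define A' where "A' = A + B\<^sup>2 / (1 - C)"
  have A': "(1 - A') * (1 - C) = D" 
    unfolding A'_def det using C by (simp add: field_simps)
  then have A'1: "A' < 1" using pos(1) C by (metis diff_gt_0_iff_gt zero_less_mult_pos2)
  have "F (a * g, b * g + c * h) = ennreal (exp (A * g\<^sup>2 / 2)) * ennreal (exp (C * h\<^sup>2 / 2 + (B * g) * h))" for g h
    by (simp add: F_def A_def B_def C_def ennreal_mult[symmetric] exp_add[symmetric] power2_eq_square algebra_simps add_divide_distrib)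
  then have "(\<integral>\<^sup>+g. \<integral>\<^sup>+h. F (a * g, b * g + c * h) \<partial>stdnormal \<partial>stdnormal)
    = (\<integral>\<^sup>+g. ennreal (exp (A * g\<^sup>2 / 2)) * ennreal (exp ((B * g)\<^sup>2 / (2 * (1 - C))) / sqrt (1 - C)) \<partial>stdnormal)"
    by (simp add: nn_integral_cmult nn_integral_exp_quadratic_stdnormal[OF C])
  also have "\<dots> = (\<integral>\<^sup>+g. ennreal (1 / sqrt (1 - C)) * ennreal (exp (A' * g\<^sup>2 / 2)) \<partial>stdnormal)"
  proof (intro nn_integral_cong)
    fix g
    have "A * g\<^sup>2 / 2 + (B * g)\<^sup>2 / (2 * (1 - C)) = A' * g\<^sup>2 / 2"
      using C by (simp add: A'_def field_simps power_mult_distrib)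
    then show "ennreal (exp (A * g\<^sup>2 / 2)) * ennreal (exp ((B * g)\<^sup>2 / (2 * (1 - C))) / sqrt (1 - C))
      = ennreal (1 / sqrt (1 - C)) * ennreal (exp (A' * g\<^sup>2 / 2))"
      using C by (simp add: ennreal_mult[symmetric] exp_add[symmetric])
  qed
  also have "\<dots> = ennreal (1 / sqrt (1 - C)) * ennreal (1 / sqrt (1 - A'))"
    by (subst nn_integral_cmult) (simp_all add: nn_integral_exp_quadratic_stdnormal[OF A'1, of 0, simplified])
  also have "\<dots> = ennreal (1 / sqrt D)"
    using C A'1 by (simp add: ennreal_mult[symmetric] A'[symmetric] real_sqrt_mult mult.commute)
  finally show ?thesis unfolding int[symmetric] by (simp add: F_def)
qed

section \<open>Finite products of probability measures\<close>

text \<open>Boxes determine a finite product measure, and on a box both the density and the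
  indicator factorize over the coordinates.\<close>

lemma PiM_density:
  assumes I: "finite I" and M: "\<And>i. prob_space (M i)"
    and f [measurable]: "\<And>i. f i \<in> borel_measurable (M i)"
    and dens: "\<And>i. prob_space (density (M i) (f i))"
  shows "PiM I (\<lambda>i. density (M i) (f i)) = density (PiM I M) (\<lambda>x. \<Prod>i\<in>I. f i (x i))"
proof -
  interpret D: product_prob_space "\<lambda>i. density (M i) (f i)" UNIV
    by (rule product_prob_spaceI) (rule dens)
  interpret M: product_prob_space M UNIV
    by (rule product_prob_spaceI) (rule M)
  have "density (PiM I M) (\<lambda>x. \<Prod>i\<in>I. f i (x i)) = PiM I (\<lambda>i. density (M i) (f i))"
  proof (rule D.PiM_eqI[OF I])
    show "sets (density (PiM I M) (\<lambda>x. \<Prod>i\<in>I. f i (x i))) = sets (PiM I (\<lambda>i. density (M i) (f i)))"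
      by (simp cong: sets_PiM_cong)
    fix A assume A: "\<And>i. i \<in> I \<Longrightarrow> A i \<in> sets (density (M i) (f i))"
    then have A' [measurable]: "\<And>i. i \<in> I \<Longrightarrow> A i \<in> sets (M i)" by simp
    have [measurable]: "Pi\<^sub>E I A \<in> sets (PiM I M)"
      using A' I by (intro sets_PiM_I_finite) auto
    have "emeasure (density (PiM I M) (\<lambda>x. \<Prod>i\<in>I. f i (x i))) (Pi\<^sub>E I A)
        = (\<integral>\<^sup>+x. (\<Prod>i\<in>I. f i (x i)) * indicator (Pi\<^sub>E I A) x \<partial>PiM I M)"
      by (rule emeasure_density) measurable
    also have "\<dots> = (\<integral>\<^sup>+x. (\<Prod>i\<in>I. f i (x i) * indicator (A i) (x i)) \<partial>PiM I M)"
    proof (rule nn_integral_cong)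
      fix x assume "x \<in> space (PiM I M)"
      then have "indicator (Pi\<^sub>E I A) x = (\<Prod>i\<in>I. indicator (A i) (x i) :: ennreal)"
        using I by (auto simp: indicator_def space_PiM PiE_iff)
      then show "(\<Prod>i\<in>I. f i (x i)) * indicator (Pi\<^sub>E I A) x = (\<Prod>i\<in>I. f i (x i) * indicator (A i) (x i))"
        by (simp add: prod.distrib)
    qed
    also have "\<dots> = (\<Prod>i\<in>I. \<integral>\<^sup>+x. f i x * indicator (A i) x \<partial>M i)"
      using I by (intro M.product_nn_integral_prod) auto
    also have "\<dots> = (\<Prod>i\<in>I. emeasure (density (M i) (f i)) (A i))"
      using A' by (intro prod.cong) (auto simp: emeasure_density)
    finally show "emeasure (density (PiM I M) (\<lambda>x. \<Prod>i\<in>I. f i (x i))) (Pi\<^sub>E I A)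
        = (\<Prod>i\<in>I. emeasure (density (M i) (f i)) (A i))" .
  qed
  then show ?thesis ..
qed

text \<open>The rows read disjoint blocks of one flat family of independent variables, hence are
  independent, and each row is a reindexed product. Leaving \<open>h\<close> general lets the same
  flat family be cut into rows or into columns.\<close>

lemma distr_PiM_uncurry:
  fixes h :: "'i \<Rightarrow> 'j \<Rightarrow> 'k"
  assumes N: "prob_space N" and I: "I \<noteq> {}" and J: "J \<noteq> {}"
    and inj: "inj_on (case_prod h) (I \<times> J)" and h: "\<And>i j. i \<in> I \<Longrightarrow> j \<in> J \<Longrightarrow> h i j \<in> K"
  shows "distr (PiM K (\<lambda>_. N)) (PiM I (\<lambda>_. PiM J (\<lambda>_. N))) (\<lambda>w. \<lambda>i\<in>I. \<lambda>j\<in>J. w (h i j))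
    = PiM I (\<lambda>_. PiM J (\<lambda>_. N))"
proof -
  from I J h have K: "K \<noteq> {}" by blast
  interpret F: prob_space "PiM K (\<lambda>_. N)" by (rule prob_space_PiM) (rule N)
  have comp: "distr (PiM K (\<lambda>_. N)) N (\<lambda>w. w k) = N" if "k \<in> K" for k
    using distr_PiM_component[of K "\<lambda>_. N" k] N that by simp
  have "distr (PiM K (\<lambda>_. N)) (PiM K (\<lambda>_. N)) (\<lambda>w. \<lambda>k\<in>K. w k) = PiM K (\<lambda>_. N)"
  proof -
    have "distr (PiM K (\<lambda>_. N)) (PiM K (\<lambda>_. N)) (\<lambda>w. \<lambda>k\<in>K. w k) = distr (PiM K (\<lambda>_. N)) (PiM K (\<lambda>_. N)) (\<lambda>w. w)"
      by (intro distr_cong refl) (auto simp: space_PiM PiE_restrict)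
    then show ?thesis by simp
  qed
  also have "\<dots> = PiM K (\<lambda>k. distr (PiM K (\<lambda>_. N)) N (\<lambda>w. w k))"
    by (intro PiM_cong) (auto simp: comp)
  finally have "F.indep_vars (\<lambda>_. N) (\<lambda>k w. w k) K"
    by (subst F.indep_vars_iff_distr_eq_PiM'[OF K]) auto
  moreover have "disjoint_family_on (\<lambda>i. h i ` J) I"
    unfolding disjoint_family_on_def
  proof (intro ballI impI)
    fix i i' assume "i \<in> I" "i' \<in> I" "i \<noteq> i'"
    moreover have "i = i'" if "h i j = h i' j'" "i \<in> I" "i' \<in> I" "j \<in> J" "j' \<in> J" for j j'
      using inj_onD[OF inj, of "(i, j)" "(i', j')"] that by simp
    ultimately show "h i ` J \<inter> h i' ` J = {}" by blast
  qed
  ultimately have "F.indep_vars (\<lambda>i. PiM (h i ` J) (\<lambda>_. N)) (\<lambda>i w. restrict (\<lambda>k. w k) (h i ` J)) I"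
    by (intro F.indep_vars_restrict) (use h in auto)
  then have "F.indep_vars (\<lambda>_. PiM J (\<lambda>_. N)) (\<lambda>i w. (\<lambda>v. \<lambda>j\<in>J. v (h i j)) (restrict (\<lambda>k. w k) (h i ` J))) I"
    by (rule F.indep_vars_compose2) (intro measurable_restrict measurable_component_singleton imageI)
  then have "F.indep_vars (\<lambda>_. PiM J (\<lambda>_. N)) (\<lambda>i w. \<lambda>j\<in>J. w (h i j)) I"
    by (simp cong: restrict_cong)
  then have "distr (PiM K (\<lambda>_. N)) (PiM I (\<lambda>_. PiM J (\<lambda>_. N))) (\<lambda>w. \<lambda>i\<in>I. \<lambda>j\<in>J. w (h i j))
      = PiM I (\<lambda>i. distr (PiM K (\<lambda>_. N)) (PiM J (\<lambda>_. N)) (\<lambda>w. \<lambda>j\<in>J. w (h i j)))"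
    by (subst (asm) F.indep_vars_iff_distr_eq_PiM'[OF I])
       (use h in \<open>auto intro!: measurable_restrict measurable_component_singleton\<close>)
  also have "\<dots> = PiM I (\<lambda>_. PiM J (\<lambda>_. N))"
  proof (rule PiM_cong[OF refl])
    fix i assume "i \<in> I"
    then show "distr (PiM K (\<lambda>_. N)) (PiM J (\<lambda>_. N)) (\<lambda>w. \<lambda>j\<in>J. w (h i j)) = PiM J (\<lambda>_. N)"
      using inj h N by (intro distr_PiM_reindex[of K "\<lambda>_. N" "h i" J]) (auto simp: inj_on_def)
  qed
  finally show ?thesis .
qed

text \<open>Both nested products are images of the flat product over
  \<open>I \<times> J\<close>.\<close>

lemma distr_PiM_transpose:
  assumes N: "prob_space N" and I: "I \<noteq> {}" and J: "J \<noteq> {}"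
  shows "distr (PiM J (\<lambda>_. PiM I (\<lambda>_. N))) (PiM I (\<lambda>_. PiM J (\<lambda>_. N))) (\<lambda>x. \<lambda>i\<in>I. \<lambda>j\<in>J. x j i)
    = PiM I (\<lambda>_. PiM J (\<lambda>_. N))"
proof -
  let ?F = "PiM (I \<times> J) (\<lambda>_. N)"
  have 1: "distr ?F (PiM I (\<lambda>_. PiM J (\<lambda>_. N))) (\<lambda>w. \<lambda>i\<in>I. \<lambda>j\<in>J. w (i, j)) = PiM I (\<lambda>_. PiM J (\<lambda>_. N))"
    by (rule distr_PiM_uncurry[OF N I J]) (auto simp: inj_on_def)
  have 2: "distr ?F (PiM J (\<lambda>_. PiM I (\<lambda>_. N))) (\<lambda>w. \<lambda>j\<in>J. \<lambda>i\<in>I. w (i, j)) = PiM J (\<lambda>_. PiM I (\<lambda>_. N))"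
    by (rule distr_PiM_uncurry[OF N J I]) (auto simp: inj_on_def)
  have m2: "(\<lambda>w. \<lambda>j\<in>J. \<lambda>i\<in>I. w (i, j)) \<in> measurable ?F (PiM J (\<lambda>_. PiM I (\<lambda>_. N)))"
    by (auto intro!: measurable_restrict)
  have m3: "(\<lambda>x. \<lambda>i\<in>I. \<lambda>j\<in>J. x j i) \<in> measurable (PiM J (\<lambda>_. PiM I (\<lambda>_. N))) (PiM I (\<lambda>_. PiM J (\<lambda>_. N)))"
  proof (intro measurable_restrict)
    fix i j assume "i \<in> I" "j \<in> J"
    then show "(\<lambda>x. x j i) \<in> measurable (PiM J (\<lambda>_. PiM I (\<lambda>_. N))) N"
      by (auto intro: measurable_compose[of "\<lambda>x. x j" _ "PiM I (\<lambda>_. N)" "\<lambda>x. x i"])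
  qed
  have "distr (PiM J (\<lambda>_. PiM I (\<lambda>_. N))) (PiM I (\<lambda>_. PiM J (\<lambda>_. N))) (\<lambda>x. \<lambda>i\<in>I. \<lambda>j\<in>J. x j i)
     = distr ?F (PiM I (\<lambda>_. PiM J (\<lambda>_. N))) (\<lambda>w. \<lambda>i\<in>I. \<lambda>j\<in>J. (\<lambda>j\<in>J. \<lambda>i\<in>I. w (i, j)) j i)"
    by (subst 2[symmetric], subst distr_distr[OF m3 m2]) (simp add: comp_def)
  also have "(\<lambda>w. \<lambda>i\<in>I. \<lambda>j\<in>J. (\<lambda>j\<in>J. \<lambda>i\<in>I. w (i, j)) j i) = (\<lambda>w. \<lambda>i\<in>I. \<lambda>j\<in>J. w (i, j))"
    by (auto simp: fun_eq_iff restrict_def)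
  finally show ?thesis unfolding 1 .
qed

text \<open>Samples are stored by rows, whereas likelihood ratios factorize over the coordinates,
  that is over columns. Transposing makes the columns the factors of the product measure, and the
  integral becomes a power.\<close>

lemma nn_integral_PiM_prod_columns:
  assumes N: "prob_space N" and I: "finite I" "I \<noteq> {}" and J: "finite J" "J \<noteq> {}"
    and \<phi> [measurable]: "\<phi> \<in> borel_measurable (PiM I (\<lambda>_. N))"
  shows "(\<integral>\<^sup>+x. (\<Prod>j\<in>J. \<phi> (\<lambda>i\<in>I. x i j)) \<partial>PiM I (\<lambda>_. PiM J (\<lambda>_. N)))
    = (\<integral>\<^sup>+x. \<phi> x \<partial>PiM I (\<lambda>_. N)) ^ card J"
proof -
  interpret P: prob_space "PiM I (\<lambda>_. N)" by (rule prob_space_PiM) (rule N)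
  interpret PJ: product_prob_space "\<lambda>_. PiM I (\<lambda>_. N)" UNIV
    by (rule product_prob_spaceI) (rule P.prob_space_axioms)
  have m1: "(\<lambda>x. x i j) \<in> measurable (PiM I (\<lambda>_. PiM J (\<lambda>_. N))) N" if "i \<in> I" "j \<in> J" for i j
    using that by (auto intro: measurable_compose[of "\<lambda>x. x i" _ "PiM J (\<lambda>_. N)" "\<lambda>x. x j"])
  have [measurable]: "(\<lambda>x. \<lambda>i\<in>I. x i j) \<in> measurable (PiM I (\<lambda>_. PiM J (\<lambda>_. N))) (PiM I (\<lambda>_. N))" if "j \<in> J" for j
    using that by (intro measurable_restrict m1) 
  have m3: "(\<lambda>x. \<lambda>i\<in>I. \<lambda>j\<in>J. x j i) \<in> measurable (PiM J (\<lambda>_. PiM I (\<lambda>_. N))) (PiM I (\<lambda>_. PiM J (\<lambda>_. N)))"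
  proof (intro measurable_restrict)
    fix i j assume "i \<in> I" "j \<in> J"
    then show "(\<lambda>x. x j i) \<in> measurable (PiM J (\<lambda>_. PiM I (\<lambda>_. N))) N"
      by (auto intro: measurable_compose[of "\<lambda>x. x j" _ "PiM I (\<lambda>_. N)" "\<lambda>x. x i"])
  qed
  have "(\<integral>\<^sup>+x. (\<Prod>j\<in>J. \<phi> (\<lambda>i\<in>I. x i j)) \<partial>PiM I (\<lambda>_. PiM J (\<lambda>_. N)))
    = (\<integral>\<^sup>+x. (\<Prod>j\<in>J. \<phi> (\<lambda>i\<in>I. (\<lambda>i\<in>I. \<lambda>j\<in>J. x j i) i j)) \<partial>PiM J (\<lambda>_. PiM I (\<lambda>_. N)))"
    by (subst distr_PiM_transpose[OF N I(2) J(2), symmetric], subst nn_integral_distr[OF m3]) auto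
  also have "\<dots> = (\<integral>\<^sup>+x. (\<Prod>j\<in>J. \<phi> (x j)) \<partial>PiM J (\<lambda>_. PiM I (\<lambda>_. N)))"
  proof (intro nn_integral_cong prod.cong refl arg_cong[where f=\<phi>])
    fix x j assume "x \<in> space (PiM J (\<lambda>_. PiM I (\<lambda>_. N)))" and j: "j \<in> J"
    then have "x j \<in> extensional I" by (auto simp: space_PiM PiE_iff)
    then show "(\<lambda>i\<in>I. (\<lambda>i\<in>I. \<lambda>j\<in>J. x j i) i j) = x j"
      using j by (auto simp: fun_eq_iff extensional_def)
  qed
  also have "\<dots> = (\<integral>\<^sup>+x. \<phi> x \<partial>PiM I (\<lambda>_. N)) ^ card J"
    by (subst PJ.product_nn_integral_prod[OF J(1)]) auto
  finally show ?thesis .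
qed

section \<open>Translation of normal variables as a change of density\<close>

lemma density_stdnormal_shift:
  "density stdnormal (\<lambda>x. ennreal (exp (\<mu> * x - \<mu>\<^sup>2 / 2))) = density lborel (\<lambda>x. ennreal (normal_density \<mu> 1 x))"
proof -
  have "normal_density 0 1 x * exp (\<mu> * x - \<mu>\<^sup>2 / 2) = normal_density \<mu> 1 x" for x
    by (simp add: normal_density_def exp_add[symmetric] power2_eq_square field_simps)
  then show ?thesis
    unfolding stdnormal_def by (subst density_density_eq) (auto simp: ennreal_mult[symmetric])
qed

lemma distr_stdnormal_shift:
  "distr stdnormal borel (\<lambda>x. x + \<mu>) = density lborel (\<lambda>x. ennreal (normal_density \<mu> 1 x))"
proof (rule measure_eqI)
  fix X assume "X \<in> sets (distr stdnormal borel (\<lambda>x. x + \<mu>))"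
  then have [measurable]: "X \<in> sets borel" by simp
  have "emeasure (distr stdnormal borel (\<lambda>x. x + \<mu>)) X = (\<integral>\<^sup>+x. indicator X (x + \<mu>) \<partial>stdnormal)"
    by (simp add: nn_integral_distr flip: nn_integral_indicator)
  also have "\<dots> = (\<integral>\<^sup>+x. ennreal (normal_density 0 1 x) * indicator X (x + \<mu>) \<partial>lborel)"
    by (rule nn_integral_stdnormal) measurable
  also have "\<dots> = (\<integral>\<^sup>+x. ennreal (normal_density \<mu> 1 (\<mu> + 1 * x)) * indicator X (\<mu> + 1 * x) \<partial>lborel)"
    by (intro nn_integral_cong) (simp add: normal_density_def add.commute)
  also have "\<dots> = (\<integral>\<^sup>+x. ennreal (normal_density \<mu> 1 x) * indicator X x \<partial>lborel)"
    by (subst nn_integral_real_affine[of _ 1 \<mu>]) auto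
  also have "\<dots> = emeasure (density lborel (\<lambda>x. ennreal (normal_density \<mu> 1 x))) X"
    by (simp add: emeasure_density)
  finally show "emeasure (distr stdnormal borel (\<lambda>x. x + \<mu>)) X = emeasure (density lborel (\<lambda>x. ennreal (normal_density \<mu> 1 x))) X" .
qed simp

text \<open>Finite-dimensional Cameron-Martin formula: the exponential weight is the density of
  independent normal variables with mean \<open>\<mu>\<close>, whose law is also the image of the
  standard one under translation. It serves to trade the weight given by one likelihood ratio for a
  shift in the argument of the other.\<close>

lemma nn_integral_PiM_stdnormal_shift:
  assumes B: "finite B" and H [measurable]: "H \<in> borel_measurable (PiM B (\<lambda>_. borel))"
  shows "(\<integral>\<^sup>+y. ennreal (exp (\<mu> * (\<Sum>i\<in>B. y i) - real (card B) * \<mu>\<^sup>2 / 2)) * H y \<partial>PiM B (\<lambda>_. stdnormal))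
    = (\<integral>\<^sup>+y. H (\<lambda>i\<in>B. y i + \<mu>) \<partial>PiM B (\<lambda>_. stdnormal))"
proof -
  have [measurable]: "H \<in> borel_measurable (PiM B (\<lambda>_. stdnormal))"
    using H by (simp cong: measurable_cong_sets sets_PiM_cong)
  have pn: "prob_space (density lborel (\<lambda>x. ennreal (normal_density \<mu> 1 x)))"
    by (rule prob_space_normal_density) simp
  have w: "ennreal (exp (\<mu> * (\<Sum>i\<in>B. y i) - real (card B) * \<mu>\<^sup>2 / 2)) = (\<Prod>i\<in>B. ennreal (exp (\<mu> * y i - \<mu>\<^sup>2 / 2)))" for y
    using B by (simp add: prod_ennreal exp_sum[symmetric] sum_subtractf sum_distrib_left)
  have "(\<integral>\<^sup>+y. ennreal (exp (\<mu> * (\<Sum>i\<in>B. y i) - real (card B) * \<mu>\<^sup>2 / 2)) * H y \<partial>PiM B (\<lambda>_. stdnormal))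
    = (\<integral>\<^sup>+y. H y \<partial>density (PiM B (\<lambda>_. stdnormal)) (\<lambda>y. \<Prod>i\<in>B. ennreal (exp (\<mu> * y i - \<mu>\<^sup>2 / 2))))"
    unfolding w by (subst nn_integral_density) auto
  also have "density (PiM B (\<lambda>_. stdnormal)) (\<lambda>y. \<Prod>i\<in>B. ennreal (exp (\<mu> * y i - \<mu>\<^sup>2 / 2)))
      = PiM B (\<lambda>_. density stdnormal (\<lambda>x. ennreal (exp (\<mu> * x - \<mu>\<^sup>2 / 2))))"
    by (rule PiM_density[symmetric]) (use B prob_space_stdnormal pn in \<open>auto simp: density_stdnormal_shift\<close>)
  also have "\<dots> = PiM B (\<lambda>_. distr stdnormal borel (\<lambda>x. x + \<mu>))"
    by (simp add: density_stdnormal_shift distr_stdnormal_shift)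
  also have "\<dots> = PiM B (\<lambda>_. distr stdnormal stdnormal (\<lambda>x. x + \<mu>))"
    by (intro PiM_cong distr_cong) auto
  also have "\<dots> = distr (PiM B (\<lambda>_. stdnormal)) (PiM B (\<lambda>_. stdnormal)) (compose B (\<lambda>x. x + \<mu>))"
    by (rule distr_PiM_finite_prob_space'[symmetric]) (use B prob_space_stdnormal in auto)
  also have "(\<integral>\<^sup>+y. H y \<partial>\<dots>) = (\<integral>\<^sup>+y. H (compose B (\<lambda>x. x + \<mu>) y) \<partial>PiM B (\<lambda>_. stdnormal))"
  proof (rule nn_integral_distr)
    have "(\<lambda>y. \<lambda>i\<in>B. y i + \<mu>) \<in> measurable (PiM B (\<lambda>_. stdnormal)) (PiM B (\<lambda>_. stdnormal))"
      by (intro measurable_restrict) measurable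
    then show "compose B (\<lambda>x. x + \<mu>) \<in> measurable (PiM B (\<lambda>_. stdnormal)) (PiM B (\<lambda>_. stdnormal))"
      by (simp add: compose_def[abs_def])
  qed simp
  finally show ?thesis by (simp add: compose_def)
qed

section \<open>Overlap of two likelihood ratios in one coordinate\<close>

text \<open>Likelihood ratio of one coordinate given \<open>A\<close>, with the latent variable
  integrated out. It depends on the data only through the sum \<open>r\<close> over \<open>A\<close>
  and the sum \<open>q\<close> over the \<open>m\<close> remaining samples.\<close>

definition shift_lr :: "real \<Rightarrow> real \<Rightarrow> real \<Rightarrow> real \<Rightarrow> real \<Rightarrow> real" where
  "shift_lr m \<tau> \<beta> r q =
    exp (\<tau> * (q + m * \<beta> * r)\<^sup>2 / (2 * (1 + m * \<tau>)) - \<beta> * r * q - m * \<beta>\<^sup>2 * r\<^sup>2 / 2) / sqrt (1 + m * \<tau>)"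

lemma shift_lr_nonneg: "0 \<le> 1 + m * \<tau> \<Longrightarrow> 0 \<le> shift_lr m \<tau> \<beta> r q"
  by (simp add: shift_lr_def)

lemma measurable_shift_lr [measurable (raw)]:
  assumes [measurable]: "f \<in> borel_measurable M" "g \<in> borel_measurable M"
  shows "(\<lambda>x. shift_lr m \<tau> \<beta> (f x) (g x)) \<in> borel_measurable M"
  unfolding shift_lr_def by measurable

text \<open>At a fixed latent value the \<open>m\<close> shifted samples have mean \<mu> = -\<beta>
  r - sqrt \<tau> \<zeta> and likelihood ratio exp (\<mu> q - m \<mu>^2 / 2). Averaging over
  \<open>\<zeta>\<close> is a Gaussian integral with quadratic coefficient -m \<tau>.\<close>

lemma nn_integral_shift_lr:
  assumes "m \<ge> 0" "\<tau> \<ge> 0"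
  shows "(\<integral>\<^sup>+\<zeta>. ennreal (exp ((- \<beta> * r - sqrt \<tau> * \<zeta>) * q - m * (- \<beta> * r - sqrt \<tau> * \<zeta>)\<^sup>2 / 2)) \<partial>stdnormal)
    = ennreal (shift_lr m \<tau> \<beta> r q)"
proof -
  have C: "- (m * \<tau>) < 1" using assms by (smt (verit) mult_nonneg_nonneg)
  define E where "E = exp (- \<beta> * r * q - m * \<beta>\<^sup>2 * r\<^sup>2 / 2)"
  have "(- \<beta> * r - sqrt \<tau> * \<zeta>) * q - m * (- \<beta> * r - sqrt \<tau> * \<zeta>)\<^sup>2 / 2
      = (- \<beta> * r * q - m * \<beta>\<^sup>2 * r\<^sup>2 / 2) + (- (m * (sqrt \<tau>)\<^sup>2) * \<zeta>\<^sup>2 / 2 + (- sqrt \<tau> * (q + m * \<beta> * r)) * \<zeta>)" for \<zeta>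
    by (simp add: power2_eq_square field_simps)
  then have "(\<integral>\<^sup>+\<zeta>. ennreal (exp ((- \<beta> * r - sqrt \<tau> * \<zeta>) * q - m * (- \<beta> * r - sqrt \<tau> * \<zeta>)\<^sup>2 / 2)) \<partial>stdnormal)
     = (\<integral>\<^sup>+\<zeta>. ennreal E * ennreal (exp (- (m * \<tau>) * \<zeta>\<^sup>2 / 2 + (- sqrt \<tau> * (q + m * \<beta> * r)) * \<zeta>)) \<partial>stdnormal)"
    using assms by (simp add: E_def exp_add ennreal_mult)
  also have "\<dots> = ennreal E * ennreal (exp ((- sqrt \<tau> * (q + m * \<beta> * r))\<^sup>2 / (2 * (1 - - (m * \<tau>)))) / sqrt (1 - - (m * \<tau>)))"
    by (subst nn_integral_cmult) (simp_all only: nn_integral_exp_quadratic_stdnormal[OF C], measurable)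
  also have "(- sqrt \<tau> * (q + m * \<beta> * r))\<^sup>2 = \<tau> * (q + m * \<beta> * r)\<^sup>2"
    using assms by (simp add: power_mult_distrib)
  also have "ennreal E * ennreal (exp (\<tau> * (q + m * \<beta> * r)\<^sup>2 / (2 * (1 - - (m * \<tau>)))) / sqrt (1 - - (m * \<tau>)))
      = ennreal (shift_lr m \<tau> \<beta> r q)"
    using assms C by (simp add: E_def shift_lr_def power_mult_distrib ennreal_mult[symmetric] exp_add[symmetric] algebra_simps)
  finally show ?thesis .
qed

section \<open>Gram matrix and determinant for a pair of planted sets\<close>

lemma sum_indicator_bilinear:
  fixes c c' :: real
  assumes "finite S" "A \<subseteq> S" "C \<subseteq> S" "D \<subseteq> S"
  shows "(\<Sum>i\<in>S. (indicator C i - c * indicator A i) * (indicator D i - c' * indicator A i))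
    = real (card (C \<inter> D)) - c' * real (card (C \<inter> A)) - c * real (card (D \<inter> A)) + c * c' * real (card A)"
proof -
  have ind: "(\<Sum>i\<in>S. indicator X i) = real (card X)" if "X \<subseteq> S" for X
    using that assms(1) by (simp add: indicator_def sum.If_cases Int_absorb1 Int_absorb2 flip: Int_def)
  have "(\<Sum>i\<in>S. (indicator C i - c * indicator A i) * (indicator D i - c' * indicator A i))
    = (\<Sum>i\<in>S. indicator (C \<inter> D) i - c' * indicator (C \<inter> A) i - c * indicator (D \<inter> A) i + c * c' * indicator A i)"
    by (intro sum.cong refl) (auto simp: indicator_def algebra_simps)
  also have "\<dots> = (\<Sum>i\<in>S. indicator (C \<inter> D) i) - c' * (\<Sum>i\<in>S. indicator (C \<inter> A) i)
      - c * (\<Sum>i\<in>S. indicator (D \<inter> A) i) + c * c' * (\<Sum>i\<in>S. indicator A i)"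
    by (simp add: sum.distrib sum_subtractf sum_distrib_left)
  also have "\<dots> = real (card (C \<inter> D)) - c' * real (card (C \<inter> A)) - c * real (card (D \<inter> A)) + c * c' * real (card A)"
    using assms by (subst (1 2 3 4) ind) auto
  finally show ?thesis .
qed

text \<open>Here \<open>t\<close>, \<open>e\<close>, \<open>f\<close> count the common points of
  \<open>A\<close> and \<open>A'\<close>, the points of \<open>A'\<close> outside \<open>A\<close>,
  and the points outside both. \<open>G11\<close>, \<open>G12\<close>, \<open>G22\<close> are the
  covariances, under the law planted on \<open>A\<close>, of the sums over \<open>A'\<close> and
  over its complement. The left-hand side is \<open>1 + m * \<tau>\<close> times det (I - M G), with
  M the quadratic form in the exponent of \<open>shift_lr\<close>. The root equation turns it into a
  difference of squares that equals 1 at \<open>w = 0\<close>.\<close>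

lemma overlap_determinant:
  fixes k m t \<tau> \<beta> :: real
  assumes m: "m \<noteq> 0" and root: "\<beta>\<^sup>2 * k * m - 2 * \<beta> * k + m * \<tau> = 0"
    and e: "e = k - t" and f: "f = m - e" and w: "w = (k + m) * t - k\<^sup>2"
    and G11: "G11 = k - 2 * \<beta> * e * t + (\<beta>\<^sup>2 * k + \<tau>) * e\<^sup>2"
    and G12: "G12 = - \<beta> * (f * t + e\<^sup>2) + (\<beta>\<^sup>2 * k + \<tau>) * e * f"
    and G22: "G22 = m - 2 * \<beta> * e * f + (\<beta>\<^sup>2 * k + \<tau>) * f\<^sup>2"
  shows "1 + m * \<tau> + m * \<beta>\<^sup>2 * G11 + 2 * \<beta> * G12 - \<tau> * G22 - \<beta>\<^sup>2 * (G11 * G22 - G12\<^sup>2)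
    = (1 - \<beta>\<^sup>2 * w)\<^sup>2 - (2 * \<beta> * w / m)\<^sup>2"
proof -
  \<comment> \<open>The root equation is linear in \<open>\<tau>\<close>, and with
    \<open>k = \<kappa> * m\<close> its solution involves no division. Eliminating
    \<open>\<tau>\<close> leaves a polynomial identity.\<close>
  define \<kappa> where "\<kappa> = k / m"
  have k: "k = \<kappa> * m" using m by (simp add: \<kappa>_def)
  have "m * (\<tau> - \<beta> * \<kappa> * (2 - \<beta> * m)) = 0"
    using root unfolding k by (simp add: power2_eq_square algebra_simps)
  then have \<tau>: "\<tau> = \<beta> * \<kappa> * (2 - \<beta> * m)" using m by simp
  define v where "v = (1 + \<kappa>) * t - \<kappa>\<^sup>2 * m"
  have wv: "w = m * v" unfolding w v_def k by (simp add: power2_eq_square algebra_simps)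
  have q: "2 * \<beta> * w / m = 2 * \<beta> * v" using m by (simp add: wv)
  have \<gamma>: "\<beta>\<^sup>2 * k + \<tau> = 2 * \<beta> * \<kappa>" unfolding \<tau> k by (simp add: power2_eq_square algebra_simps)
  show ?thesis
    unfolding q unfolding wv v_def G11 G12 G22 e f \<gamma> unfolding \<tau> k
    by (simp add: power2_eq_square algebra_simps)
qed

text \<open>Brings the exponent into the shape of a quadratic form in \<open>(r, q)\<close> that
  \<open>nn_integral_exp_quadratic_forms\<close> can integrate.\<close>

lemma shift_lr_quadratic:
  assumes "1 + m * \<tau> > 0"
  shows "shift_lr m \<tau> \<beta> r q = 1 / sqrt (1 + m * \<tau>) *
    exp ((- m * \<beta>\<^sup>2 / (1 + m * \<tau>)) * r\<^sup>2 / 2 + (- \<beta> / (1 + m * \<tau>)) * r * q + (\<tau> / (1 + m * \<tau>)) * q\<^sup>2 / 2)"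
proof -
  define \<sigma> where "\<sigma> = 1 + m * \<tau>"
  have \<sigma>: "\<sigma> > 0" "m * \<tau> = \<sigma> - 1" using assms by (auto simp: \<sigma>_def)
  have "\<tau> * (q + m * \<beta> * r)\<^sup>2 - 2 * \<sigma> * (\<beta> * r * q) - \<sigma> * (m * \<beta>\<^sup>2 * r\<^sup>2)
      = \<tau> * q\<^sup>2 + 2 * (m * \<tau>) * \<beta> * r * q + (m * \<tau>) * m * \<beta>\<^sup>2 * r\<^sup>2 - 2 * \<sigma> * (\<beta> * r * q) - \<sigma> * (m * \<beta>\<^sup>2 * r\<^sup>2)"
    by (simp add: power2_eq_square algebra_simps)
  also have "\<dots> = \<tau> * q\<^sup>2 - 2 * \<beta> * r * q - m * \<beta>\<^sup>2 * r\<^sup>2"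
    unfolding \<sigma>(2) by (simp add: algebra_simps)
  finally have "(\<tau> * (q + m * \<beta> * r)\<^sup>2 - 2 * \<sigma> * (\<beta> * r * q) - \<sigma> * (m * \<beta>\<^sup>2 * r\<^sup>2)) / (2 * \<sigma>)
      = (\<tau> * q\<^sup>2 - 2 * \<beta> * r * q - m * \<beta>\<^sup>2 * r\<^sup>2) / (2 * \<sigma>)"
    by (rule arg_cong)
  then have "\<tau> * (q + m * \<beta> * r)\<^sup>2 / (2 * \<sigma>) - \<beta> * r * q - m * \<beta>\<^sup>2 * r\<^sup>2 / 2
      = (- m * \<beta>\<^sup>2 / \<sigma>) * r\<^sup>2 / 2 + (- \<beta> / \<sigma>) * r * q + (\<tau> / \<sigma>) * q\<^sup>2 / 2"
    using \<sigma>(1) by (simp add: diff_divide_distrib mult.commute)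
  then show ?thesis by (simp add: shift_lr_def \<sigma>_def)
qed

text \<open>The left-hand side is the expectation of the second likelihood ratio under the first planted
  law, where the two sums that it involves are linear forms in the \<open>n\<close> noise variables and the
  latent variable, which gets the index 0.\<close>

lemma nn_integral_shift_lr_overlap:
  fixes S A A' :: "nat set"
  assumes S: "finite S" "0 \<notin> S" and A: "A \<subseteq> S" "A' \<subseteq> S"
    and k: "real (card A) = k" "real (card A') = k" and m: "real (card S) = k + m" "m > 0"
    and par: "\<tau> \<ge> 0" "\<beta> \<ge> 0" "\<beta>\<^sup>2 * k * m - 2 * \<beta> * k + m * \<tau> = 0" "2 * \<beta> * k * m * \<tau> < 1"
    and w: "w = (k + m) * real (card (A \<inter> A')) - k\<^sup>2"
    and pos: "(1 - \<beta>\<^sup>2 * w)\<^sup>2 - (2 * \<beta> * w / m)\<^sup>2 > 0"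
  shows "(\<integral>\<^sup>+x. ennreal (shift_lr m \<tau> \<beta> (\<Sum>i\<in>A. x i) (\<Sum>i\<in>S - A. x i))
      * ennreal (shift_lr m \<tau> \<beta> (\<Sum>i\<in>A'. x i) (\<Sum>i\<in>S - A'. x i)) \<partial>PiM S (\<lambda>_. stdnormal))
    = ennreal (1 / sqrt ((1 - \<beta>\<^sup>2 * w)\<^sup>2 - (2 * \<beta> * w / m)\<^sup>2))"
proof -
  let ?N = "\<lambda>I. PiM I (\<lambda>_::nat. stdnormal)"
  define B where "B = S - A"
  define B' where "B' = S - A'"
  define t where "t = real (card (A \<inter> A'))"
  define e where "e = real (card (A' \<inter> B))"
  define f where "f = real (card (B' \<inter> B))"
  have fin [simp]: "finite A" "finite A'" "finite B" "finite B'"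
    using S A by (auto simp: B_def B'_def intro: finite_subset)
  have AB: "A \<inter> B = {}" "A \<union> B = S" and AB': "A' \<inter> B' = {}" "A' \<union> B' = S"
    using A by (auto simp: B_def B'_def)
  have cB: "real (card B) = m"
    using card_Un_disjoint[of A B] AB k m by simp
  have cB': "real (card B') = m"
    using card_Un_disjoint[of A' B'] AB' k m by simp
  have split: "real (card (X \<inter> A)) + real (card (X \<inter> B)) = real (card X)" if "X \<subseteq> S" "finite X" for X
  proof -
    have "card ((X \<inter> A) \<union> (X \<inter> B)) = card (X \<inter> A) + card (X \<inter> B)"
      using AB by (intro card_Un_disjoint) auto
    moreover have "(X \<inter> A) \<union> (X \<inter> B) = X" using AB that by auto
    ultimately show ?thesis by simp
  qed
  have e: "e = k - t"
    using split[of A'] A k by (simp add: e_def t_def Int_commute)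
  have BA: "real (card (B' \<inter> A)) = e"
  proof -
    have "card ((A \<inter> A') \<union> (A \<inter> B')) = card (A \<inter> A') + card (A \<inter> B')"
      using AB' by (intro card_Un_disjoint) auto
    moreover have "(A \<inter> A') \<union> (A \<inter> B') = A" using AB' A by auto
    ultimately show ?thesis using k by (simp add: e t_def Int_commute)
  qed
  have f: "f = m - e"
    using split[of B'] BA cB' AB' by (auto simp: f_def)
  have ef: "0 \<le> e" "0 \<le> f" "f \<le> m" using f by (auto simp: e_def f_def)
  define H where "H = (\<lambda>x. ennreal (shift_lr m \<tau> \<beta> (\<Sum>i\<in>A'. x i) (\<Sum>i\<in>B'. x i)))"
  have H [measurable]: "H \<in> borel_measurable (?N S)"
    unfolding H_def using AB' by (intro measurable_compose[OF _ measurable_ennreal] measurable_shift_lr borel_measurable_sum) auto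
  \<comment> \<open>\<open>W\<close> is the first likelihood ratio before the latent variable
    \<open>\<zeta>\<close> is averaged out, and \<open>\<mu>\<close> is the mean that it gives to
    the samples in \<open>B\<close>.\<close>
  define \<mu> where "\<mu> = (\<lambda>\<zeta> x. - \<beta> * (\<Sum>i\<in>A. x i) - sqrt \<tau> * \<zeta>)"
  define W where "W = (\<lambda>\<zeta> x. ennreal (exp (\<mu> \<zeta> x * (\<Sum>i\<in>B. x i) - m * (\<mu> \<zeta> x)\<^sup>2 / 2)))"
  \<comment> \<open>Coefficients of the sum over \<open>C\<close> under the law planted on
    \<open>A\<close>: each sample in \<open>C \<inter> B\<close> carries the shift
    \<open>\<mu>\<close>, itself linear in the noise on \<open>A\<close> and in
    \<open>\<zeta>\<close>. Index 0 is free for \<open>\<zeta>\<close> because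
    \<open>0 \<notin> S\<close>.\<close>
  define p where "p = (\<lambda>C i. if i = 0 then - real (card (C \<inter> B)) * sqrt \<tau>
    else indicator C i - real (card (C \<inter> B)) * \<beta> * indicator A i)"
  define K where "K = (\<lambda>x. ennreal (shift_lr m \<tau> \<beta> (\<Sum>i\<in>insert 0 S. p A' i * x i) (\<Sum>i\<in>insert 0 S. p B' i * x i)))"
  have sumA: "(\<lambda>x. \<Sum>i\<in>X. x i) \<in> borel_measurable (?N I)" if "X \<subseteq> I" for X I
    using that by (intro borel_measurable_sum) auto
  have [measurable]: "(\<lambda>x. \<Sum>i\<in>A. x i) \<in> borel_measurable (?N S)" "(\<lambda>x. \<Sum>i\<in>B. x i) \<in> borel_measurable (?N S)"
    "(\<lambda>x. \<Sum>i\<in>A. x i) \<in> borel_measurable (?N A)"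
    using AB by (auto intro!: sumA)
  have W [measurable]: "(\<lambda>(\<zeta>, x). W \<zeta> x) \<in> borel_measurable (stdnormal \<Otimes>\<^sub>M ?N S)"
    unfolding W_def \<mu>_def by measurable
  have W2 [measurable]: "(\<lambda>(x, \<zeta>). W \<zeta> x) \<in> borel_measurable (?N S \<Otimes>\<^sub>M stdnormal)"
    unfolding W_def \<mu>_def by measurable
  have K [measurable]: "K \<in> borel_measurable (?N (insert 0 S))"
    unfolding K_def by measurable
  interpret NS: prob_space "?N S" by (intro prob_space_PiM prob_space_stdnormal)
  interpret P: pair_sigma_finite "?N S" stdnormal ..

  have shifted: "(\<Sum>i\<in>C. merge A B (u, \<lambda>i\<in>B. y i + \<mu> \<zeta> u) i)
      = (\<Sum>i\<in>insert 0 S. p C i * ((merge A B (u, y))(0 := \<zeta>)) i)" if C: "C \<subseteq> S" for C u y \<zeta>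
  proof -
    let ?x = "merge A B (u, y)"
    have finC: "finite C" using C S finite_subset by blast
    have \<mu>: "\<mu> \<zeta> u = - \<beta> * (\<Sum>i\<in>S. indicator A i * ?x i) - sqrt \<tau> * \<zeta>"
    proof -
      have "(\<Sum>i\<in>A. u i) = (\<Sum>i\<in>A. ?x i)" by (intro sum.cong) (auto simp: merge_def)
      also have "\<dots> = (\<Sum>i\<in>S. indicator A i * ?x i)"
        using A S by (simp add: indicator_def if_distrib sum.If_cases Int_absorb1 cong: if_cong)
      finally show ?thesis by (simp add: \<mu>_def)
    qed
    have "(\<Sum>i\<in>C. merge A B (u, \<lambda>i\<in>B. y i + \<mu> \<zeta> u) i) = (\<Sum>i\<in>C. ?x i + indicator B i * \<mu> \<zeta> u)"
      using C AB by (intro sum.cong) (auto simp: merge_def)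
    also have "\<dots> = (\<Sum>i\<in>C. ?x i) + real (card (C \<inter> B)) * \<mu> \<zeta> u"
    proof -
      have "(\<Sum>i\<in>C. indicator B i) = real (card (C \<inter> B))"
        using finC by (simp add: indicator_def sum.If_cases flip: Int_def)
      then show ?thesis by (simp add: sum.distrib sum_distrib_right[symmetric])
    qed
    also have "(\<Sum>i\<in>C. ?x i) = (\<Sum>i\<in>S. indicator C i * ?x i)"
      using C S by (simp add: indicator_def if_distrib sum.If_cases Int_absorb1 cong: if_cong)
    also have "\<dots> + real (card (C \<inter> B)) * \<mu> \<zeta> u
      = (\<Sum>i\<in>S. (indicator C i - real (card (C \<inter> B)) * \<beta> * indicator A i) * ?x i) - real (card (C \<inter> B)) * sqrt \<tau> * \<zeta>"
      unfolding \<mu> by (simp add: left_diff_distrib sum_subtractf sum_distrib_left sum_negf algebra_simps)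
    also have "\<dots> = (\<Sum>i\<in>insert 0 S. p C i * (?x(0 := \<zeta>)) i)"
    proof -
      have "(\<Sum>i\<in>S. p C i * (?x(0 := \<zeta>)) i) = (\<Sum>i\<in>S. (indicator C i - real (card (C \<inter> B)) * \<beta> * indicator A i) * ?x i)"
        by (rule sum.cong) (use S in \<open>auto simp: p_def\<close>)
      then show ?thesis using S by (simp add: p_def)
    qed
    finally show ?thesis .
  qed

  have "(\<integral>\<^sup>+x. ennreal (shift_lr m \<tau> \<beta> (\<Sum>i\<in>A. x i) (\<Sum>i\<in>B. x i)) * H x \<partial>?N S)
      = (\<integral>\<^sup>+x. \<integral>\<^sup>+\<zeta>. W \<zeta> x * H x \<partial>stdnormal \<partial>?N S)"
  proof (intro nn_integral_cong)
    fix x assume "x \<in> space (?N S)"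
    have "(\<integral>\<^sup>+\<zeta>. W \<zeta> x * H x \<partial>stdnormal) = (\<integral>\<^sup>+\<zeta>. W \<zeta> x \<partial>stdnormal) * H x"
      by (rule nn_integral_multc) (simp add: W_def \<mu>_def)
    also have "(\<integral>\<^sup>+\<zeta>. W \<zeta> x \<partial>stdnormal) = ennreal (shift_lr m \<tau> \<beta> (\<Sum>i\<in>A. x i) (\<Sum>i\<in>B. x i))"
      unfolding W_def \<mu>_def using par m by (intro nn_integral_shift_lr) auto
    finally show "ennreal (shift_lr m \<tau> \<beta> (\<Sum>i\<in>A. x i) (\<Sum>i\<in>B. x i)) * H x = (\<integral>\<^sup>+\<zeta>. W \<zeta> x * H x \<partial>stdnormal)" ..
  qed
  also have "\<dots> = (\<integral>\<^sup>+\<zeta>. \<integral>\<^sup>+x. W \<zeta> x * H x \<partial>?N S \<partial>stdnormal)"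
    by (rule P.Fubini'[symmetric]) measurable
  \<comment> \<open>For fixed \<open>\<zeta>\<close> and fixed values on \<open>A\<close> the shift
    is a constant, so the weight \<open>W\<close> is absorbed by translating the variables in
    \<open>B\<close>. The second ratio then becomes a function of two linear forms in noise and
    latent variable.\<close>
  also have "\<dots> = (\<integral>\<^sup>+\<zeta>. \<integral>\<^sup>+x. K (x(0 := \<zeta>)) \<partial>?N S \<partial>stdnormal)"
  proof (rule nn_integral_cong)
    fix \<zeta> :: real
    have [measurable]: "(\<lambda>x. x(0 := \<zeta>)) \<in> measurable (?N S) (?N (insert 0 S))"
      by (rule measurable_fun_upd[where J=S]) auto
    have HB: "(\<lambda>y. H (merge A B (u, y))) \<in> borel_measurable (PiM B (\<lambda>_. borel))" if "u \<in> space (?N A)" for u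
    proof -
      have "(\<lambda>y. merge A B (u, y)) \<in> measurable (?N B) (?N (A \<union> B))"
        using that by (intro measurable_compose[OF measurable_Pair1' measurable_merge])
      then have "(\<lambda>y. H (merge A B (u, y))) \<in> borel_measurable (?N B)"
        using H unfolding AB(2) by (rule measurable_compose)
      then show ?thesis by (simp cong: measurable_cong_sets sets_PiM_cong)
    qed
    have "(\<integral>\<^sup>+x. W \<zeta> x * H x \<partial>?N S)
        = (\<integral>\<^sup>+u. \<integral>\<^sup>+y. W \<zeta> (merge A B (u, y)) * H (merge A B (u, y)) \<partial>?N B \<partial>?N A)"
      using stdnormal_prod.product_nn_integral_fold[OF AB(1), of "\<lambda>x. W \<zeta> x * H x"] unfolding AB(2) by simp
    also have "\<dots> = (\<integral>\<^sup>+u. \<integral>\<^sup>+y. H (merge A B (u, \<lambda>i\<in>B. y i + \<mu> \<zeta> u)) \<partial>?N B \<partial>?N A)"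
    proof (rule nn_integral_cong)
      fix u assume u: "u \<in> space (?N A)"
      have "W \<zeta> (merge A B (u, y)) = ennreal (exp (\<mu> \<zeta> u * (\<Sum>i\<in>B. y i) - real (card B) * (\<mu> \<zeta> u)\<^sup>2 / 2))" for y
      proof -
        have "(\<Sum>i\<in>A. merge A B (u, y) i) = (\<Sum>i\<in>A. u i)" "(\<Sum>i\<in>B. merge A B (u, y) i) = (\<Sum>i\<in>B. y i)"
          using AB(1) by (auto intro!: sum.cong simp: merge_def)
        then show ?thesis by (simp add: W_def \<mu>_def cB)
      qed
      then show "(\<integral>\<^sup>+y. W \<zeta> (merge A B (u, y)) * H (merge A B (u, y)) \<partial>?N B)
          = (\<integral>\<^sup>+y. H (merge A B (u, \<lambda>i\<in>B. y i + \<mu> \<zeta> u)) \<partial>?N B)"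
        using nn_integral_PiM_stdnormal_shift[OF fin(3) HB[OF u], of "\<mu> \<zeta> u"] by simp
    qed
    also have "\<dots> = (\<integral>\<^sup>+u. \<integral>\<^sup>+y. K ((merge A B (u, y))(0 := \<zeta>)) \<partial>?N B \<partial>?N A)"
      unfolding H_def K_def using AB' by (subst (1 2) shifted) auto
    also have "\<dots> = (\<integral>\<^sup>+x. K (x(0 := \<zeta>)) \<partial>?N S)"
      using stdnormal_prod.product_nn_integral_fold[OF AB(1), of "\<lambda>x. K (x(0 := \<zeta>))"] unfolding AB(2) by simp
    finally show "(\<integral>\<^sup>+x. W \<zeta> x * H x \<partial>?N S) = (\<integral>\<^sup>+x. K (x(0 := \<zeta>)) \<partial>?N S)" .
  qed
  also have "\<dots> = (\<integral>\<^sup>+x. K x \<partial>?N (insert 0 S))"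
    using S by (subst stdnormal_prod.product_nn_integral_insert_rev) auto
  also have "\<dots> = ennreal (1 / sqrt ((1 - \<beta>\<^sup>2 * w)\<^sup>2 - (2 * \<beta> * w / m)\<^sup>2))"
  proof -
    define \<sigma> where "\<sigma> = 1 + m * \<tau>"
    have \<sigma>: "\<sigma> > 0" using m par by (simp add: \<sigma>_def add_pos_nonneg)
    have gram: "(\<Sum>i\<in>insert 0 S. p C i * p D i) = real (card (C \<inter> D)) - real (card (D \<inter> B)) * \<beta> * real (card (C \<inter> A))
        - real (card (C \<inter> B)) * \<beta> * real (card (D \<inter> A))
        + (\<beta>\<^sup>2 * k + \<tau>) * real (card (C \<inter> B)) * real (card (D \<inter> B))" if "C \<subseteq> S" "D \<subseteq> S" for C D
    proof -
      have "(\<Sum>i\<in>S. p C i * p D i) = (\<Sum>i\<in>S. (indicator C i - real (card (C \<inter> B)) * \<beta> * indicator A i)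
          * (indicator D i - real (card (D \<inter> B)) * \<beta> * indicator A i))"
        by (rule sum.cong) (use S in \<open>auto simp: p_def\<close>)
      also note sum_indicator_bilinear[OF S(1) A(1) that]
      finally have "(\<Sum>i\<in>insert 0 S. p C i * p D i) = p C 0 * p D 0 + (real (card (C \<inter> D)) - real (card (D \<inter> B)) * \<beta> * real (card (C \<inter> A))
        - real (card (C \<inter> B)) * \<beta> * real (card (D \<inter> A))
        + real (card (C \<inter> B)) * \<beta> * (real (card (D \<inter> B)) * \<beta>) * k)"
        using S k by simp
      moreover have "p C 0 * p D 0 = \<tau> * real (card (C \<inter> B)) * real (card (D \<inter> B))"
        using par(1) by (simp add: p_def mult_ac)
      ultimately show ?thesis by (simp add: power2_eq_square algebra_simps)
    qed
    define G11 where "G11 = k - 2 * \<beta> * e * t + (\<beta>\<^sup>2 * k + \<tau>) * e\<^sup>2"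
    define G12 where "G12 = - \<beta> * (f * t + e\<^sup>2) + (\<beta>\<^sup>2 * k + \<tau>) * e * f"
    define G22 where "G22 = m - 2 * \<beta> * e * f + (\<beta>\<^sup>2 * k + \<tau>) * f\<^sup>2"
    have card: "real (card (A' \<inter> A)) = t" by (simp add: t_def Int_commute)
    have 11: "G11 = (\<Sum>i\<in>insert 0 S. (p A' i)\<^sup>2)"
      unfolding power2_eq_square gram[OF A(2) A(2)] using k card
      by (simp add: G11_def e_def power2_eq_square algebra_simps)
    have BS: "B' \<subseteq> S" using AB' by auto
    have 12: "G12 = (\<Sum>i\<in>insert 0 S. p A' i * p B' i)"
      using gram[OF A(2) BS] AB' card BA
      by (simp add: G12_def e_def[symmetric] f_def[symmetric] power2_eq_square algebra_simps)
    have 22: "G22 = (\<Sum>i\<in>insert 0 S. (p B' i)\<^sup>2)"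
      using gram[OF BS BS] BA cB'
      by (simp add: G22_def e_def[symmetric] f_def[symmetric] power2_eq_square algebra_simps)
    define D where "D = 1 - ((- m * \<beta>\<^sup>2 / \<sigma>) * G11 + 2 * (- \<beta> / \<sigma>) * G12 + (\<tau> / \<sigma>) * G22)
      + ((- m * \<beta>\<^sup>2 / \<sigma>) * (\<tau> / \<sigma>) - (- \<beta> / \<sigma>)\<^sup>2) * (G11 * G22 - G12\<^sup>2)"
    have "(- m * \<beta>\<^sup>2 / \<sigma>) * (\<tau> / \<sigma>) - (- \<beta> / \<sigma>)\<^sup>2 = - \<beta>\<^sup>2 * (1 + m * \<tau>) / \<sigma>\<^sup>2"
      using \<sigma> by (simp add: field_simps power2_eq_square)
    also have "\<dots> = - \<beta>\<^sup>2 / \<sigma>"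
      using \<sigma> by (simp add: \<sigma>_def[symmetric] power2_eq_square)
    finally have detM: "(- m * \<beta>\<^sup>2 / \<sigma>) * (\<tau> / \<sigma>) - (- \<beta> / \<sigma>)\<^sup>2 = - \<beta>\<^sup>2 / \<sigma>" .
    have "\<sigma> * D = \<sigma> + m * \<beta>\<^sup>2 * G11 + 2 * \<beta> * G12 - \<tau> * G22 - \<beta>\<^sup>2 * (G11 * G22 - G12\<^sup>2)"
      unfolding D_def detM using \<sigma> by (simp add: field_simps)
    also have "\<dots> = (1 - \<beta>\<^sup>2 * w)\<^sup>2 - (2 * \<beta> * w / m)\<^sup>2"
      unfolding \<sigma>_def using m par(3) w e f by (intro overlap_determinant) (auto simp: G11_def G12_def G22_def t_def)
    finally have \<sigma>D: "\<sigma> * D = (1 - \<beta>\<^sup>2 * w)\<^sup>2 - (2 * \<beta> * w / m)\<^sup>2" .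
    have D: "D > 0" using \<sigma>D pos \<sigma> by (metis zero_less_mult_pos)
    \<comment> \<open>This prepares the condition \<open>m22 * G22 < 1\<close>. Dropping the
      negative cross term and using \<open>f \<le> m\<close>, the root equation bounds
      \<open>G22\<close> by m + 2 \<beta> k m, and the assumption on 2 \<beta> k m \<tau> then gives
      \<tau> G22 < 1 + m \<tau>.\<close>
    have "G22 \<le> m + (\<beta>\<^sup>2 * k + \<tau>) * m\<^sup>2"
    proof -
      have "(\<beta>\<^sup>2 * k + \<tau>) * f\<^sup>2 \<le> (\<beta>\<^sup>2 * k + \<tau>) * m\<^sup>2"
        using ef par k by (intro mult_left_mono power_mono add_nonneg_nonneg mult_nonneg_nonneg) auto
      moreover have "0 \<le> 2 * \<beta> * e * f" using ef par by simp
      ultimately show ?thesis unfolding G22_def by linarith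
    qed
    also have "(\<beta>\<^sup>2 * k + \<tau>) * m\<^sup>2 = m * (\<beta>\<^sup>2 * k * m + m * \<tau>)"
      by (simp add: power2_eq_square algebra_simps)
    also have "\<beta>\<^sup>2 * k * m + m * \<tau> = 2 * \<beta> * k" using par(3) by simp
    finally have "\<tau> * G22 \<le> \<tau> * (m + m * (2 * \<beta> * k))"
      using par(1) by (intro mult_left_mono)
    also have "\<dots> < \<sigma>" using par(4) by (simp add: \<sigma>_def algebra_simps)
    finally have m22: "\<tau> / \<sigma> * G22 < 1" using \<sigma> by (simp add: field_simps)
    have "(\<integral>\<^sup>+x. K x \<partial>?N (insert 0 S)) = ennreal (1 / sqrt \<sigma>) * ennreal (1 / sqrt D)"
    proof -
      have "K x = ennreal (1 / sqrt \<sigma>) * ennreal (exp (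
          (- m * \<beta>\<^sup>2 / \<sigma>) * (\<Sum>i\<in>insert 0 S. p A' i * x i)\<^sup>2 / 2
          + (- \<beta> / \<sigma>) * (\<Sum>i\<in>insert 0 S. p A' i * x i) * (\<Sum>i\<in>insert 0 S. p B' i * x i)
          + (\<tau> / \<sigma>) * (\<Sum>i\<in>insert 0 S. p B' i * x i)\<^sup>2 / 2))" for x
        unfolding K_def using \<sigma> by (subst shift_lr_quadratic) (simp_all only: \<sigma>_def, simp add: ennreal_mult[symmetric])
      then show ?thesis
        using nn_integral_exp_quadratic_forms[OF _ 11 12 22 D_def D _ m22] S(1) par(1) \<sigma>
        by (simp only: nn_integral_cmult) (subst nn_integral_cmult; simp)
    qed
    also have "\<dots> = ennreal (1 / sqrt (\<sigma> * D))"
      using \<sigma> D by (simp add: ennreal_mult[symmetric] real_sqrt_mult)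
    finally show ?thesis unfolding \<sigma>D .
  qed
  finally show ?thesis unfolding H_def B_def B'_def .
qed

section \<open>Moment generating function of the intersection of two random sets\<close>

text \<open>The quotient of the two binomials is a product of factors (k - i) / (n - i) with i < j,
  each at most k / n. It is the probability that a random k-subset contains j given points; writing
  products instead of quotients keeps the induction in the natural numbers.\<close>

lemma binomial_diff_mult_power_le:
  "j \<le> k \<Longrightarrow> k \<le> n \<Longrightarrow> ((n - j) choose (k - j)) * n ^ j \<le> k ^ j * (n choose k)"
proof (induction j)
  case (Suc j)
  let ?C = "\<lambda>j. (n - j) choose (k - j)"
  have n: "n - j = Suc (n - Suc j)" and k: "k - j = Suc (k - Suc j)" using Suc.prems by auto
  have rec: "?C (Suc j) * (n - j) = (k - j) * ?C j"
    unfolding n k by (simp only: Suc_times_binomial mult.commute)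
  have "(?C (Suc j) * n ^ Suc j) * (n - j) = (?C (Suc j) * (n - j)) * n ^ Suc j"
    by (simp only: mult_ac)
  also have "\<dots> = ((k - j) * n) * (?C j * n ^ j)"
    unfolding rec by (simp only: power_Suc mult_ac)
  also have "\<dots> \<le> (k * (n - j)) * (k ^ j * (n choose k))"
  proof (rule mult_mono)
    have "j * k \<le> j * n" using Suc.prems by simp
    then show "(k - j) * n \<le> k * (n - j)"
      using diff_le_mono2[of "j * k" "j * n" "k * n"] by (simp add: diff_mult_distrib diff_mult_distrib2 mult.commute)
  qed (use Suc in auto)
  also have "\<dots> = (k ^ Suc j * (n choose k)) * (n - j)" by simp
  finally show ?case using Suc.prems by (simp only: mult_le_cancel2)
qed simp

lemma card_subsets_containing:
  assumes "finite S" "T \<subseteq> S"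
  shows "card {B. B \<subseteq> S \<and> card B = k \<and> T \<subseteq> B} = (if card T \<le> k then (card S - card T) choose (k - card T) else 0)"
proof (cases "card T \<le> k")
  case True
  have finT: "finite T" using assms finite_subset by blast
  have "bij_betw (\<lambda>B. B \<union> T) {B. B \<subseteq> S - T \<and> card B = k - card T} {B. B \<subseteq> S \<and> card B = k \<and> T \<subseteq> B}"
  proof (rule bij_betwI[where g="\<lambda>B. B - T"])
    show "(\<lambda>B. B \<union> T) \<in> {B. B \<subseteq> S - T \<and> card B = k - card T} \<rightarrow> {B. B \<subseteq> S \<and> card B = k \<and> T \<subseteq> B}"
    proof (intro Pi_I, clarify, intro conjI)
      fix B assume B: "B \<subseteq> S - T" "card B = k - card T"
      then have "finite B" using assms finite_subset by blast
      moreover have "B \<inter> T = {}" using B by auto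
      ultimately show "card (B \<union> T) = k" using B True finT by (simp add: card_Un_disjoint)
    qed (use assms in auto)
    show "(\<lambda>B. B - T) \<in> {B. B \<subseteq> S \<and> card B = k \<and> T \<subseteq> B} \<rightarrow> {B. B \<subseteq> S - T \<and> card B = k - card T}"
      using card_Diff_subset[OF finT] by fastforce
  qed blast+
  then have "card {B. B \<subseteq> S \<and> card B = k \<and> T \<subseteq> B} = card {B. B \<subseteq> S - T \<and> card B = k - card T}"
    by (rule bij_betw_same_card[symmetric])
  also have "\<dots> = card (S - T) choose (k - card T)"
    using assms by (intro n_subsets) auto
  also have "card (S - T) = card S - card T" by (rule card_Diff_subset[OF finT assms(2)])
  finally show ?thesis using True by simp
next
  case False
  have "card T \<le> card B" if "B \<subseteq> S" "T \<subseteq> B" for B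
    using that(2) by (rule card_mono[OF finite_subset[OF that(1) assms(1)]])
  then have empty: "{B. B \<subseteq> S \<and> card B = k \<and> T \<subseteq> B} = {}" using False by blast
  show ?thesis unfolding empty using False by simp
qed

lemma sum_Pow_power_card:
  fixes x :: real
  shows "finite F \<Longrightarrow> (\<Sum>T\<in>Pow F. x ^ card T) = (1 + x) ^ card F"
proof (induction F rule: finite_induct)
  case (insert a F)
  have "(\<Sum>T\<in>Pow (insert a F). x ^ card T) = (\<Sum>T\<in>Pow F. x ^ card T) + (\<Sum>T\<in>insert a ` Pow F. x ^ card T)"
    unfolding Pow_insert using insert by (intro sum.union_disjoint) auto
  also have "(\<Sum>T\<in>insert a ` Pow F. x ^ card T) = (\<Sum>T\<in>Pow F. x ^ card (insert a T))"
    using insert.hyps by (subst sum.reindex) (auto simp: inj_on_def)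
  also have "\<dots> = (\<Sum>T\<in>Pow F. x * x ^ card T)"
  proof (rule sum.cong[OF refl])
    fix T assume "T \<in> Pow F"
    then have "finite T" "a \<notin> T" using insert.hyps finite_subset by auto
    then show "x ^ card (insert a T) = x * x ^ card T" by simp
  qed
  finally show ?case using insert by (simp add: sum_distrib_left[symmetric] algebra_simps)
qed simp

text \<open>Expanding the power over the subsets \<open>T\<close> of \<open>A \<inter> B\<close> and
  exchanging sums leaves the number of sets that contain \<open>T\<close>, which is compared term by
  term with independent sampling; \<open>x \<ge> 0\<close> preserves the direction. The bound is the
  generating function of a binomial variable with success probability k / n.\<close>

lemma sum_power_card_Int_le:
  fixes x :: real
  assumes S: "finite S" "S \<noteq> {}" and A: "A \<subseteq> S" and k: "k \<le> card S" and x: "x \<ge> 0"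
  shows "(\<Sum>B | B \<subseteq> S \<and> card B = k. (1 + x) ^ card (A \<inter> B))
    \<le> real (card S choose k) * (1 + x * (real k / real (card S))) ^ card A"
proof -
  let ?K = "{B. B \<subseteq> S \<and> card B = k}"
  define n where "n = card S"
  have n: "n > 0" using S by (auto simp: n_def card_gt_0_iff)
  have finA: "finite A" using S A finite_subset by blast
  have finK: "finite ?K" using S by simp
  have "(\<Sum>B\<in>?K. (1 + x) ^ card (A \<inter> B)) = (\<Sum>B\<in>?K. \<Sum>T\<in>Pow (A \<inter> B). x ^ card T)"
    using finA by (intro sum.cong refl sum_Pow_power_card[symmetric]) auto
  also have "\<dots> = (\<Sum>B\<in>?K. \<Sum>T | T \<in> Pow A \<and> T \<subseteq> B. x ^ card T)"
    by (intro sum.cong) auto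
  also have "\<dots> = (\<Sum>T\<in>Pow A. \<Sum>B | B \<in> ?K \<and> T \<subseteq> B. x ^ card T)"
    using finA finK by (intro sum.swap_restrict) auto
  also have "\<dots> = (\<Sum>T\<in>Pow A. x ^ card T * real (card {B. B \<subseteq> S \<and> card B = k \<and> T \<subseteq> B}))"
    by (simp add: conj_assoc mult.commute)
  also have "\<dots> \<le> (\<Sum>T\<in>Pow A. x ^ card T * (real (n choose k) * (real k / real n) ^ card T))"
  proof (intro sum_mono mult_left_mono)
    fix T assume "T \<in> Pow A"
    then have T: "T \<subseteq> S" using A by auto
    show "real (card {B. B \<subseteq> S \<and> card B = k \<and> T \<subseteq> B}) \<le> real (n choose k) * (real k / real n) ^ card T"
    proof (cases "card T \<le> k")
      case True
      have "real (((n - card T) choose (k - card T)) * n ^ card T) \<le> real (k ^ card T * (n choose k))"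
        using binomial_diff_mult_power_le[OF True, of n] k n_def by (intro of_nat_mono) simp
      then show ?thesis
        using True n card_subsets_containing[OF S(1) T, of k]
        by (simp add: n_def[symmetric] field_simps power_divide)
    next
      case False
      then show ?thesis using card_subsets_containing[OF S(1) T, of k] by simp
    qed
  qed (use x in auto)
  also have "\<dots> = real (n choose k) * (\<Sum>T\<in>Pow A. (x * (real k / real n)) ^ card T)"
    by (simp only: sum_distrib_left power_mult_distrib mult_ac)
  also have "\<dots> = real (n choose k) * (1 + x * (real k / real n)) ^ card A"
    by (simp add: sum_Pow_power_card[OF finA])
  finally show ?thesis by (simp add: n_def)
qed

text \<open>For negative \<open>l\<close> one counts the points of \<open>A\<close> in the complement of the random set.\<close>

lemma sum_exp_card_Int_le:
  fixes l :: real
  assumes S: "finite S" "S \<noteq> {}" and A: "A \<subseteq> S" "card A = k" and l: "\<bar>l\<bar> \<le> 1"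
  defines "V \<equiv> (real k)\<^sup>2 / real (card S)"
  shows "(\<Sum>B | B \<subseteq> S \<and> card B = k. exp (l * (real (card (A \<inter> B)) - V))) \<le> real (card S choose k) * exp (V * l\<^sup>2)"
proof -
  let ?K = "\<lambda>k. {B. B \<subseteq> S \<and> card B = k}"
  define n where "n = card S"
  have n: "n > 0" using S by (auto simp: n_def card_gt_0_iff)
  have finA: "finite A" using S A finite_subset by blast
  have kn: "k \<le> n" unfolding n_def A(2)[symmetric] using S A by (intro card_mono)
  have V: "V = real k * (real k / real n)" by (simp add: V_def n_def power2_eq_square)
  have V0: "V \<ge> 0" by (simp add: V_def)
  \<comment> \<open>Poisson bound with mean \<open>V\<close>, proved without restricting
    \<open>l\<close>; the passage to a quadratic exponent comes afterwards.\<close>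
  have main: "(\<Sum>B\<in>?K k. exp (l * real (card (A \<inter> B)))) \<le> real (n choose k) * exp (V * (exp l - 1))"
  proof (cases "l \<ge> 0")
    case True
    have "(\<Sum>B\<in>?K k. exp (l * real (card (A \<inter> B)))) = (\<Sum>B\<in>?K k. (1 + (exp l - 1)) ^ card (A \<inter> B))"
      by (simp add: exp_of_nat_mult[symmetric] mult.commute)
    also have "\<dots> \<le> real (n choose k) * (1 + (exp l - 1) * (real k / real n)) ^ k"
      using sum_power_card_Int_le[OF S A(1), of k "exp l - 1"] kn True A(2) by (simp add: n_def)
    also have "\<dots> \<le> real (n choose k) * (exp ((exp l - 1) * (real k / real n))) ^ k"
      using True by (intro mult_left_mono power_mono exp_ge_add_one_self add_nonneg_nonneg mult_nonneg_nonneg) auto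
    also have "(exp ((exp l - 1) * (real k / real n))) ^ k = exp (V * (exp l - 1))"
      unfolding V by (simp add: exp_of_nat_mult[symmetric] mult_ac)
    finally show ?thesis .
  next
    case False
    have card: "real (card (A \<inter> B)) = real k - real (card (A \<inter> (S - B)))" if "B \<subseteq> S" for B
    proof -
      have "card ((A \<inter> B) \<union> (A \<inter> (S - B))) = card (A \<inter> B) + card (A \<inter> (S - B))"
        using finA by (intro card_Un_disjoint) auto
      moreover have "(A \<inter> B) \<union> (A \<inter> (S - B)) = A" using A by auto
      ultimately show ?thesis using A by simp
    qed
    have "(\<Sum>B\<in>?K k. exp (l * real (card (A \<inter> B)))) = (\<Sum>B\<in>?K k. exp (l * real k) * (1 + (exp (- l) - 1)) ^ card (A \<inter> (S - B)))"
    proof (intro sum.cong refl)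
      fix B assume "B \<in> ?K k"
      then have "B \<subseteq> S" by simp
      then have "exp (l * real (card (A \<inter> B))) = exp (l * real k + real (card (A \<inter> (S - B))) * (- l))"
        by (simp add: card[of B] algebra_simps)
      then show "exp (l * real (card (A \<inter> B))) = exp (l * real k) * (1 + (exp (- l) - 1)) ^ card (A \<inter> (S - B))"
        by (simp only: exp_add exp_of_nat_mult) simp
    qed
    also have "\<dots> = (\<Sum>B\<in>?K (n - k). exp (l * real k) * (1 + (exp (- l) - 1)) ^ card (A \<inter> B))"
    proof (rule sum.reindex_bij_betw)
      have "card (S - B) = n - card B" if "B \<subseteq> S" for B
        unfolding n_def using S that by (intro card_Diff_subset) (auto intro: finite_subset)
      then show "bij_betw (\<lambda>B. S - B) (?K k) (?K (n - k))"
        by (intro bij_betwI[where g="\<lambda>B. S - B"]) (use kn in \<open>auto simp: double_diff\<close>)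
    qed
    also have "\<dots> \<le> exp (l * real k) * (real (n choose (n - k)) * (1 + (exp (- l) - 1) * (real (n - k) / real n)) ^ k)"
      using sum_power_card_Int_le[OF S A(1), of "n - k" "exp (- l) - 1"] False A(2)
      unfolding sum_distrib_left[symmetric] by (intro mult_left_mono) (auto simp: n_def)
    also have "\<dots> = real (n choose k) * (exp l * (1 + (exp (- l) - 1) * (real (n - k) / real n))) ^ k"
      using kn by (simp add: binomial_symmetric[symmetric] power_mult_distrib exp_of_nat_mult[symmetric] mult_ac)
    \<comment> \<open>One factor \<open>exp l\<close> per point of \<open>A\<close> undoes the
      passage to complements, and the binomial base of the case \<open>l \<ge> 0\<close>
      reappears.\<close>
    also have "exp l * (1 + (exp (- l) - 1) * (real (n - k) / real n)) = 1 + (exp l - 1) * (real k / real n)"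
    proof -
      have r: "real (n - k) / real n = 1 - real k / real n" using kn n by (simp add: of_nat_diff diff_divide_distrib)
      have "y * (1 + (z - 1) * (1 - r)) = y * r + (y * z) * (1 - r)" for y z r :: real
        by (simp add: algebra_simps)
      then have "exp l * (1 + (exp (- l) - 1) * (real (n - k) / real n)) = exp l * (real k / real n) + (1 - real k / real n)"
        unfolding r by (simp add: mult_exp_exp)
      then show ?thesis by (simp only: left_diff_distrib)
    qed
    also have "real (n choose k) * (1 + (exp l - 1) * (real k / real n)) ^ k
        \<le> real (n choose k) * (exp ((exp l - 1) * (real k / real n))) ^ k"
    proof (intro mult_left_mono power_mono exp_ge_add_one_self)
      have "1 + (x - 1) * r = (1 - r) + x * r" for x r :: real by (simp add: algebra_simps)
      then have "1 + (exp l - 1) * (real k / real n) = (1 - real k / real n) + exp l * (real k / real n)" .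
      also have "\<dots> \<ge> 0" using kn n by (intro add_nonneg_nonneg) auto
      finally show "0 \<le> 1 + (exp l - 1) * (real k / real n)" .
    qed auto
    also have "(exp ((exp l - 1) * (real k / real n))) ^ k = exp (V * (exp l - 1))"
      unfolding V by (simp add: exp_of_nat_mult[symmetric] mult_ac)
    finally show ?thesis .
  qed
  \<comment> \<open>From the Poisson to a Gaussian exponent; the assumption
    \<open>\<bar>l\<bar> \<le> 1\<close> enters here.\<close>
  have expl: "exp l - 1 \<le> l + l\<^sup>2"
  proof (cases "l \<ge> 0")
    case True
    then show ?thesis using exp_bound[of l] l by simp
  next
    case False
    have "1 - l \<le> exp (- l)" using exp_ge_add_one_self[of "- l"] by simp
    then have "exp l \<le> 1 / (1 - l)"
      using False by (simp add: exp_minus field_simps)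
    also have "\<dots> \<le> 1 + l + l\<^sup>2"
    proof -
      have "(1 + l + l\<^sup>2) * (1 - l) = 1 - l ^ 3" by (simp add: power2_eq_square power3_eq_cube algebra_simps)
      moreover have "l ^ 3 \<le> 0" using False by (simp add: power_le_zero_eq)
      ultimately show ?thesis using False by (simp add: divide_le_eq)
    qed
    finally show ?thesis by simp
  qed
  have "(\<Sum>B\<in>?K k. exp (l * (real (card (A \<inter> B)) - V))) = exp (- l * V) * (\<Sum>B\<in>?K k. exp (l * real (card (A \<inter> B))))"
    by (simp add: sum_distrib_left exp_add[symmetric] algebra_simps)
  also have "\<dots> \<le> exp (- l * V) * (real (n choose k) * exp (V * (exp l - 1)))"
    by (intro mult_left_mono main) auto
  also have "\<dots> = real (n choose k) * (exp (- l * V) * exp (V * (exp l - 1)))"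
    by (simp only: mult_ac)
  also have "exp (- l * V) * exp (V * (exp l - 1)) = exp (V * (exp l - 1) - l * V)"
    by (simp add: mult_exp_exp)
  also have "real (n choose k) * exp (V * (exp l - 1) - l * V) \<le> real (n choose k) * exp (V * l\<^sup>2)"
  proof -
    have "V * (exp l - 1) \<le> V * (l + l\<^sup>2)" using expl V0 by (rule mult_left_mono)
    then show ?thesis by (intro mult_left_mono) (auto simp: algebra_simps)
  qed
  finally show ?thesis by (simp add: n_def)
qed

text \<open>The square in the exponent is removed by exp v \<le> 1 + v exp v with v = \<theta> s^2.
  The prefactor s^2 is at most 2 V exp (|s| / sqrt V), and |s| \<le> k bounds exp v by exp (\<theta>
  k |s|). What remains are exponentials linear in \<open>s\<close>, covered by the moment bound,
  with the small factor \<theta> V in front.\<close>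

lemma sum_exp_quadratic_card_Int_le:
  fixes \<xi> \<theta> :: real
  assumes S: "finite S" "S \<noteq> {}" and A: "A \<subseteq> S" "card A = k"
    and V: "V = (real k)\<^sup>2 / real (card S)" "V \<ge> 9"
    and par: "\<xi> \<ge> 0" "\<theta> \<ge> 0" "V * \<xi>\<^sup>2 \<le> 1" "V * (\<theta> * real k)\<^sup>2 \<le> 1"
  shows "(\<Sum>B | B \<subseteq> S \<and> card B = k. exp (\<xi> * (real (card (A \<inter> B)) - V) + \<theta> * (real (card (A \<inter> B)) - V)\<^sup>2))
    \<le> real (card S choose k) * (exp (V * \<xi>\<^sup>2) + 8 * \<theta> * V * exp 9)"
proof -
  let ?K = "{B. B \<subseteq> S \<and> card B = k}"
  define s where "s = (\<lambda>B. real (card (A \<inter> B)) - V)"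
  define r where "r = 1 / sqrt V"
  define \<eta> where "\<eta> = \<theta> * real k"
  \<comment> \<open>These rates arise from the choices of sign in exp |r s| and exp |\<eta> s|. Each
    is at most 3 r in absolute value, so V l^2 \<le> 9, which is the origin of \<open>exp 9\<close>.
    The assumption \<open>V \<ge> 9\<close> gives 3 r \<le> 1, the range of the moment
    bound.\<close>
  let ?L = "[\<xi> + r + \<eta>, \<xi> + r - \<eta>, \<xi> - r + \<eta>, \<xi> - r - \<eta>]"
  have V0: "V > 0" using V(2) by simp
  have r: "r > 0" "V * r\<^sup>2 = 1" using V0 by (auto simp: r_def power_divide)
  have "3\<^sup>2 \<le> V" using V(2) by simp
  then have "3 \<le> sqrt V" by (rule real_le_rsqrt)
  then have r3: "r \<le> 1 / 3" using V0 by (simp add: r_def field_simps)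
  have \<eta>0: "\<eta> \<ge> 0" using par by (simp add: \<eta>_def)
  have le_r: "a \<le> r" if "V * a\<^sup>2 \<le> 1" for a
  proof (rule power2_le_imp_le)
    show "a\<^sup>2 \<le> r\<^sup>2" using that r(2) V0 by (metis mult_le_cancel_left_pos)
  qed (use r in simp)
  have \<xi>r: "\<xi> \<le> r" using par(3) by (rule le_r)
  have \<eta>r: "\<eta> \<le> r" using par(4) unfolding \<eta>_def by (rule le_r)
  have finA: "finite A" using S A finite_subset by blast
  have kn: "k \<le> card S" unfolding A(2)[symmetric] using S A by (intro card_mono)
  have s_bound: "\<bar>s B\<bar> \<le> real k" for B
  proof -
    have "card (A \<inter> B) \<le> k" unfolding A(2)[symmetric] using finA by (intro card_mono) auto
    moreover have "V \<le> real k"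
    proof -
      have "card S > 0" using S by (auto simp: card_gt_0_iff)
      then show ?thesis using kn by (simp add: V(1) field_simps power2_eq_square mult_left_mono)
    qed
    ultimately show ?thesis using V0 unfolding s_def by linarith
  qed
  have mgf: "(\<Sum>B\<in>?K. exp (l * s B)) \<le> real (card S choose k) * exp (V * l\<^sup>2)" if "\<bar>l\<bar> \<le> 1" for l
    using sum_exp_card_Int_le[OF S A that] unfolding s_def V(1) .
  have mgf9: "(\<Sum>B\<in>?K. exp (l * s B)) \<le> real (card S choose k) * exp 9" if "l \<in> set ?L" for l
  proof -
    have l: "\<bar>l\<bar> \<le> 3 * r" using that par(1) \<eta>0 \<xi>r \<eta>r r(1) by auto
    then have "\<bar>l\<bar> \<le> 1" using r3 by linarith
    moreover have "V * l\<^sup>2 \<le> 9"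
    proof -
      have "l\<^sup>2 \<le> (3 * r)\<^sup>2" using l by (metis abs_ge_zero power2_abs power_mono)
      then have "V * l\<^sup>2 \<le> V * (3 * r)\<^sup>2" using V0 by simp
      also have "\<dots> = 9 * (V * r\<^sup>2)" by (simp add: power_mult_distrib)
      finally show ?thesis using r(2) by simp
    qed
    ultimately show ?thesis by (intro order_trans[OF mgf] mult_left_mono) auto
  qed
  have pt: "exp (\<xi> * s B + \<theta> * (s B)\<^sup>2) \<le> exp (\<xi> * s B) + 2 * \<theta> * V * (\<Sum>l\<leftarrow>?L. exp (l * s B))" for B
  proof -
    let ?s = "s B"
    have e1: "exp u \<le> 1 + u * exp u" for u :: real
      using exp_ge_add_one_self[of "- u"] by (simp add: exp_minus field_simps)
    have e2: "exp \<bar>a\<bar> \<le> exp a + exp (- a)" for a :: real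
      by (cases "a \<ge> 0") auto
    \<comment> \<open>The scale \<open>r\<close> satisfies V r^2 = 1, and a^2 \<le> 2 exp |a| is
      applied with a = r s.\<close>
    have "?s\<^sup>2 = V * (r * ?s)\<^sup>2" using r(2) by (simp add: power_mult_distrib mult.assoc[symmetric])
    also have "(r * ?s)\<^sup>2 \<le> 2 * exp \<bar>r * ?s\<bar>"
      using exp_lower_Taylor_quadratic[of "\<bar>r * ?s\<bar>"] by simp
    also have "\<dots> \<le> 2 * (exp (r * ?s) + exp (- (r * ?s)))" using e2[of "r * ?s"] by simp
    finally have s2: "?s\<^sup>2 \<le> V * (2 * (exp (r * ?s) + exp (- (r * ?s))))" using V0 by simp
    have "\<theta> * ?s\<^sup>2 \<le> \<bar>\<eta> * ?s\<bar>"
    proof -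
      have "\<bar>?s\<bar> * \<bar>?s\<bar> \<le> real k * \<bar>?s\<bar>" by (intro mult_right_mono s_bound) auto
      then have "\<theta> * (\<bar>?s\<bar> * \<bar>?s\<bar>) \<le> \<theta> * (real k * \<bar>?s\<bar>)" using par(2) by (rule mult_left_mono)
      then show ?thesis using par(2) by (simp add: \<eta>_def abs_mult power2_eq_square mult.assoc)
    qed
    then have "exp (\<theta> * ?s\<^sup>2) \<le> exp \<bar>\<eta> * ?s\<bar>" by simp
    also have "\<dots> \<le> exp (\<eta> * ?s) + exp (- (\<eta> * ?s))" by (rule e2)
    finally have e3: "exp (\<theta> * ?s\<^sup>2) \<le> exp (\<eta> * ?s) + exp (- (\<eta> * ?s))" .
    have "exp (\<theta> * ?s\<^sup>2) \<le> 1 + \<theta> * (?s\<^sup>2 * exp (\<theta> * ?s\<^sup>2))" using e1[of "\<theta> * ?s\<^sup>2"] by (simp add: mult.assoc)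
    also have "?s\<^sup>2 * exp (\<theta> * ?s\<^sup>2) \<le> (V * (2 * (exp (r * ?s) + exp (- (r * ?s))))) * (exp (\<eta> * ?s) + exp (- (\<eta> * ?s)))"
      using V0 by (intro mult_mono s2 e3) (auto intro!: mult_nonneg_nonneg add_nonneg_nonneg)
    finally have "exp (\<theta> * ?s\<^sup>2) \<le> 1 + \<theta> * ((V * (2 * (exp (r * ?s) + exp (- (r * ?s))))) * (exp (\<eta> * ?s) + exp (- (\<eta> * ?s))))"
      using par(2) by (simp add: mult_left_mono)
    then have "exp (\<xi> * ?s) * exp (\<theta> * ?s\<^sup>2) \<le> exp (\<xi> * ?s) * (1 + \<theta> * ((V * (2 * (exp (r * ?s) + exp (- (r * ?s))))) * (exp (\<eta> * ?s) + exp (- (\<eta> * ?s)))))"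
      by (rule mult_left_mono) simp
    also have "\<dots> = exp (\<xi> * ?s) + 2 * \<theta> * V * (\<Sum>l\<leftarrow>?L. exp (l * ?s))"
      by (simp add: algebra_simps exp_add exp_diff exp_minus divide_inverse)
    finally show ?thesis by (simp add: exp_add)
  qed
  have "(\<Sum>B\<in>?K. exp (\<xi> * s B + \<theta> * (s B)\<^sup>2)) \<le> (\<Sum>B\<in>?K. exp (\<xi> * s B) + 2 * \<theta> * V * (\<Sum>l\<leftarrow>?L. exp (l * s B)))"
    by (intro sum_mono pt)
  also have "\<dots> = (\<Sum>B\<in>?K. exp (\<xi> * s B)) + 2 * \<theta> * V * (\<Sum>l\<leftarrow>?L. \<Sum>B\<in>?K. exp (l * s B))"
    by (simp add: sum.distrib sum_distrib_left distrib_left)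
  also have "\<dots> \<le> real (card S choose k) * exp (V * \<xi>\<^sup>2) + 2 * \<theta> * V * (4 * (real (card S choose k) * exp 9))"
  proof (intro add_mono mult_left_mono mgf)
    show "(\<Sum>l\<leftarrow>?L. \<Sum>B\<in>?K. exp (l * s B)) \<le> 4 * (real (card S choose k) * exp 9)"
      using mgf9[of "\<xi> + r + \<eta>"] mgf9[of "\<xi> + r - \<eta>"] mgf9[of "\<xi> - r + \<eta>"] mgf9[of "\<xi> - r - \<eta>"] by simp
  qed (use par V0 \<xi>r r3 in auto)
  finally show ?thesis by (simp add: s_def algebra_simps)
qed

text \<open>The determinant is 1 - Z with |Z| \<le> u = \<beta> |s| \<le> 1 / 100, and - ln (1 - Z)
  \<le> Z + 2 Z^2. The term 2 x, linear in \<open>s\<close>, is kept exactly because it averages out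
  to first order; the rest is of order u^2. The constant 9 is half of 16 + 2, where y^2 \<le> 16 u^2
  comes from \<open>n \<le> 2 * m\<close> and 2 Z^2 \<le> 2 u^2.\<close>

lemma overlap_le_exp:
  fixes \<beta> n m k s :: real
  assumes \<beta>: "\<beta> \<ge> 0" and n: "\<beta> * n \<le> 1 / 100" "n \<ge> 0" and m: "m > 0" "n \<le> 2 * m" and k: "k \<le> n" and s: "\<bar>s\<bar> \<le> k"
  shows "(1 - \<beta>\<^sup>2 * (n * s))\<^sup>2 - (2 * \<beta> * (n * s) / m)\<^sup>2 > 0"
    and "(1 / sqrt ((1 - \<beta>\<^sup>2 * (n * s))\<^sup>2 - (2 * \<beta> * (n * s) / m)\<^sup>2)) ^ d
      \<le> exp (real d * \<beta>\<^sup>2 * n * s + 9 * real d * \<beta>\<^sup>2 * s\<^sup>2)"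
proof -
  define x where "x = \<beta>\<^sup>2 * (n * s)"
  define y where "y = 2 * \<beta> * (n * s) / m"
  define u where "u = \<beta> * \<bar>s\<bar>"
  define Z where "Z = 2 * x - x\<^sup>2 + y\<^sup>2"
  have u0: "0 \<le> u" using \<beta> by (simp add: u_def)
  have "\<beta> * \<bar>s\<bar> \<le> \<beta> * n" using \<beta> s k by (intro mult_left_mono) auto
  then have u1: "u \<le> 1 / 100" using n by (simp add: u_def)
  have "\<bar>x\<bar> = (\<beta> * n) * u" using \<beta> n by (simp add: x_def u_def abs_mult power2_eq_square)
  also have "\<dots> \<le> 1 / 100 * u" using n u0 by (intro mult_right_mono)
  finally have x: "\<bar>x\<bar> \<le> u / 100" by simp
  have "\<bar>y\<bar> = 2 * u * (n / m)" using \<beta> n m by (simp add: y_def u_def abs_mult)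
  also have "\<dots> \<le> 2 * u * 2" using m u0 by (intro mult_left_mono) (auto simp: field_simps)
  finally have y: "\<bar>y\<bar> \<le> 4 * u" by simp
  have y2: "y\<^sup>2 \<le> 16 * u\<^sup>2" using power_mono[OF y, of 2] by (simp add: power_mult_distrib)
  have u2: "u\<^sup>2 \<le> u / 100" using mult_right_mono[OF u1 u0] by (simp add: power2_eq_square)
  have x2: "x\<^sup>2 \<le> u\<^sup>2" using x u0 by (intro abs_le_square_iff[THEN iffD1]) simp
  have Z: "\<bar>Z\<bar> \<le> u"
    using x y2 u2 x2 u0 zero_le_power2[of x] zero_le_power2[of y] unfolding Z_def by linarith
  then have Zh: "\<bar>- Z\<bar> \<le> 1 / 2" using u1 by simp
  have Z2: "Z\<^sup>2 \<le> u\<^sup>2" using Z u0 by (intro abs_le_square_iff[THEN iffD1]) simp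
  have eq: "(1 - x)\<^sup>2 - y\<^sup>2 = 1 - Z" by (simp add: Z_def power2_eq_square algebra_simps)
  have pos: "1 - Z > 0" using Zh by simp
  then show "(1 - \<beta>\<^sup>2 * (n * s))\<^sup>2 - (2 * \<beta> * (n * s) / m)\<^sup>2 > 0"
    using eq by (simp add: x_def y_def)
  have "- Z - 2 * Z\<^sup>2 \<le> ln (1 - Z)"
    using abs_ln_one_plus_x_minus_x_bound[OF Zh] by (simp add: abs_le_iff)
  moreover have "Z + 2 * Z\<^sup>2 \<le> 2 * x + 18 * u\<^sup>2"
    using y2 Z2 zero_le_power2[of x] unfolding Z_def by linarith
  ultimately have "- ln (1 - Z) / 2 \<le> x + 9 * u\<^sup>2" by linarith
  then have "exp (- ln (1 - Z) / 2) ^ d \<le> exp (x + 9 * u\<^sup>2) ^ d" by (intro power_mono) auto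
  also have "exp (- ln (1 - Z) / 2) = 1 / sqrt (1 - Z)"
    using pos by (simp add: ln_sqrt[symmetric] exp_minus inverse_eq_divide)
  also have "exp (x + 9 * u\<^sup>2) ^ d = exp (real d * \<beta>\<^sup>2 * n * s + 9 * real d * \<beta>\<^sup>2 * s\<^sup>2)"
    by (simp add: exp_of_nat_mult[symmetric] x_def u_def power_mult_distrib algebra_simps)
  finally show "(1 / sqrt ((1 - \<beta>\<^sup>2 * (n * s))\<^sup>2 - (2 * \<beta> * (n * s) / m)\<^sup>2)) ^ d
      \<le> exp (real d * \<beta>\<^sup>2 * n * s + 9 * real d * \<beta>\<^sup>2 * s\<^sup>2)"
    using eq by (simp add: x_def y_def)
qed

section \<open>The planted distribution and its likelihood ratio\<close>

lemma gaussian_standard: "gaussian d (\<lambda>_. 0) 1 = PiM {1..d} (\<lambda>_. stdnormal)"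
  by (simp add: gaussian_def stdnormal_def)

lemma sets_gaussian [measurable_cong]: "sets (gaussian d \<mu> v) = sets (euclid d)"
  unfolding gaussian_def by (intro sets_PiM_cong) auto

lemma prob_space_gaussian: "v > 0 \<Longrightarrow> prob_space (gaussian d \<mu> v)"
  unfolding gaussian_def by (intro prob_space_PiM prob_space_normal_density) simp

lemma gaussian_eq_density:
  "gaussian d \<mu> 1 = density (gaussian d (\<lambda>_. 0) 1) (\<lambda>x. \<Prod>j\<in>{1..d}. ennreal (exp (\<mu> j * x j - (\<mu> j)\<^sup>2 / 2)))"
proof -
  have "PiM {1..d} (\<lambda>j. density stdnormal (\<lambda>x. ennreal (exp (\<mu> j * x - (\<mu> j)\<^sup>2 / 2))))
    = density (PiM {1..d} (\<lambda>_. stdnormal)) (\<lambda>x. \<Prod>j\<in>{1..d}. ennreal (exp (\<mu> j * x j - (\<mu> j)\<^sup>2 / 2)))"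
    by (rule PiM_density) (auto simp: prob_space_stdnormal density_stdnormal_shift prob_space_normal_density)
  then show ?thesis
    unfolding gaussian_standard by (simp add: density_stdnormal_shift gaussian_def)
qed

lemma nn_integral_normal_scale:
  assumes \<sigma>: "\<sigma> > 0" and [measurable]: "f \<in> borel_measurable borel"
  shows "(\<integral>\<^sup>+x. f x \<partial>density lborel (\<lambda>x. ennreal (normal_density 0 \<sigma> x))) = (\<integral>\<^sup>+x. f (\<sigma> * x) \<partial>stdnormal)"
proof -
  have "(\<integral>\<^sup>+x. f x \<partial>density lborel (\<lambda>x. ennreal (normal_density 0 \<sigma> x))) = (\<integral>\<^sup>+x. ennreal (normal_density 0 \<sigma> x) * f x \<partial>lborel)"
    by (rule nn_integral_density) auto
  also have "\<dots> = ennreal \<bar>\<sigma>\<bar> * (\<integral>\<^sup>+x. ennreal (normal_density 0 \<sigma> (0 + \<sigma> * x)) * f (0 + \<sigma> * x) \<partial>lborel)"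
    using \<sigma> by (intro nn_integral_real_affine) auto
  also have "\<dots> = (\<integral>\<^sup>+x. ennreal \<bar>\<sigma>\<bar> * (ennreal (normal_density 0 \<sigma> (0 + \<sigma> * x)) * f (0 + \<sigma> * x)) \<partial>lborel)"
    by (rule nn_integral_cmult[symmetric]) measurable
  also have "\<dots> = (\<integral>\<^sup>+x. ennreal (normal_density 0 1 x) * f (\<sigma> * x) \<partial>lborel)"
  proof (rule nn_integral_cong)
    fix x
    have "\<sigma> * normal_density 0 \<sigma> (\<sigma> * x) = normal_density 0 1 x"
      using \<sigma> by (simp add: normal_density_def real_sqrt_mult power_mult_distrib)
    then show "ennreal \<bar>\<sigma>\<bar> * (ennreal (normal_density 0 \<sigma> (0 + \<sigma> * x)) * f (0 + \<sigma> * x)) = ennreal (normal_density 0 1 x) * f (\<sigma> * x)"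
      using \<sigma> by (simp add: mult.assoc[symmetric] ennreal_mult[symmetric])
  qed
  also have "\<dots> = (\<integral>\<^sup>+x. f (\<sigma> * x) \<partial>stdnormal)"
    by (rule nn_integral_stdnormal[symmetric]) measurable
  finally show ?thesis .
qed

text \<open>Conditional law of the samples given \<open>A\<close>, isolated so that
  \<open>alt_dist\<close> becomes its uniform mixture; \<open>\<tau>\<close> is the variance of the
  latent vector.\<close>

definition planted_dist ::
    "nat \<Rightarrow> nat \<Rightarrow> real \<Rightarrow> real \<Rightarrow> nat set \<Rightarrow> (nat \<Rightarrow> nat \<Rightarrow> real) measure" where
  "planted_dist d n \<tau> \<beta> A =
    do {
      X \<leftarrow> (\<Pi>\<^sub>M i\<in>A. gaussian d (\<lambda>_. 0) 1);
      z \<leftarrow> gaussian d (\<lambda>_. 0) \<tau>;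
      Y \<leftarrow> (\<Pi>\<^sub>M i\<in>{1..n} - A. gaussian d (\<lambda>j. - \<beta> * (\<Sum>i\<in>A. X i j) - z j) 1);
      return (samples d n) (merge A ({1..n} - A) (X, Y))
    }"

definition planted_lr :: "nat \<Rightarrow> nat \<Rightarrow> real \<Rightarrow> real \<Rightarrow> nat set \<Rightarrow> (nat \<Rightarrow> nat \<Rightarrow> real) \<Rightarrow> real" where
  "planted_lr d n \<tau> \<beta> A x =
    (\<Prod>j\<in>{1..d}. shift_lr (real (card ({1..n} - A))) \<tau> \<beta> (\<Sum>i\<in>A. x i j) (\<Sum>i\<in>{1..n} - A. x i j))"

lemma measurable_double_component:
  assumes "i \<in> I" "j \<in> J"
  shows "(\<lambda>x. x i j) \<in> measurable (PiM I (\<lambda>_. PiM J (\<lambda>_. N))) N"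
  using assms by (auto intro: measurable_compose[of "\<lambda>x. x i" _ "PiM J (\<lambda>_. N)" "\<lambda>x. x j"])

text \<open>Given \<open>X\<close> and \<open>z\<close>, the remaining samples have an explicit
  density against standard normals. Integrating \<open>z\<close> out first, by exchanging integrals,
  leaves \<open>planted_lr\<close> at the merged sample. The first two conclusions are what
  averaging over \<open>A\<close> requires of a kernel.\<close>

lemma planted_dist_emeasure:
  assumes A: "A \<subseteq> {1..n}" and \<tau>: "\<tau> > 0"
  shows "planted_dist d n \<tau> \<beta> A \<in> space (subprob_algebra (samples d n))" (is ?sub)
    and "prob_space (planted_dist d n \<tau> \<beta> A)" (is ?prob)
    and "E \<in> sets (samples d n) \<Longrightarrow> emeasure (planted_dist d n \<tau> \<beta> A) E
      = (\<integral>\<^sup>+x. ennreal (planted_lr d n \<tau> \<beta> A x) * indicator E x \<partial>null_dist d n)" (is "_ \<Longrightarrow> ?em")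
proof -
  note One_nat_def [simp del]
  let ?J = "{1..d}" and ?S = "{1..n}"
  define B where "B = ?S - A"
  define m where "m = real (card B)"
  let ?G = "gaussian d (\<lambda>_. 0) 1"
  let ?P = "\<lambda>I. PiM I (\<lambda>_::nat. ?G)"
  let ?Z = "gaussian d (\<lambda>_. 0) \<tau>"
  have fin [simp]: "finite A" "finite B" using A by (auto simp: B_def intro: finite_subset)
  have AB: "A \<inter> B = {}" "A \<union> B = ?S" using A by (auto simp: B_def)
  have setsP [measurable_cong]: "sets (?P I) = sets (PiM I (\<lambda>_. euclid d))" for I
    by (intro sets_PiM_cong sets_gaussian refl)
  interpret G: prob_space ?G by (rule prob_space_gaussian) simp
  interpret Z: prob_space ?Z by (rule prob_space_gaussian) (rule \<tau>)
  interpret GP: product_prob_space "\<lambda>_. ?G" UNIV by (rule product_prob_spaceI) (rule G.prob_space_axioms)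
  interpret PA: prob_space "?P A" by (rule prob_space_PiM) (rule G.prob_space_axioms)
  interpret PB: prob_space "?P B" by (rule prob_space_PiM) (rule G.prob_space_axioms)
  define \<mu> where "\<mu> = (\<lambda>(X :: nat \<Rightarrow> nat \<Rightarrow> real) (z :: nat \<Rightarrow> real) j. - \<beta> * (\<Sum>i\<in>A. X i j) - z j)"
  define w where "w = (\<lambda>X z (y :: nat \<Rightarrow> nat \<Rightarrow> real). \<Prod>i\<in>B. \<Prod>j\<in>?J. ennreal (exp (\<mu> X z j * y i j - (\<mu> X z j)\<^sup>2 / 2)))"
  define Y where "Y = (\<lambda>X z. PiM B (\<lambda>_. gaussian d (\<mu> X z) 1))"
  define K where "K = (\<lambda>X z. Y X z \<bind> (\<lambda>y. return (samples d n) (merge A B (X, y))))"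
  have comp: "(\<lambda>x. x i j) \<in> borel_measurable (?P I)" if "i \<in> I" "j \<in> ?J" for i j I
    using measurable_double_component[OF that, of borel] unfolding measurable_cong_sets[OF setsP refl] .
  have compZ: "(\<lambda>x. x j) \<in> borel_measurable ?Z" if "j \<in> ?J" for j
    using measurable_component_singleton[OF that, of "\<lambda>_. borel"] unfolding measurable_cong_sets[OF sets_gaussian refl] .
  have \<mu>_meas: "(\<lambda>p. \<mu> (fst p) (snd p) j) \<in> borel_measurable (?P A \<Otimes>\<^sub>M ?Z)" if "j \<in> ?J" for j
    unfolding \<mu>_def using that
    by (intro borel_measurable_diff borel_measurable_times borel_measurable_const borel_measurable_sum
        measurable_compose[OF measurable_fst comp] measurable_compose[OF measurable_snd compZ])
  have w_meas [measurable]: "(\<lambda>p. w (fst (fst p)) (snd (fst p)) (snd p)) \<in> borel_measurable ((?P A \<Otimes>\<^sub>M ?Z) \<Otimes>\<^sub>M ?P B)"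
    unfolding w_def
  proof (intro borel_measurable_prod_ennreal)
    fix i j assume "i \<in> B" "j \<in> ?J"
    note [measurable] = measurable_compose[OF measurable_fst \<mu>_meas[OF \<open>j \<in> ?J\<close>]] measurable_compose[OF measurable_snd comp[OF \<open>i \<in> B\<close> \<open>j \<in> ?J\<close>]]
    show "(\<lambda>p. ennreal (exp (\<mu> (fst (fst p)) (snd (fst p)) j * snd p i j - (\<mu> (fst (fst p)) (snd (fst p)) j)\<^sup>2 / 2)))
        \<in> borel_measurable ((?P A \<Otimes>\<^sub>M ?Z) \<Otimes>\<^sub>M ?P B)"
      by measurable
  qed
  have Y: "Y X z = density (?P B) (w X z)" for X z
  proof -
    have "Y X z = PiM B (\<lambda>_. density ?G (\<lambda>x. \<Prod>j\<in>?J. ennreal (exp (\<mu> X z j * x j - (\<mu> X z j)\<^sup>2 / 2))))"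
      unfolding Y_def by (subst gaussian_eq_density) simp
    also have "\<dots> = density (?P B) (w X z)"
      unfolding w_def
    proof (rule PiM_density)
      show "(\<lambda>x. \<Prod>j\<in>?J. ennreal (exp (\<mu> X z j * x j - (\<mu> X z j)\<^sup>2 / 2))) \<in> borel_measurable ?G"
        by (intro borel_measurable_prod_ennreal) (auto simp: gaussian_standard)
      show "prob_space (density ?G (\<lambda>x. \<Prod>j\<in>?J. ennreal (exp (\<mu> X z j * x j - (\<mu> X z j)\<^sup>2 / 2))))"
        unfolding gaussian_eq_density[symmetric] by (rule prob_space_gaussian) simp
    qed (simp_all add: G.prob_space_axioms)
    finally show ?thesis .
  qed
  have probY: "prob_space (Y X z)" for X z
    unfolding Y_def by (intro prob_space_PiM prob_space_gaussian) simp
  have setsY [measurable_cong]: "sets (Y X z) = sets (?P B)" for X z by (simp add: Y)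
  have merge_meas: "(\<lambda>p. merge A B p) \<in> measurable (?P A \<Otimes>\<^sub>M ?P B) (samples d n)"
  proof -
    have "merge A B \<in> measurable (?P A \<Otimes>\<^sub>M ?P B) (?P ?S)"
      using measurable_merge[of A B "\<lambda>_. ?G"] unfolding AB(2) .
    then show ?thesis unfolding measurable_cong_sets[OF refl setsP] .
  qed
  have merge1: "(\<lambda>y. merge A B (X, y)) \<in> measurable (?P B) (samples d n)" if "X \<in> space (?P A)" for X
    using measurable_compose[OF measurable_Pair1'[OF that] merge_meas] .
  have mergeY: "(\<lambda>y. merge A B (X, y)) \<in> measurable (Y X' z) (samples d n)" if "X \<in> space (?P A)" for X X' z
    using merge1[OF that] unfolding measurable_cong_sets[OF setsY refl] .
  have K: "K X z = distr (Y X z) (samples d n) (\<lambda>y. merge A B (X, y))" if "X \<in> space (?P A)" for X z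
    unfolding K_def using probY mergeY[OF that]
    by (intro bind_return_distr') (auto simp: prob_space.not_empty)
  have probK: "prob_space (K X z)" if "X \<in> space (?P A)" for X z
    unfolding K[OF that] using probY mergeY[OF that] by (intro prob_space.prob_space_distr)
  have setsK: "sets (K X z) = sets (samples d n)" if "X \<in> space (?P A)" for X z
    by (simp add: K[OF that])
  have emK: "emeasure (K X z) E = (\<integral>\<^sup>+y. w X z y * indicator E (merge A B (X, y)) \<partial>?P B)"
    if X: "X \<in> space (?P A)" and z: "z \<in> space ?Z" and E [measurable]: "E \<in> sets (samples d n)" for X z E
  proof -
    note merge1[OF X, measurable]
    have [measurable]: "w X z \<in> borel_measurable (?P B)"
    proof -
      have "(X, z) \<in> space (?P A \<Otimes>\<^sub>M ?Z)" using X z by (simp add: space_pair_measure)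
      from measurable_compose[OF measurable_Pair1'[OF this] w_meas] show ?thesis by simp
    qed
    have "emeasure (K X z) E = (\<integral>\<^sup>+y. indicator E y \<partial>K X z)"
      by (rule nn_integral_indicator[symmetric]) (simp only: setsK[OF X] E)
    also have "\<dots> = (\<integral>\<^sup>+y. indicator E (merge A B (X, y)) \<partial>Y X z)"
      unfolding K[OF X] by (rule nn_integral_distr) (auto simp: Y)
    also have "\<dots> = (\<integral>\<^sup>+y. w X z y * indicator E (merge A B (X, y)) \<partial>?P B)"
      unfolding Y by (rule nn_integral_density) measurable
    finally show ?thesis .
  qed
  have ind_meas: "(\<lambda>p. w (fst (fst p)) (snd (fst p)) (snd p) * indicator E (merge A B (fst (fst p), snd p)))
      \<in> borel_measurable ((?P A \<Otimes>\<^sub>M ?Z) \<Otimes>\<^sub>M ?P B)" if [measurable]: "E \<in> sets (samples d n)" for E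
  proof -
    have "(\<lambda>p. merge A B (fst (fst p), snd p)) \<in> measurable ((?P A \<Otimes>\<^sub>M ?Z) \<Otimes>\<^sub>M ?P B) (samples d n)"
      by (rule measurable_compose[OF _ merge_meas]) measurable
    then have "(\<lambda>p. indicator E (merge A B (fst (fst p), snd p)) :: ennreal) \<in> borel_measurable ((?P A \<Otimes>\<^sub>M ?Z) \<Otimes>\<^sub>M ?P B)"
      by (rule measurable_compose) measurable
    then show ?thesis using w_meas by (rule borel_measurable_times_ennreal[rotated])
  qed
  \<comment> \<open>Joint measurability of the kernel is read off from the formula
    \<open>emK\<close>, an integral of a jointly measurable function.\<close>
  have K_meas: "(\<lambda>(X, z). K X z) \<in> measurable (?P A \<Otimes>\<^sub>M ?Z) (subprob_algebra (samples d n))"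
  proof (rule measurable_subprob_algebra)
    fix E assume E: "E \<in> sets (samples d n)"
    have "(\<lambda>a. \<integral>\<^sup>+y. w (fst a) (snd a) y * indicator E (merge A B (fst a, y)) \<partial>?P B) \<in> borel_measurable (?P A \<Otimes>\<^sub>M ?Z)"
      using PB.borel_measurable_nn_integral_fst[OF ind_meas[OF E]] by simp
    then show "(\<lambda>a. emeasure (case a of (X, z) \<Rightarrow> K X z) E) \<in> borel_measurable (?P A \<Otimes>\<^sub>M ?Z)"
      by (rule measurable_cong[THEN iffD1, rotated]) (auto simp: space_pair_measure emK E)
  qed (auto simp: space_pair_measure setsK intro: prob_space_imp_subprob_space probK)
  have K1: "K X \<in> measurable ?Z (subprob_algebra (samples d n))" if "X \<in> space (?P A)" for X
    using measurable_compose[OF measurable_Pair1'[OF that] K_meas] by simp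
  have Zsub: "(\<lambda>X. ?Z) \<in> measurable (?P A) (subprob_algebra ?Z)"
    by (intro measurable_const) (simp add: space_subprob_algebra Z.subprob_space_axioms)
  have ZK: "(\<lambda>X. ?Z \<bind> K X) \<in> measurable (?P A) (subprob_algebra (samples d n))"
    by (rule measurable_bind'[OF Zsub K_meas])
  have planted: "planted_dist d n \<tau> \<beta> A = ?P A \<bind> (\<lambda>X. ?Z \<bind> K X)"
    unfolding planted_dist_def K_def Y_def \<mu>_def B_def ..
  \<comment> \<open>A constant kernel on a one-point space carries the measurability rule for bind
    over to a single measure.\<close>
  have "(\<lambda>_. ?P A \<bind> (\<lambda>X. ?Z \<bind> K X)) \<in> measurable (count_space {()}) (subprob_algebra (samples d n))"
    by (rule measurable_bind'[where N="?P A"])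
       (use ZK in \<open>auto intro!: measurable_compose[OF measurable_snd] simp: space_subprob_algebra PA.subprob_space_axioms split_beta'\<close>)
  from measurable_space[OF this, of "()"] show ?sub
    unfolding planted by simp
  then have sp: "space (planted_dist d n \<tau> \<beta> A) = space (samples d n)"
    by (intro sets_eq_imp_space_eq) (simp add: space_subprob_algebra)
  show ?prob
  proof (rule prob_spaceI)
    have "emeasure (planted_dist d n \<tau> \<beta> A) (space (samples d n)) = (\<integral>\<^sup>+X. emeasure (?Z \<bind> K X) (space (samples d n)) \<partial>?P A)"
      unfolding planted by (rule emeasure_bind[OF PA.not_empty ZK]) simp
    also have "\<dots> = (\<integral>\<^sup>+X. 1 \<partial>?P A)"
    proof (rule nn_integral_cong)
      fix X assume X: "X \<in> space (?P A)"
      have "emeasure (?Z \<bind> K X) (space (samples d n)) = (\<integral>\<^sup>+z. emeasure (K X z) (space (samples d n)) \<partial>?Z)"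
        by (rule emeasure_bind[OF Z.not_empty K1[OF X]]) simp
      also have "\<dots> = (\<integral>\<^sup>+z. 1 \<partial>?Z)"
        using prob_space.emeasure_space_1[OF probK[OF X]] sets_eq_imp_space_eq[OF setsK[OF X]] by simp
      finally show "emeasure (?Z \<bind> K X) (space (samples d n)) = 1" by (simp add: Z.emeasure_space_1)
    qed
    finally show "emeasure (planted_dist d n \<tau> \<beta> A) (space (planted_dist d n \<tau> \<beta> A)) = 1"
      by (simp add: sp PA.emeasure_space_1)
  qed

  assume E: "E \<in> sets (samples d n)"
  note E [measurable]
  \<comment> \<open>Exchanging the products over samples and coordinates gives each coordinate of
    \<open>z\<close> a factor of its own, so the integral splits into \<open>d\<close>
    one-dimensional ones.\<close>
  have zint: "(\<integral>\<^sup>+z. w X z y \<partial>?Z) = ennreal (planted_lr d n \<tau> \<beta> A (merge A B (X, y)))" for X y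
  proof -
    interpret ND: product_prob_space "\<lambda>_::nat. density lborel (\<lambda>x. ennreal (normal_density 0 (sqrt \<tau>) x))" UNIV
      by (rule product_prob_spaceI) (use \<tau> in \<open>simp add: prob_space_normal_density\<close>)
    define h where "h = (\<lambda>j \<zeta>. ennreal (exp ((- \<beta> * (\<Sum>i\<in>A. X i j) - \<zeta>) * (\<Sum>i\<in>B. y i j) - m * (- \<beta> * (\<Sum>i\<in>A. X i j) - \<zeta>)\<^sup>2 / 2)))"
    have "w X z y = (\<Prod>j\<in>?J. h j (z j))" for z
    proof -
      have "w X z y = (\<Prod>j\<in>?J. \<Prod>i\<in>B. ennreal (exp (\<mu> X z j * y i j - (\<mu> X z j)\<^sup>2 / 2)))"
        unfolding w_def by (rule prod.swap)
      also have "\<dots> = (\<Prod>j\<in>?J. h j (z j))"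
        by (intro prod.cong refl)
           (simp add: prod_ennreal exp_sum[symmetric] sum_subtractf sum_distrib_left h_def m_def \<mu>_def)
      finally show ?thesis .
    qed
    then have "(\<integral>\<^sup>+z. w X z y \<partial>?Z) = (\<integral>\<^sup>+z. (\<Prod>j\<in>?J. h j (z j)) \<partial>?Z)" by simp
    also have "\<dots> = (\<Prod>j\<in>?J. \<integral>\<^sup>+\<zeta>. h j \<zeta> \<partial>density lborel (\<lambda>x. ennreal (normal_density 0 (sqrt \<tau>) x)))"
      unfolding gaussian_def by (rule ND.product_nn_integral_prod) (auto simp: h_def)
    also have "\<dots> = (\<Prod>j\<in>?J. ennreal (shift_lr m \<tau> \<beta> (\<Sum>i\<in>A. X i j) (\<Sum>i\<in>B. y i j)))"
    proof (intro prod.cong refl)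
      fix j
      have "(\<integral>\<^sup>+\<zeta>. h j \<zeta> \<partial>density lborel (\<lambda>x. ennreal (normal_density 0 (sqrt \<tau>) x))) = (\<integral>\<^sup>+\<zeta>. h j (sqrt \<tau> * \<zeta>) \<partial>stdnormal)"
        by (rule nn_integral_normal_scale) (use \<tau> in \<open>auto simp: h_def\<close>)
      also have "\<dots> = ennreal (shift_lr m \<tau> \<beta> (\<Sum>i\<in>A. X i j) (\<Sum>i\<in>B. y i j))"
        unfolding h_def using \<tau> by (intro nn_integral_shift_lr) (auto simp: m_def)
      finally show "(\<integral>\<^sup>+\<zeta>. h j \<zeta> \<partial>density lborel (\<lambda>x. ennreal (normal_density 0 (sqrt \<tau>) x)))
        = ennreal (shift_lr m \<tau> \<beta> (\<Sum>i\<in>A. X i j) (\<Sum>i\<in>B. y i j))" .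
    qed
    also have "\<dots> = ennreal (\<Prod>j\<in>?J. shift_lr m \<tau> \<beta> (\<Sum>i\<in>A. X i j) (\<Sum>i\<in>B. y i j))"
      using \<tau> by (intro prod_ennreal shift_lr_nonneg) (simp add: m_def)
    also have "(\<Prod>j\<in>?J. shift_lr m \<tau> \<beta> (\<Sum>i\<in>A. X i j) (\<Sum>i\<in>B. y i j)) = planted_lr d n \<tau> \<beta> A (merge A B (X, y))"
    proof -
      have "(\<Sum>i\<in>A. merge A B (X, y) i j) = (\<Sum>i\<in>A. X i j)" "(\<Sum>i\<in>B. merge A B (X, y) i j) = (\<Sum>i\<in>B. y i j)" for j
        using AB(1) by (auto intro!: sum.cong simp: merge_def)
      then show ?thesis by (simp add: planted_lr_def B_def[symmetric] m_def[symmetric])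
    qed
    finally show ?thesis .
  qed
  have "emeasure (planted_dist d n \<tau> \<beta> A) E = (\<integral>\<^sup>+X. emeasure (?Z \<bind> K X) E \<partial>?P A)"
    unfolding planted by (rule emeasure_bind[OF PA.not_empty ZK E])
  also have "\<dots> = (\<integral>\<^sup>+X. \<integral>\<^sup>+z. \<integral>\<^sup>+y. w X z y * indicator E (merge A B (X, y)) \<partial>?P B \<partial>?Z \<partial>?P A)"
    by (intro nn_integral_cong) (simp add: emeasure_bind[OF Z.not_empty K1 E] emK[OF _ _ E] cong: nn_integral_cong)
  also have "\<dots> = (\<integral>\<^sup>+X. \<integral>\<^sup>+y. ennreal (planted_lr d n \<tau> \<beta> A (merge A B (X, y))) * indicator E (merge A B (X, y)) \<partial>?P B \<partial>?P A)"
  proof (rule nn_integral_cong)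
    fix X assume X: "X \<in> space (?P A)"
    interpret PZ: pair_sigma_finite ?Z "?P B" ..
    have m1: "(\<lambda>(z, y). w X z y * indicator E (merge A B (X, y))) \<in> borel_measurable (?Z \<Otimes>\<^sub>M ?P B)"
    proof -
      have "(\<lambda>(z, y). ((X, z), y)) \<in> measurable (?Z \<Otimes>\<^sub>M ?P B) ((?P A \<Otimes>\<^sub>M ?Z) \<Otimes>\<^sub>M ?P B)"
        using X by measurable
      from measurable_compose[OF this ind_meas[OF E]] show ?thesis by (simp add: split_beta')
    qed
    have "(\<integral>\<^sup>+z. \<integral>\<^sup>+y. w X z y * indicator E (merge A B (X, y)) \<partial>?P B \<partial>?Z)
        = (\<integral>\<^sup>+y. \<integral>\<^sup>+z. w X z y * indicator E (merge A B (X, y)) \<partial>?Z \<partial>?P B)"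
      by (rule PZ.Fubini'[OF m1, symmetric])
    also have "\<dots> = (\<integral>\<^sup>+y. ennreal (planted_lr d n \<tau> \<beta> A (merge A B (X, y))) * indicator E (merge A B (X, y)) \<partial>?P B)"
    proof (rule nn_integral_cong)
      fix y assume y: "y \<in> space (?P B)"
      have "(\<lambda>z. ((X, z), y)) \<in> measurable ?Z ((?P A \<Otimes>\<^sub>M ?Z) \<Otimes>\<^sub>M ?P B)"
        using X y by measurable
      from measurable_compose[OF this w_meas] have "(\<lambda>z. w X z y) \<in> borel_measurable ?Z" by simp
      then show "(\<integral>\<^sup>+z. w X z y * indicator E (merge A B (X, y)) \<partial>?Z)
          = ennreal (planted_lr d n \<tau> \<beta> A (merge A B (X, y))) * indicator E (merge A B (X, y))"
        by (simp add: nn_integral_multc zint)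
    qed
    finally show "(\<integral>\<^sup>+z. \<integral>\<^sup>+y. w X z y * indicator E (merge A B (X, y)) \<partial>?P B \<partial>?Z)
      = (\<integral>\<^sup>+y. ennreal (planted_lr d n \<tau> \<beta> A (merge A B (X, y))) * indicator E (merge A B (X, y)) \<partial>?P B)" .
  qed
  also have "\<dots> = (\<integral>\<^sup>+x. ennreal (planted_lr d n \<tau> \<beta> A x) * indicator E x \<partial>?P ?S)"
  proof -
    have "(\<lambda>x. ennreal (planted_lr d n \<tau> \<beta> A x) * indicator E x) \<in> borel_measurable (?P (A \<union> B))"
      unfolding AB(2) planted_lr_def using A
      by (intro borel_measurable_times_ennreal measurable_compose[OF _ measurable_ennreal] borel_measurable_prod
          measurable_shift_lr borel_measurable_sum comp borel_measurable_indicator) (auto simp: setsP E)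
    from GP.product_nn_integral_fold[OF AB(1) fin this] show ?thesis unfolding AB(2) by simp
  qed
  finally show ?em by (simp add: null_dist_def)
qed

section \<open>The chi-square bound\<close>

text \<open>On any event the two measures differ by at most the integral of |1 - f|, whose square is
  at most the integral of (1 - f)^2. The latter is the chi-square divergence, the second moment of
  \<open>f\<close> minus 1.\<close>

lemma tv_dist_density_le:
  fixes f :: "'a \<Rightarrow> real"
  assumes M: "prob_space M" and f [measurable]: "f \<in> borel_measurable M" and f0: "\<And>x. f x \<ge> 0"
    and dens: "prob_space (density M (\<lambda>x. ennreal (f x)))"
    and chi: "(\<integral>\<^sup>+x. ennreal ((f x)\<^sup>2) \<partial>M) \<le> ennreal (1 + \<delta>\<^sup>2)" and \<delta>: "\<delta> \<ge> 0"
  shows "tv_dist M (density M (\<lambda>x. ennreal (f x))) \<le> \<delta>"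
proof -
  interpret prob_space M by fact
  interpret N: prob_space "density M (\<lambda>x. ennreal (f x))" by fact
  have "(\<integral>\<^sup>+x. ennreal (f x) \<partial>M) = 1"
    using N.emeasure_space_1 by (simp add: emeasure_density cong: nn_integral_cong)
  then have int: "integrable M f" and f1: "(\<integral>x. f x \<partial>M) = 1"
    using f0 by (auto simp: integral_eq_nn_integral intro!: integrableI_nonneg)
  have int2: "integrable M (\<lambda>x. (f x)\<^sup>2)"
    using chi by (intro integrableI_nonneg) (auto simp: le_less_trans)
  have f2: "(\<integral>x. (f x)\<^sup>2 \<partial>M) \<le> 1 + \<delta>\<^sup>2"
  proof -
    have "ennreal (\<integral>x. (f x)\<^sup>2 \<partial>M) \<le> ennreal (1 + \<delta>\<^sup>2)"
      using chi int2 by (simp add: nn_integral_eq_integral del: ennreal_plus)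
    then show ?thesis by (subst (asm) ennreal_le_iff) auto
  qed
  define g where "g = (\<lambda>x. \<bar>1 - f x\<bar>)"
  have g: "integrable M g" unfolding g_def using int by auto
  have g2eq: "(g x)\<^sup>2 = 1 - 2 * f x + (f x)\<^sup>2" for x
    by (simp add: g_def power2_eq_square algebra_simps)
  have g2: "integrable M (\<lambda>x. (g x)\<^sup>2)" unfolding g2eq using int int2 by auto
  have g2': "(\<integral>x. (g x)\<^sup>2 \<partial>M) \<le> \<delta>\<^sup>2"
    unfolding g2eq using int int2 f1 f2 by (simp add: prob_space)
  \<comment> \<open>Cauchy-Schwarz in the form that the variance of \<open>g\<close> is
    nonnegative.\<close>
  define c where "c = (\<integral>x. g x \<partial>M)"
  have "0 \<le> (\<integral>x. (g x - c)\<^sup>2 \<partial>M)" by simp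
  also have "\<dots> = (\<integral>x. (g x)\<^sup>2 - 2 * c * g x + c\<^sup>2 \<partial>M)"
    by (simp add: power2_eq_square algebra_simps)
  also have "\<dots> = (\<integral>x. (g x)\<^sup>2 \<partial>M) - c\<^sup>2"
    using g g2 by (simp add: prob_space c_def[symmetric] power2_eq_square)
  finally have "c\<^sup>2 \<le> \<delta>\<^sup>2" using g2' by simp
  then have c: "c \<le> \<delta>" using \<delta> by (rule power2_le_imp_le)
  show ?thesis
    unfolding tv_dist_def
  proof (rule cSUP_least)
    fix E assume [measurable]: "E \<in> sets M"
    have intE: "integrable M (\<lambda>x. f x * indicator E x)" using int by (rule integrable_real_mult_indicator[rotated]) simp
    have "emeasure (density M (\<lambda>x. ennreal (f x))) E = (\<integral>\<^sup>+x. ennreal (f x * indicator E x) \<partial>M)"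
      by (simp add: emeasure_density ennreal_mult'' ennreal_indicator f0)
    also have "\<dots> = ennreal (\<integral>x. f x * indicator E x \<partial>M)"
      using intE f0 by (intro nn_integral_eq_integral) auto
    finally have "measure (density M (\<lambda>x. ennreal (f x))) E = (\<integral>x. f x * indicator E x \<partial>M)"
      using f0 by (simp add: measure_def)
    then have "measure M E - measure (density M (\<lambda>x. ennreal (f x))) E = (\<integral>x. indicator E x - f x * indicator E x \<partial>M)"
      using intE by (subst Bochner_Integration.integral_diff) (auto simp: emeasure_eq_measure)
    also have "\<bar>\<dots>\<bar> \<le> (\<integral>x. g x \<partial>M)"
    proof -
      have D: "integrable M (\<lambda>x. indicator E x - f x * indicator E x)"
        using intE by (intro Bochner_Integration.integrable_diff) (auto simp: less_top[symmetric])
      then have "(\<integral>x. \<bar>indicator E x - f x * indicator E x\<bar> \<partial>M) \<le> (\<integral>x. g x \<partial>M)"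
        using g by (intro integral_mono integrable_abs) (auto simp: g_def indicator_def)
      then show ?thesis using integral_abs_bound[of M "\<lambda>x. indicator E x - f x * indicator E x"] by linarith
    qed
    finally show "\<bar>measure M E - measure (density M (\<lambda>x. ennreal (f x))) E\<bar> \<le> \<delta>"
      using c by (simp add: c_def)
  qed auto
qed

section \<open>Density of the mixture and mixed second moments of its components\<close>

lemma null_dist_stdnormal: "null_dist d n = PiM {1..n} (\<lambda>_. PiM {1..d} (\<lambda>_. stdnormal))"
  by (simp add: null_dist_def gaussian_standard)

lemma prob_space_null_dist: "prob_space (null_dist d n)"
  unfolding null_dist_stdnormal by (intro prob_space_PiM prob_space_stdnormal)

lemma sets_null_dist [measurable_cong]: "sets (null_dist d n) = sets (samples d n)"
  unfolding null_dist_def by (intro sets_PiM_cong sets_gaussian refl)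

lemma measurable_planted_lr [measurable]:
  assumes "A \<subseteq> {1..n}"
  shows "planted_lr d n \<tau> \<beta> A \<in> borel_measurable (null_dist d n)"
proof -
  have "(\<lambda>x. x i j) \<in> borel_measurable (null_dist d n)" if "i \<in> {1..n}" "j \<in> {1..d}" for i j
    using measurable_double_component[OF that, of borel] unfolding measurable_cong_sets[OF sets_null_dist refl] .
  then show ?thesis
    unfolding planted_lr_def[abs_def] using assms
    by (intro borel_measurable_prod measurable_shift_lr borel_measurable_sum) auto
qed

lemma planted_lr_nonneg: "\<tau> \<ge> 0 \<Longrightarrow> 0 \<le> planted_lr d n \<tau> \<beta> A x"
  unfolding planted_lr_def by (intro prod_nonneg shift_lr_nonneg ballI) simp

text \<open>A finite mixture has the average of the component densities as its density; the family
  must be nonempty for the uniform measure on it to have mass 1.\<close>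

lemma alt_dist_eq_density:
  fixes d n :: nat and \<epsilon> \<alpha> \<beta> :: real
  defines "\<A> \<equiv> {A. A \<subseteq> {1..n} \<and> card A = nat \<lfloor>\<epsilon> * real n\<rfloor>}"
  assumes ne: "\<A> \<noteq> {}" and \<tau>: "\<alpha>\<^sup>2 / real d > 0"
  shows "alt_dist d n \<epsilon> \<alpha> \<beta> = density (null_dist d n)
      (\<lambda>x. ennreal ((\<Sum>A\<in>\<A>. planted_lr d n (\<alpha>\<^sup>2 / real d) \<beta> A x) / real (card \<A>)))" (is "_ = ?D")
    and "prob_space (alt_dist d n \<epsilon> \<alpha> \<beta>)"
proof -
  let ?\<tau> = "\<alpha>\<^sup>2 / real d"
  let ?U = "uniform_count_measure \<A>"
  let ?p = "planted_dist d n ?\<tau> \<beta>"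
  let ?l = "planted_lr d n ?\<tau> \<beta>"
  have fin: "finite \<A>" by (simp add: \<A>_def)
  have N0: "real (card \<A>) > 0" using fin ne by (simp add: card_gt_0_iff)
  have sub: "A \<subseteq> {1..n}" if "A \<in> \<A>" for A using that by (simp add: \<A>_def)
  have alt: "alt_dist d n \<epsilon> \<alpha> \<beta> = ?U \<bind> ?p"
    unfolding alt_dist_def planted_dist_def \<A>_def ..
  have meas: "?p \<in> measurable ?U (subprob_algebra (samples d n))"
    unfolding measurable_cong_sets[OF sets_uniform_count_measure_count_space refl] measurable_count_space_eq1
    using planted_dist_emeasure(1)[OF sub \<tau>] by auto
  have sp: "space ?U \<noteq> {}" using ne by simp
  have sets: "sets (alt_dist d n \<epsilon> \<alpha> \<beta>) = sets (samples d n)"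
    unfolding alt by (rule sets_bind_measurable[OF meas sp])
  have em: "emeasure (alt_dist d n \<epsilon> \<alpha> \<beta>) E = (\<Sum>A\<in>\<A>. ennreal (1 / real (card \<A>)) * emeasure (?p A) E)"
    if "E \<in> sets (samples d n)" for E
  proof -
    have "emeasure (alt_dist d n \<epsilon> \<alpha> \<beta>) E = (\<integral>\<^sup>+A. emeasure (?p A) E \<partial>?U)"
      unfolding alt by (rule emeasure_bind[OF sp meas that])
    then show ?thesis
      unfolding uniform_count_measure_def using fin by (simp add: nn_integral_point_measure_finite)
  qed
  show "alt_dist d n \<epsilon> \<alpha> \<beta> = ?D"
  proof (rule measure_eqI)
    show "sets (alt_dist d n \<epsilon> \<alpha> \<beta>) = sets ?D" by (simp only: sets sets_density sets_null_dist)
    fix E assume "E \<in> sets (alt_dist d n \<epsilon> \<alpha> \<beta>)"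
    then have E: "E \<in> sets (samples d n)" by (simp only: sets)
    then have E' [measurable]: "E \<in> sets (null_dist d n)" by (simp only: sets_null_dist)
    note measurable_planted_lr[OF sub, measurable]
    have "emeasure (alt_dist d n \<epsilon> \<alpha> \<beta>) E
        = (\<Sum>A\<in>\<A>. ennreal (1 / real (card \<A>)) * (\<integral>\<^sup>+x. ennreal (?l A x) * indicator E x \<partial>null_dist d n))"
      unfolding em[OF E] using planted_dist_emeasure(3)[OF sub \<tau> E] by simp
    also have "\<dots> = (\<Sum>A\<in>\<A>. \<integral>\<^sup>+x. ennreal (1 / real (card \<A>)) * (ennreal (?l A x) * indicator E x) \<partial>null_dist d n)"
      by (intro sum.cong refl nn_integral_cmult[symmetric]) measurable
    also have "\<dots> = (\<integral>\<^sup>+x. (\<Sum>A\<in>\<A>. ennreal (1 / real (card \<A>)) * (ennreal (?l A x) * indicator E x)) \<partial>null_dist d n)"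
      by (intro nn_integral_sum[symmetric]) measurable
    also have "\<dots> = (\<integral>\<^sup>+x. ennreal ((\<Sum>A\<in>\<A>. ?l A x) / real (card \<A>)) * indicator E x \<partial>null_dist d n)"
    proof (rule nn_integral_cong)
      fix x
      have "(\<Sum>A\<in>\<A>. ennreal (1 / real (card \<A>)) * (ennreal (?l A x) * indicator E x))
          = (\<Sum>A\<in>\<A>. ennreal (?l A x / real (card \<A>))) * indicator E x"
        using N0 planted_lr_nonneg[of ?\<tau>] \<tau>
        by (simp add: sum_distrib_right mult.assoc[symmetric] ennreal_mult[symmetric] del: sum_ennreal)
      also have "(\<Sum>A\<in>\<A>. ennreal (?l A x / real (card \<A>))) = ennreal (\<Sum>A\<in>\<A>. ?l A x / real (card \<A>))"
        using planted_lr_nonneg[of ?\<tau>] \<tau> by (intro sum_ennreal) auto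
      finally show "(\<Sum>A\<in>\<A>. ennreal (1 / real (card \<A>)) * (ennreal (?l A x) * indicator E x))
          = ennreal ((\<Sum>A\<in>\<A>. ?l A x) / real (card \<A>)) * indicator E x"
        by (simp add: sum_divide_distrib)
    qed
    also have "\<dots> = emeasure ?D E"
      by (rule emeasure_density[symmetric]) measurable
    finally show "emeasure (alt_dist d n \<epsilon> \<alpha> \<beta>) E = emeasure ?D E" .
  qed
  show "prob_space (alt_dist d n \<epsilon> \<alpha> \<beta>)"
  proof (rule prob_spaceI)
    have "emeasure (?p A) (space (samples d n)) = 1" if "A \<in> \<A>" for A
    proof -
      have "space (?p A) = space (samples d n)"
        using planted_dist_emeasure(1)[OF sub[OF that] \<tau>] by (intro sets_eq_imp_space_eq) (simp add: space_subprob_algebra)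
      then show ?thesis using prob_space.emeasure_space_1[OF planted_dist_emeasure(2)[OF sub[OF that] \<tau>]] by metis
    qed
    then have "emeasure (alt_dist d n \<epsilon> \<alpha> \<beta>) (space (samples d n)) = (\<Sum>A\<in>\<A>. ennreal (1 / real (card \<A>)) * 1)"
      by (subst em) (auto intro!: sum.cong)
    also have "\<dots> = ennreal (\<Sum>A\<in>\<A>. 1 / real (card \<A>))" unfolding mult_1_right by (intro sum_ennreal) simp
    also have "\<dots> = 1" using N0 by simp
    finally show "emeasure (alt_dist d n \<epsilon> \<alpha> \<beta>) (space (alt_dist d n \<epsilon> \<alpha> \<beta>)) = 1"
      by (simp only: sets_eq_imp_space_eq[OF sets])
  qed
qed

text \<open>Both ratios are products over coordinates, so the integral is the d-th power of the
  overlap in a single coordinate.\<close>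

lemma nn_integral_planted_lr_mult:
  assumes d: "d \<ge> 1" and A: "A \<subseteq> {1..n}" "A' \<subseteq> {1..n}"
    and k: "real (card A) = k" "real (card A') = k" and m: "real n = k + m" "m > 0"
    and par: "\<tau> \<ge> 0" "\<beta> \<ge> 0" "\<beta>\<^sup>2 * k * m - 2 * \<beta> * k + m * \<tau> = 0" "2 * \<beta> * k * m * \<tau> < 1"
    and w: "w = real n * real (card (A \<inter> A')) - k\<^sup>2"
    and pos: "(1 - \<beta>\<^sup>2 * w)\<^sup>2 - (2 * \<beta> * w / m)\<^sup>2 > 0"
  shows "(\<integral>\<^sup>+x. ennreal (planted_lr d n \<tau> \<beta> A x * planted_lr d n \<tau> \<beta> A' x) \<partial>null_dist d n)
    = ennreal ((1 / sqrt ((1 - \<beta>\<^sup>2 * w)\<^sup>2 - (2 * \<beta> * w / m)\<^sup>2)) ^ d)"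
proof -
  let ?S = "{1..n}" and ?J = "{1..d}"
  define \<phi> where "\<phi> = (\<lambda>x. ennreal (shift_lr m \<tau> \<beta> (\<Sum>i\<in>A. x i) (\<Sum>i\<in>?S - A. x i))
      * ennreal (shift_lr m \<tau> \<beta> (\<Sum>i\<in>A'. x i) (\<Sum>i\<in>?S - A'. x i)))"
  have cB: "real (card (?S - C)) = m" if "C \<subseteq> ?S" "real (card C) = k" for C
  proof -
    have "card (?S - C) = card ?S - card C" using that by (intro card_Diff_subset) (auto intro: finite_subset)
    moreover have "card C \<le> card ?S" using that by (intro card_mono) auto
    ultimately show ?thesis using that m by (simp add: of_nat_diff)
  qed
  have n0: "n > 0" using m k by (auto intro: gr0I)
  have \<phi>_meas: "\<phi> \<in> borel_measurable (PiM ?S (\<lambda>_. stdnormal))"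
    unfolding \<phi>_def using A
    by (intro borel_measurable_times_ennreal measurable_compose[OF _ measurable_ennreal] measurable_shift_lr borel_measurable_sum) auto
  have col: "\<phi> (\<lambda>i\<in>?S. x i j) = ennreal (shift_lr m \<tau> \<beta> (\<Sum>i\<in>A. x i j) (\<Sum>i\<in>?S - A. x i j)
      * shift_lr m \<tau> \<beta> (\<Sum>i\<in>A'. x i j) (\<Sum>i\<in>?S - A'. x i j))" for x j
  proof -
    have "(\<Sum>i\<in>C. (\<lambda>i\<in>?S. x i j) i) = (\<Sum>i\<in>C. x i j)" if "C \<subseteq> ?S" for C
      using that by (intro sum.cong) auto
    then show ?thesis unfolding \<phi>_def using A m par
      by (simp add: ennreal_mult shift_lr_nonneg)
  qed
  have "(\<integral>\<^sup>+x. ennreal (planted_lr d n \<tau> \<beta> A x * planted_lr d n \<tau> \<beta> A' x) \<partial>null_dist d n)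
      = (\<integral>\<^sup>+x. (\<Prod>j\<in>?J. \<phi> (\<lambda>i\<in>?S. x i j)) \<partial>PiM ?S (\<lambda>_. PiM ?J (\<lambda>_. stdnormal)))"
    unfolding null_dist_stdnormal col planted_lr_def cB[OF A(1) k(1)] cB[OF A(2) k(2)] using m par
    by (subst prod_ennreal) (auto simp: prod.distrib shift_lr_nonneg)
  also have "\<dots> = (\<integral>\<^sup>+x. \<phi> x \<partial>PiM ?S (\<lambda>_. stdnormal)) ^ card ?J"
    using d n0 by (intro nn_integral_PiM_prod_columns[OF prob_space_stdnormal _ _ _ _ \<phi>_meas]) auto
  also have "(\<integral>\<^sup>+x. \<phi> x \<partial>PiM ?S (\<lambda>_. stdnormal)) = ennreal (1 / sqrt ((1 - \<beta>\<^sup>2 * w)\<^sup>2 - (2 * \<beta> * w / m)\<^sup>2))"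
    unfolding \<phi>_def using A k m par w pos by (intro nn_integral_shift_lr_overlap) auto
  finally show ?thesis using pos by (simp add: ennreal_power)
qed

text \<open>The second moment of the averaged ratio is a double average over pairs of sets. For
  fixed \<open>A\<close>, the average over the other set is bounded by an exponential moment of the
  centered overlap with \<xi> = d \<beta>^2 n and \<theta> = 9 d \<beta>^2, and that bound is the
  same for all \<open>A\<close>.\<close>

lemma tv_dist_null_alt_le:
  fixes d n k :: nat and \<epsilon> \<alpha> \<beta> m V :: real
  assumes d: "d \<ge> 1" and \<alpha>: "\<alpha> > 0" and k: "nat \<lfloor>\<epsilon> * real n\<rfloor> = k" and m: "real n = real k + m" "m > 0" "real n \<le> 2 * m"
    and \<beta>: "\<beta> \<ge> 0" "\<beta>\<^sup>2 * real k * m - 2 * \<beta> * real k + m * (\<alpha>\<^sup>2 / real d) = 0" "\<beta> * real n \<le> 1 / 100"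
    and V: "V = (real k)\<^sup>2 / real n" "V \<ge> 9"
    and small: "V * (real d * \<beta>\<^sup>2 * real n)\<^sup>2 \<le> 1" "V * (9 * real d * \<beta>\<^sup>2 * real k)\<^sup>2 \<le> 1"
    and chi: "exp (V * (real d * \<beta>\<^sup>2 * real n)\<^sup>2) + 8 * (9 * real d * \<beta>\<^sup>2) * V * exp 9 \<le> 1 + \<delta>\<^sup>2" "\<delta> \<ge> 0"
  shows "tv_dist (null_dist d n) (alt_dist d n \<epsilon> \<alpha> \<beta>) \<le> \<delta>"
proof -
  define \<tau> where "\<tau> = \<alpha>\<^sup>2 / real d"
  define \<A> where "\<A> = {A. A \<subseteq> {1..n} \<and> card A = k}"
  define f where "f = (\<lambda>x. (\<Sum>A\<in>\<A>. planted_lr d n \<tau> \<beta> A x) / real (card \<A>))"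
  let ?l = "planted_lr d n \<tau> \<beta>"
  let ?M = "null_dist d n"
  have \<tau>: "\<tau> > 0" using d \<alpha> by (simp add: \<tau>_def)
  have n0: "n > 0" using m by (auto intro: gr0I)
  have kn: "k \<le> n" using m by linarith
  have fin: "finite \<A>" by (simp add: \<A>_def)
  have cA: "card \<A> = n choose k" using n_subsets[of "{1..n}" k] by (simp add: \<A>_def)
  have N0: "real (card \<A>) > 0" using kn by (simp add: cA)
  then have ne: "\<A> \<noteq> {}" by auto
  \<comment> \<open>The root equation gives m \<tau> \<le> 2 \<beta> k, and \<beta> k \<le> \<beta>
    n \<le> 1 / 100, so the product is at most 4 / 10^4.\<close>
  have k\<tau>: "2 * \<beta> * real k * m * \<tau> < 1"
  proof -
    have "m * \<tau> = \<beta> * real k * (2 - \<beta> * m)" using \<beta>(2) by (simp add: \<tau>_def power2_eq_square algebra_simps)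
    also have "\<dots> \<le> \<beta> * real k * 2" using \<beta>(1) m(2) by (intro mult_left_mono) auto
    finally have mt: "m * \<tau> \<le> 2 * (\<beta> * real k)" by simp
    have "\<beta> * real k \<le> \<beta> * real n" using \<beta>(1) kn by (intro mult_left_mono) auto
    then have bk: "\<beta> * real k \<le> 1 / 100" using \<beta>(3) by simp
    have a: "2 * (\<beta> * real k) \<le> 2 * (1 / 100)" and b: "m * \<tau> \<le> 2 * (1 / 100)" using mt bk by linarith+
    have "(2 * (\<beta> * real k)) * (m * \<tau>) \<le> (2 * (1 / 100)) * (2 * (1 / 100))"
      by (rule mult_mono[OF a b]) (use m(2) \<tau> in auto)
    then show ?thesis by (simp add: mult_ac)
  qed
  have overlap: "(\<integral>\<^sup>+x. ennreal (?l A x * ?l B x) \<partial>?M)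
      \<le> ennreal (exp (real d * \<beta>\<^sup>2 * real n * (real (card (A \<inter> B)) - V)
          + 9 * real d * \<beta>\<^sup>2 * (real (card (A \<inter> B)) - V)\<^sup>2))" if AB: "A \<in> \<A>" "B \<in> \<A>" for A B
  proof -
    define s where "s = real (card (A \<inter> B)) - V"
    have ns: "real n * s = real n * real (card (A \<inter> B)) - (real k)\<^sup>2"
      using n0 by (simp add: s_def V algebra_simps)
    have "card (A \<inter> B) \<le> card A" using AB by (intro card_mono) (auto simp: \<A>_def intro: finite_subset)
    moreover have "V \<le> real k"
      using kn n0 by (simp add: V field_simps power2_eq_square mult_left_mono)
    ultimately have s: "\<bar>s\<bar> \<le> real k" using V(2) AB by (auto simp: s_def \<A>_def)
    note * = overlap_le_exp[OF \<beta>(1) \<beta>(3) _ m(2,3) _ s]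
    have "(\<integral>\<^sup>+x. ennreal (?l A x * ?l B x) \<partial>?M)
      = ennreal ((1 / sqrt ((1 - \<beta>\<^sup>2 * (real n * s))\<^sup>2 - (2 * \<beta> * (real n * s) / m)\<^sup>2)) ^ d)"
      using AB d m \<tau> \<beta> k\<tau> ns kn
      by (intro nn_integral_planted_lr_mult[where k="real k"] *(1)) (auto simp: \<A>_def \<tau>_def)
    also have "\<dots> \<le> ennreal (exp (real d * \<beta>\<^sup>2 * real n * s + 9 * real d * \<beta>\<^sup>2 * s\<^sup>2))"
      using kn by (intro ennreal_leI *(2)) auto
    finally show ?thesis by (simp add: s_def)
  qed
  have l0: "0 \<le> ?l A x" for A x using \<tau> by (intro planted_lr_nonneg) simp
  have f0: "f x \<ge> 0" for x unfolding f_def by (intro divide_nonneg_nonneg sum_nonneg l0) simp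
  have [measurable]: "?l A \<in> borel_measurable ?M" if "A \<in> \<A>" for A
    using that by (intro measurable_planted_lr) (simp add: \<A>_def)
  have "(\<integral>\<^sup>+x. ennreal ((f x)\<^sup>2) \<partial>?M)
      = (\<integral>\<^sup>+x. ennreal (1 / (real (card \<A>))\<^sup>2) * (\<Sum>A\<in>\<A>. \<Sum>B\<in>\<A>. ennreal (?l A x * ?l B x)) \<partial>?M)"
  proof (rule nn_integral_cong)
    fix x
    have "(f x)\<^sup>2 = 1 / (real (card \<A>))\<^sup>2 * (\<Sum>A\<in>\<A>. \<Sum>B\<in>\<A>. ?l A x * ?l B x)"
      by (simp add: f_def power_divide sum_product[symmetric] power2_eq_square)
    then show "ennreal ((f x)\<^sup>2) = ennreal (1 / (real (card \<A>))\<^sup>2) * (\<Sum>A\<in>\<A>. \<Sum>B\<in>\<A>. ennreal (?l A x * ?l B x))"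
      using l0 by (simp add: ennreal_mult[symmetric] sum_nonneg)
  qed
  also have "\<dots> = ennreal (1 / (real (card \<A>))\<^sup>2) * (\<Sum>A\<in>\<A>. \<Sum>B\<in>\<A>. \<integral>\<^sup>+x. ennreal (?l A x * ?l B x) \<partial>?M)"
    by (subst nn_integral_cmult) (auto simp: nn_integral_sum)
  also have "\<dots> \<le> ennreal (1 / (real (card \<A>))\<^sup>2) * (\<Sum>A\<in>\<A>. \<Sum>B\<in>\<A>. ennreal (exp (real d * \<beta>\<^sup>2 * real n * (real (card (A \<inter> B)) - V)
          + 9 * real d * \<beta>\<^sup>2 * (real (card (A \<inter> B)) - V)\<^sup>2)))"
    by (intro mult_left_mono sum_mono overlap) auto
  also have "\<dots> = ennreal (1 / (real (card \<A>))\<^sup>2 * (\<Sum>A\<in>\<A>. \<Sum>B\<in>\<A>. exp (real d * \<beta>\<^sup>2 * real n * (real (card (A \<inter> B)) - V)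
          + 9 * real d * \<beta>\<^sup>2 * (real (card (A \<inter> B)) - V)\<^sup>2)))"
    by (simp add: ennreal_mult[symmetric] sum_nonneg)
  also have "\<dots> \<le> ennreal (1 + \<delta>\<^sup>2)"
  proof (rule ennreal_leI)
    have row: "(\<Sum>B\<in>\<A>. exp (real d * \<beta>\<^sup>2 * real n * (real (card (A \<inter> B)) - V)
          + 9 * real d * \<beta>\<^sup>2 * (real (card (A \<inter> B)) - V)\<^sup>2)) \<le> real (card \<A>) * (1 + \<delta>\<^sup>2)" if "A \<in> \<A>" for A
    proof -
      have "(\<Sum>B\<in>\<A>. exp (real d * \<beta>\<^sup>2 * real n * (real (card (A \<inter> B)) - V)
          + 9 * real d * \<beta>\<^sup>2 * (real (card (A \<inter> B)) - V)\<^sup>2))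
          \<le> real (card {1..n} choose k) * (exp (V * (real d * \<beta>\<^sup>2 * real n)\<^sup>2) + 8 * (9 * real d * \<beta>\<^sup>2) * V * exp 9)"
        unfolding \<A>_def using that n0 V small
        by (intro sum_exp_quadratic_card_Int_le) (auto simp: \<A>_def)
      also have "\<dots> \<le> real (card {1..n} choose k) * (1 + \<delta>\<^sup>2)"
        by (intro mult_left_mono chi) simp
      finally show ?thesis by (simp add: cA)
    qed
    have "(\<Sum>A\<in>\<A>. \<Sum>B\<in>\<A>. exp (real d * \<beta>\<^sup>2 * real n * (real (card (A \<inter> B)) - V)
          + 9 * real d * \<beta>\<^sup>2 * (real (card (A \<inter> B)) - V)\<^sup>2)) \<le> (\<Sum>A\<in>\<A>. real (card \<A>) * (1 + \<delta>\<^sup>2))"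
      by (intro sum_mono row)
    also have "\<dots> = (real (card \<A>))\<^sup>2 * (1 + \<delta>\<^sup>2)" by (simp add: power2_eq_square)
    finally show "1 / (real (card \<A>))\<^sup>2 * (\<Sum>A\<in>\<A>. \<Sum>B\<in>\<A>. exp (real d * \<beta>\<^sup>2 * real n * (real (card (A \<inter> B)) - V)
          + 9 * real d * \<beta>\<^sup>2 * (real (card (A \<inter> B)) - V)\<^sup>2)) \<le> 1 + \<delta>\<^sup>2"
      using N0 by (simp add: field_simps)
  qed
  finally have chi2: "(\<integral>\<^sup>+x. ennreal ((f x)\<^sup>2) \<partial>?M) \<le> ennreal (1 + \<delta>\<^sup>2)" .
  have alt: "alt_dist d n \<epsilon> \<alpha> \<beta> = density ?M (\<lambda>x. ennreal (f x))" and prob: "prob_space (alt_dist d n \<epsilon> \<alpha> \<beta>)"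
    using alt_dist_eq_density[of n \<epsilon> \<alpha> d \<beta>] ne \<tau> unfolding k f_def \<A>_def[symmetric] \<tau>_def by auto
  show ?thesis
    unfolding alt using chi2 f0 prob_space_null_dist prob[unfolded alt] chi(2)
    by (intro tv_dist_density_le) (auto simp: f_def)
qed

text \<open>In the variable v = \<beta> m the equation reads v^2 - 2 v + \<omega> = 0 with \<omega>
  = m^2 \<tau> / k. Its smaller root 1 - sqrt (1 - \<omega>) is at most \<omega>, because sqrt (1 -
  \<omega>) \<ge> 1 - \<omega> on the unit interval.\<close>

lemma variance_matching_root:
  fixes k m \<tau> :: real
  assumes k: "k > 0" and m: "m > 0" and \<tau>: "\<tau> \<ge> 0" and small: "m\<^sup>2 * \<tau> / k \<le> 1"
  obtains \<beta> where "\<beta> \<ge> 0" "\<beta>\<^sup>2 * k * m - 2 * \<beta> * k + m * \<tau> = 0" "\<beta> * m \<le> m\<^sup>2 * \<tau> / k"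
proof -
  define \<omega> where "\<omega> = m\<^sup>2 * \<tau> / k"
  define q where "q = sqrt (1 - \<omega>)"
  have \<omega>: "0 \<le> \<omega>" "\<omega> \<le> 1" using assms by (auto simp: \<omega>_def)
  have q: "0 \<le> q" "q \<le> 1" "q\<^sup>2 = 1 - \<omega>" using \<omega> by (auto simp: q_def)
  have q2: "1 - \<omega> \<le> q"
    unfolding q(3)[symmetric] using mult_right_mono[OF q(2,1)] by (simp add: power2_eq_square)
  define \<beta> where "\<beta> = (1 - q) / m"
  have \<beta>m: "\<beta> * m = 1 - q" using m by (simp add: \<beta>_def)
  have "\<beta>\<^sup>2 * k * m - 2 * \<beta> * k + m * \<tau> = k / m * ((\<beta> * m)\<^sup>2 - 2 * (\<beta> * m) + \<omega>)"
    using k m by (simp add: \<omega>_def field_simps power2_eq_square)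
  also have "(\<beta> * m)\<^sup>2 - 2 * (\<beta> * m) + \<omega> = q\<^sup>2 - (1 - \<omega>)"
    unfolding \<beta>m by (simp add: power2_eq_square algebra_simps)
  finally have "\<beta>\<^sup>2 * k * m - 2 * \<beta> * k + m * \<tau> = 0" using q(3) by simp
  moreover have "\<beta> \<ge> 0" using q m by (simp add: \<beta>_def)
  moreover have "\<beta> * m \<le> m\<^sup>2 * \<tau> / k" using q2 unfolding \<beta>m \<omega>_def[symmetric] by simp
  ultimately show ?thesis using that by blast
qed

text \<open>The size conditions are first made polynomial: \<open>H1\<close> is the first upper
  bound cubed, \<open>H2\<close> the second one, \<open>H3\<close> the first lower bound squared,
  \<open>H4\<close> the second one. With \<beta> \<le> 2 \<alpha>^2 / (d \<epsilon>) inserted, the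
  smallness conditions of \<open>tv_dist_null_alt_le\<close> reduce to inequalities between
  monomials.\<close>

lemma tv_dist_null_alt_le_tenth:
  fixes d n :: nat and \<epsilon> \<alpha> c :: real
  defines "c \<equiv> 1 / 10 ^ 9"
  assumes d: "d \<ge> 1" and \<epsilon>: "0 \<le> \<epsilon>" and \<alpha>: "0 < \<alpha>" "\<alpha> \<le> 1" and int: "\<epsilon> * real n \<in> \<int>"
    and ub: "real n \<le> c * min (real d powr (2/3) * \<epsilon> powr (2/3) / \<alpha> powr (8/3)) (real d * \<epsilon> / \<alpha>\<^sup>2)"
    and lb: "real n \<ge> sqrt (real d) / \<alpha>\<^sup>2 + real d * \<epsilon> ^ 3 / \<alpha> ^ 4"
  shows "\<exists>\<beta>\<ge>0. tv_dist (null_dist d n) (alt_dist d n \<epsilon> \<alpha> \<beta>) \<le> 0.1"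
proof -
  have c: "0 < c" "c \<le> 1 / 10 ^ 9" by (auto simp: c_def)
  have d0: "real d > 0" using d by simp
  have "sqrt (real d) / \<alpha>\<^sup>2 > 0" using d0 \<alpha> by simp
  moreover have r3: "real d * \<epsilon> ^ 3 / \<alpha> ^ 4 \<ge> 0" using \<epsilon> by simp
  ultimately have n0: "real n > 0" using lb by linarith
  have ub1: "real n \<le> c * (real d powr (2/3) * \<epsilon> powr (2/3) / \<alpha> powr (8/3))" (is "_ \<le> c * ?P")
    using ub c by (smt (verit) min.cobounded1 mult_left_mono)
  have "real n \<le> c * (real d * \<epsilon> / \<alpha>\<^sup>2)"
    using ub c by (smt (verit) min.cobounded2 mult_left_mono)
  then have H2: "real n * \<alpha>\<^sup>2 \<le> c * real d * \<epsilon>" using \<alpha> by (simp add: field_simps)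
  \<comment> \<open>At \<open>\<epsilon> = 0\<close> the upper bound would force n \<alpha>^2 \<le>
    0, against the lower bound, which makes \<open>n\<close> positive.\<close>
  have "\<epsilon> \<noteq> 0"
  proof
    assume "\<epsilon> = 0"
    then have "real n * \<alpha>\<^sup>2 \<le> 0" using H2 by simp
    moreover have "real n * \<alpha>\<^sup>2 > 0" using n0 \<alpha> by simp
    ultimately show False by simp
  qed
  then have \<epsilon>0: "\<epsilon> > 0" using \<epsilon> by simp
  have H1: "real n ^ 3 * \<alpha> ^ 8 \<le> c ^ 3 * (real d)\<^sup>2 * \<epsilon>\<^sup>2"
  proof -
    have cube: "(x powr (a / 3)) ^ 3 = x powr a" if "x > 0" for x a :: real
      using that by (simp add: powr_power)
    have "real n ^ 3 \<le> (c * ?P) ^ 3" using ub1 by (intro power_mono) auto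
    also have "\<dots> = c ^ 3 * ((real d powr (2/3)) ^ 3 * (\<epsilon> powr (2/3)) ^ 3 / (\<alpha> powr (8/3)) ^ 3)"
      by (simp add: power_mult_distrib power_divide)
    also have "\<dots> = c ^ 3 * ((real d)\<^sup>2 * \<epsilon>\<^sup>2 / \<alpha> ^ 8)"
      unfolding cube[OF d0] cube[OF \<epsilon>0] cube[OF \<alpha>(1)] using d0 \<epsilon>0 \<alpha> by (simp add: powr_numeral)
    finally show ?thesis using \<alpha> by (simp add: field_simps)
  qed
  have "sqrt (real d) / \<alpha>\<^sup>2 \<le> real n" using lb r3 by linarith
  then have "sqrt (real d) \<le> real n * \<alpha>\<^sup>2" using \<alpha> by (simp add: field_simps)
  then have "(sqrt (real d))\<^sup>2 \<le> (real n * \<alpha>\<^sup>2)\<^sup>2" by (intro power_mono) auto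
  then have H3: "real d \<le> (real n)\<^sup>2 * \<alpha> ^ 4" by (simp add: power_mult_distrib)
  have "real d * \<epsilon> ^ 3 / \<alpha> ^ 4 \<le> real n" using lb \<open>sqrt (real d) / \<alpha>\<^sup>2 > 0\<close> by linarith
  then have H4: "real d * \<epsilon> ^ 3 \<le> real n * \<alpha> ^ 4" using \<alpha> by (simp add: field_simps)
  have \<alpha>2: "\<alpha>\<^sup>2 \<le> 1" using \<alpha> by (simp add: power_le_one)
  \<comment> \<open>Chain d \<epsilon>^3 \<le> (n \<alpha>^2) \<alpha>^2 \<le> c d \<epsilon>. It
    yields \<epsilon> \<le> 1 / 2 and thereby n \<le> 2 m.\<close>
  have \<epsilon>2: "\<epsilon>\<^sup>2 \<le> c"
  proof -
    have "(real d * \<epsilon>) * \<epsilon>\<^sup>2 = real d * \<epsilon> ^ 3" by (simp add: power2_eq_square power3_eq_cube)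
    also have "\<dots> \<le> (real n * \<alpha>\<^sup>2) * \<alpha>\<^sup>2" using H4 by (simp add: power2_eq_square power4_eq_xxxx mult_ac)
    also have "\<dots> \<le> (c * real d * \<epsilon>) * 1" by (rule mult_mono[OF H2 \<alpha>2]) (use c d0 \<epsilon>0 in auto)
    also have "\<dots> = (real d * \<epsilon>) * c" by simp
    finally show ?thesis using d0 \<epsilon>0 by (simp add: mult_le_cancel_left_pos)
  qed
  have "\<epsilon>\<^sup>2 \<le> (1 / 2)\<^sup>2" using \<epsilon>2 c by (simp add: power2_eq_square)
  then have \<epsilon>h: "\<epsilon> \<le> 1 / 2" by (rule power2_le_imp_le) simp
  define k where "k = nat \<lfloor>\<epsilon> * real n\<rfloor>"
  have k: "real k = \<epsilon> * real n"
    using int \<epsilon>0 by (auto simp: k_def elim!: Ints_cases)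
  define m where "m = real n - real k"
  have m: "real n = real k + m" "real n \<le> 2 * m" "m \<le> real n"
    using mult_right_mono[OF \<epsilon>h, of "real n"] \<epsilon>0 by (auto simp: m_def k)
  then have m0: "m > 0" using n0 by linarith
  have k0: "real k > 0" using k \<epsilon>0 n0 by simp
  define \<tau> where "\<tau> = \<alpha>\<^sup>2 / real d"
  have \<tau>0: "\<tau> \<ge> 0" by (simp add: \<tau>_def)
  have \<omega>1: "m\<^sup>2 * \<tau> / real k \<le> real n * \<alpha>\<^sup>2 / (real d * \<epsilon>)"
  proof -
    have "m\<^sup>2 * \<tau> / real k \<le> (real n)\<^sup>2 * \<tau> / real k"
      using m m0 \<tau>0 k0 by (intro divide_right_mono mult_right_mono power_mono) auto
    also have "\<dots> = real n * \<alpha>\<^sup>2 / (real d * \<epsilon>)"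
      using n0 \<epsilon>0 d0 by (simp add: k \<tau>_def power2_eq_square)
    finally show ?thesis .
  qed
  also have \<omega>2: "real n * \<alpha>\<^sup>2 / (real d * \<epsilon>) \<le> c" using H2 d0 \<epsilon>0 by (simp add: field_simps)
  finally have "m\<^sup>2 * \<tau> / real k \<le> 1" using c by simp
  then obtain \<beta> where \<beta>: "\<beta> \<ge> 0" "\<beta>\<^sup>2 * real k * m - 2 * \<beta> * real k + m * \<tau> = 0" "\<beta> * m \<le> m\<^sup>2 * \<tau> / real k"
    using variance_matching_root[OF k0 m0 \<tau>0] by blast
  have "\<beta> * real n \<le> \<beta> * (2 * m)" using \<beta>(1) m by (intro mult_left_mono) auto
  also have "\<dots> \<le> 2 * (real n * \<alpha>\<^sup>2 / (real d * \<epsilon>))" using \<beta>(3) \<omega>1 by simp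
  finally have \<beta>n: "\<beta> * real n \<le> 2 * (real n * \<alpha>\<^sup>2 / (real d * \<epsilon>))" .
  then have \<beta>n': "\<beta> * real n \<le> 1 / 100" using \<omega>2 c by simp
  have "real n * \<beta> \<le> real n * (2 * \<alpha>\<^sup>2 / (real d * \<epsilon>))" using \<beta>n by (simp add: mult_ac)
  then have \<beta>b: "\<beta> \<le> 2 * \<alpha>\<^sup>2 / (real d * \<epsilon>)" using n0 by (simp only: mult_le_cancel_left_pos)
  have \<beta>2: "\<beta>\<^sup>2 \<le> 4 * \<alpha> ^ 4 / ((real d)\<^sup>2 * \<epsilon>\<^sup>2)"
    using power_mono[OF \<beta>b \<beta>(1), of 2] by (simp add: power_divide power_mult_distrib)
  define V where "V = (real k)\<^sup>2 / real n"
  have V: "V = \<epsilon>\<^sup>2 * real n" using n0 by (simp add: V_def k power2_eq_square)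
  have V0: "V \<ge> 0" by (simp add: V_def)
  have c3: "c ^ 3 \<le> 1 / 10 ^ 9"
    by (simp add: c_def power_divide)
  \<comment> \<open>Inserting d \<le> n^2 \<alpha>^4 into the cubed upper bound and cancelling n^3
    \<alpha>^8 leaves 1 \<le> c^3 \<epsilon>^2 n.\<close>
  have V1: "1 \<le> c ^ 3 * V"
  proof -
    have "real n ^ 3 * \<alpha> ^ 8 \<le> c ^ 3 * (real d)\<^sup>2 * \<epsilon>\<^sup>2" by (rule H1)
    also have "\<dots> \<le> c ^ 3 * ((real n)\<^sup>2 * \<alpha> ^ 4)\<^sup>2 * \<epsilon>\<^sup>2"
      using H3 c d0 by (intro mult_right_mono mult_left_mono power_mono) auto
    also have "\<dots> = (real n ^ 3 * \<alpha> ^ 8) * (c ^ 3 * V)"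
      unfolding V by (simp add: eval_nat_numeral)
    finally show ?thesis using n0 \<alpha> by (simp add: mult_le_cancel_left1)
  qed
  have V9: "V \<ge> 9"
  proof -
    have "1 \<le> 1 / 10 ^ 9 * V" using V1 mult_right_mono[OF c3 V0] by linarith
    then show ?thesis by simp
  qed
  have dn: "real d * \<beta>\<^sup>2 \<le> 4 * \<alpha> ^ 4 / (real d * \<epsilon>\<^sup>2)"
    using mult_left_mono[OF \<beta>2, of "real d"] d0 by (simp add: power2_eq_square)
  have R: "real n ^ 3 * \<alpha> ^ 8 / ((real d)\<^sup>2 * \<epsilon>\<^sup>2) \<le> c ^ 3" using H1 d0 \<epsilon>0 by (simp add: field_simps)
  \<comment> \<open>After the bound on \<beta> is inserted, this is 16 times the quotient that
    \<open>H1\<close> controls.\<close>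
  have s1: "V * (real d * \<beta>\<^sup>2 * real n)\<^sup>2 \<le> 16 * c ^ 3"
  proof -
    have "V * (real d * \<beta>\<^sup>2 * real n)\<^sup>2 \<le> V * (4 * \<alpha> ^ 4 / (real d * \<epsilon>\<^sup>2) * real n)\<^sup>2"
      using V0 dn by (intro mult_left_mono power_mono mult_right_mono) auto
    also have "\<dots> = 16 * (real n ^ 3 * \<alpha> ^ 8 / ((real d)\<^sup>2 * \<epsilon>\<^sup>2))"
      unfolding V using d0 \<epsilon>0 by (simp add: field_simps eval_nat_numeral)
    also have "\<dots> \<le> 16 * c ^ 3" using R by simp
    finally show ?thesis .
  qed
  have s2: "V * (9 * real d * \<beta>\<^sup>2 * real k)\<^sup>2 \<le> 1"
  proof -
    have "V * (9 * real d * \<beta>\<^sup>2 * real k)\<^sup>2 = 81 * \<epsilon>\<^sup>2 * (V * (real d * \<beta>\<^sup>2 * real n)\<^sup>2)"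
      by (simp add: k power_mult_distrib)
    also have "\<dots> \<le> 81 * c * (16 * c ^ 3)"
      by (rule mult_mono[OF _ s1]) (use \<epsilon>2 c V0 in auto)
    also have "\<dots> \<le> 1" by (simp add: c_def power_divide)
    finally show ?thesis .
  qed
  \<comment> \<open>The quantity is at most 4 times n \<alpha>^2 / (d \<epsilon>) times \<epsilon>
    \<alpha>^2; the second upper bound controls the middle factor by \<open>c\<close>, and the last
    one is at most 1.\<close>
  have s3: "real d * \<beta>\<^sup>2 * V \<le> 4 * c"
  proof -
    have "real d * \<beta>\<^sup>2 * V \<le> 4 * \<alpha> ^ 4 / (real d * \<epsilon>\<^sup>2) * V" using dn V0 by (rule mult_right_mono)
    also have "\<dots> = 4 * (real n * \<alpha>\<^sup>2 / (real d * \<epsilon>)) * (\<epsilon> * \<alpha>\<^sup>2)"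
      unfolding V using d0 \<epsilon>0 by (simp add: field_simps eval_nat_numeral)
    also have "\<dots> \<le> 4 * c * (1 * 1)"
    proof (rule mult_mono)
      show "\<epsilon> * \<alpha>\<^sup>2 \<le> 1 * 1" by (rule mult_mono[OF _ \<alpha>2]) (use \<epsilon>h in auto)
    qed (use \<omega>2 c \<epsilon>0 in auto)
    finally show ?thesis by simp
  qed
  \<comment> \<open>The budget is 0.01: little more than 0.001 for the linear part, and 288 c 3^9 <
    0.006 for the quadratic part, where exp 9 is bounded by 3^9. The latter dictates the size of
    \<open>c\<close>.\<close>
  have "exp (V * (real d * \<beta>\<^sup>2 * real n)\<^sup>2) + 8 * (9 * real d * \<beta>\<^sup>2) * V * exp 9 \<le> 1 + 0.1\<^sup>2"
  proof -
    have "V * (real d * \<beta>\<^sup>2 * real n)\<^sup>2 \<le> 1 / 1000" using s1 c3 by simp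
    then have "exp (V * (real d * \<beta>\<^sup>2 * real n)\<^sup>2) \<le> exp (1 / 1000)" by simp
    also have "\<dots> \<le> 1 + 1 / 1000 + (1 / 1000)\<^sup>2" by (rule exp_bound) auto
    finally have e1: "exp (V * (real d * \<beta>\<^sup>2 * real n)\<^sup>2) \<le> 1 + 1 / 1000 + (1 / 1000)\<^sup>2" .
    have "exp (9::real) = exp 1 ^ 9" by (simp add: exp_of_nat_mult[symmetric])
    also have "\<dots> \<le> 3 ^ 9" using exp_le by (intro power_mono) auto
    finally have e9: "exp (9::real) \<le> 3 ^ 9" .
    have "72 * (real d * \<beta>\<^sup>2 * V) * exp 9 \<le> 72 * (4 * c) * 3 ^ 9"
      by (rule mult_mono[OF mult_left_mono[OF s3] e9]) (use c in auto)
    then have "8 * (9 * real d * \<beta>\<^sup>2) * V * exp 9 \<le> 72 * (4 * c) * 3 ^ 9" by (simp add: mult_ac)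
    also have "\<dots> \<le> 6 / 1000" by (simp add: c_def)
    finally have e2: "8 * (9 * real d * \<beta>\<^sup>2) * V * exp 9 \<le> 6 / 1000" .
    have "1 + 1 / 1000 + (1 / 1000)\<^sup>2 + 6 / 1000 \<le> (1 + 0.1\<^sup>2 :: real)" by (simp add: power2_eq_square)
    with add_mono[OF e1 e2] show ?thesis by (rule order_trans)
  qed
  moreover have "V * (real d * \<beta>\<^sup>2 * real n)\<^sup>2 \<le> 1" using s1 c3 by simp
  ultimately have "tv_dist (null_dist d n) (alt_dist d n \<epsilon> \<alpha> \<beta>) \<le> 0.1"
    using d \<alpha>(1) k_def[symmetric] m(1) m0 m(2) \<beta>(1) \<beta>(2)[unfolded \<tau>_def] \<beta>n' V_def V9 s2
    by (intro tv_dist_null_alt_le) auto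
  then show ?thesis using \<beta>(1) by blast
qed

theorem theorem6p1:
  shows "\<exists>c>0. \<forall>(d::nat) (n::nat) (\<epsilon>::real) (\<alpha>::real).
    d \<ge> 1 \<longrightarrow> 0 \<le> \<epsilon> \<longrightarrow> 0 < \<alpha> \<longrightarrow> \<epsilon> \<le> \<alpha> \<longrightarrow> \<alpha> \<le> 1 \<longrightarrow> \<epsilon> * real n \<in> \<int> \<longrightarrow>
    real n \<le> c * min (real d powr (2/3) * \<epsilon> powr (2/3) / \<alpha> powr (8/3)) (real d * \<epsilon> / \<alpha>\<^sup>2) \<longrightarrow>
    real n \<ge> sqrt (real d) / \<alpha>\<^sup>2 + real d * \<epsilon> ^ 3 / \<alpha> ^ 4 \<longrightarrow>
    (\<exists>\<beta>\<ge>0. tv_dist (null_dist d n) (alt_dist d n \<epsilon> \<alpha> \<beta>) \<le> 0.1)"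
  by (rule exI[of _ "1 / 10 ^ 9"]) (use tv_dist_null_alt_le_tenth in auto)

end
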